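(* Let $G$ be a finitely generated group and let $\Gamma=(V,E)$ be a Cayley graph of $G$ (with respect to a finite symmetric generating set). Assume there are constants $K_1,K_2>0$ and $\gamma\in(0,1)$ such that the return probability of the simple random walk on $\Gamma$ satisfies $\rho_n\ge K_1e^{-K_2n^{\gamma}}$ for every even $n\geq 1$. Then, for every $p\in(1,\infty)$, there is no non-constant harmonic function $f:V\to\mathbb{R}$ on $\Gamma$ with $\nabla f\in\ell^pE$.
   Context: Graphs have a symmetric edge set $E\subset V\times V$; $N(x)$ is the set of neighbours of a vertex $x$. Functions are real-valued. The gradient of $f:V\to\mathbb{R}$ is $\nabla f(x,y)=f(y)-f(x)$ for $(x,y)\in E$, and $\nabla f\in\ell^pE$ means that $\sum_{(x,y)\in E}|f(y)-f(x)|^p<\infty$. A function $f$ is harmonic if $f(x)=\frac1{|N(x)|}\sum_{y\in N(x)}f(y)$ for all $x\in V$. The random walk operator is $(Pf)(x)=\frac1{|N(x)|}\sum_{y\in N(x)}f(y)$, and $\rho_n=(P^n\delta_e)(e)$ is the probability that the simple random walk started at the identity $e$ is back at $e$ after $n$ steps. *)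

theory Defs
  imports "HOL-Analysis.Analysis" "HOL-Algebra.Generated_Groups"
begin

definition neighbours :: "('a \<times> 'a) set \<Rightarrow> 'a \<Rightarrow> 'a set" where
  "neighbours E x = {y. (x, y) \<in> E}"

definition walk_operator :: "('a \<times> 'a) set \<Rightarrow> ('a \<Rightarrow> real) \<Rightarrow> 'a \<Rightarrow> real" where
  "walk_operator E f x = (1 / real (card (neighbours E x))) * (\<Sum>y\<in>neighbours E x. f y)"

definition harmonic_on :: "'a set \<Rightarrow> ('a \<times> 'a) set \<Rightarrow> ('a \<Rightarrow> real) \<Rightarrow> bool" where
  "harmonic_on V E f \<longleftrightarrow>
     (\<forall>x\<in>V. f x = (1 / real (card (neighbours E x))) * (\<Sum>y\<in>neighbours E x. f y))"

definition gradient :: "('a \<Rightarrow> real) \<Rightarrow> 'a \<times> 'a \<Rightarrow> real" where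
  "gradient f = (\<lambda>(x, y). f y - f x)"

definition in_lp :: "real \<Rightarrow> 'b set \<Rightarrow> ('b \<Rightarrow> real) \<Rightarrow> bool" where
  "in_lp p A g \<longleftrightarrow> (\<lambda>a. \<bar>g a\<bar> powr p) summable_on A"

definition return_probability :: "('a \<times> 'a) set \<Rightarrow> 'a \<Rightarrow> nat \<Rightarrow> real" where
  "return_probability E e n = (walk_operator E ^^ n) (indicat_real {e}) e"

text \<open>The identity is not excluded from a generating set (it would contribute a loop at every
  vertex), and finiteness of \<open>S\<close> makes \<open>G\<close> finitely generated.\<close>

definition symmetric_generating_set :: "('a, 'b) monoid_scheme \<Rightarrow> 'a set \<Rightarrow> bool" where
  "symmetric_generating_set G S \<longleftrightarrow>
     S \<subseteq> carrier G \<and> (\<forall>s\<in>S. inv\<^bsub>G\<^esub> s \<in> S) \<and> generate G S = carrier G"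

definition cayley_edges :: "('a, 'b) monoid_scheme \<Rightarrow> 'a set \<Rightarrow> ('a \<times> 'a) set" where
  "cayley_edges G S = {(x, x \<otimes>\<^bsub>G\<^esub> s) | x s. x \<in> carrier G \<and> s \<in> S}"

end

theory Submission
  imports Defs "HOL-Real_Asymp.Real_Asymp"
begin

text \<open>
  The proof splits according to the volume growth of the group.

  If the balls grow faster than a large power of the radius, a Nash inequality makes \<open>lazy n\<close> decay so
  fast that the Green operator is bounded from \<open>l\<^sup>q\<close> to \<open>l\<^sup>\<infinity>\<close>. Truncate \<open>f\<close> to a bounded function \<open>T\<close>.
  Being bounded, \<open>T\<close> differs from its right translate by \<open>z\<close> by \<open>O(|z|\<^bsup>m/q\<^esup>)\<close> in \<open>l\<^sup>q\<close>, where
  \<open>m \<ge> p\<close> is an integer, and the exponent \<open>m/q\<close> is as small as we like. The return probability provides cutoffs of radius \<open>n\<close> whose relative gradient is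
  \<open>O(n\<^bsup>-(1-\<gamma>)/2\<^esup>)\<close>; this beats the exponent, so averaging \<open>T\<close> against them gives functions with
  arbitrarily small \<open>l\<^sup>q\<close> gradient that differ from \<open>T\<close> by an \<open>l\<^sup>q\<close> function. Boundedness of the Green
  operator then forces \<open>T\<close> to converge to a constant at infinity. Hence \<open>f\<close> attains an extremum, and
  the maximum principle applies.

  Otherwise the entropy of the walk is \<open>O(ln n)\<close> along a sequence of times. Entropy increments bound
  both the Hellinger distance between \<open>lazy n\<close> and its left translates and the second moment of the
  word length, while \<open>f\<close> grows at most like \<open>|z|\<^bsup>1-1/m\<^esup>\<close>. Thus the mean value property
  gives gradient zero.
\<close>

subsection \<open>Convexity and square roots\<close>

text \<open>Without truncation, \<open>f\<close> and its translate by z differ in l^m by a multiple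
  of |z|, and a cutoff gain of n^(-(1-\<gamma>)/2) is too small against that. For a bounded function
  the exponent rises from m to q at the price of the same m powers of |z|; the requirement becomes
  q(1-\<gamma>) > 2m, which fixes q. Truncation destroys harmonicity, so only the behaviour of
  \<open>T\<close> at infinity can be described, and harmonicity of \<open>f\<close> returns through
  an extremum. The Green operator sums the lazy averages over n; volume at least c r^(4q) gives
  \<open>lazy n\<close> = O(n^(-2q)), whose q-th root n^(-2) is summable. This is the threshold
  between the two cases.

  Failure of that volume bound gives small balls only for infinitely many radii. Entropy suits this:
  it is monotone in time, so a bound at the single time n controls all earlier times, and one of
  them has an increment no larger than average. With entropy at most h = O(ln n), the squared
  gradient is O((h/n) (nh)^(1-1/m)), which tends to zero because the growth exponent of
  \<open>f\<close> is below 1.\<close>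

lemma convex_on_power_nonneg: "convex_on {0::real..} (\<lambda>x. x ^ n)"
  by (cases "even n") (auto intro: convex_power_odd convex_on_subset[OF convex_power_even])

text \<open>Jensen's inequality for the m-th power with weights \<open>w i / t\<close>, t the total
  weight, cleared of denominators; a form of Hoelder's inequality.\<close>

lemma power_weighted_sum_le:
  fixes w g :: "'i \<Rightarrow> real"
  assumes "finite I" and w: "\<And>i. i \<in> I \<Longrightarrow> 0 \<le> w i" and g: "\<And>i. i \<in> I \<Longrightarrow> 0 \<le> g i" and m: "1 \<le> m"
  shows "(\<Sum>i\<in>I. w i * g i) ^ m \<le> (\<Sum>i\<in>I. w i) ^ (m - 1) * (\<Sum>i\<in>I. w i * g i ^ m)"
proof (cases "(\<Sum>i\<in>I. w i) = 0")
  case True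
  then have "\<forall>i\<in>I. w i = 0" using w \<open>finite I\<close> by (simp add: sum_nonneg_eq_0_iff)
  then show ?thesis using m by (simp add: power_0_left)
next
  case False
  define t where "t = (\<Sum>i\<in>I. w i)"
  have t: "t > 0" using False w by (simp add: t_def sum_nonneg order_less_le)
  have ne: "I \<noteq> {}" using False by auto
  have "(\<Sum>i\<in>I. (w i / t) *\<^sub>R g i) ^ m \<le> (\<Sum>i\<in>I. w i / t * g i ^ m)"
  proof (rule convex_on_sum[OF \<open>finite I\<close> ne convex_on_power_nonneg])
    show "(\<Sum>i\<in>I. w i / t) = 1" using t by (simp add: t_def flip: sum_divide_distrib)
  qed (use w g t in auto)
  moreover have "(\<Sum>i\<in>I. (w i / t) *\<^sub>R g i) = (\<Sum>i\<in>I. w i * g i) / t"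
    by (simp add: sum_divide_distrib)
  moreover have "(\<Sum>i\<in>I. w i / t * g i ^ m) = (\<Sum>i\<in>I. w i * g i ^ m) / t"
    by (simp add: sum_divide_distrib)
  ultimately have "(\<Sum>i\<in>I. w i * g i) ^ m / t ^ m \<le> (\<Sum>i\<in>I. w i * g i ^ m) / t"
    by (simp add: power_divide)
  then have "(\<Sum>i\<in>I. w i * g i) ^ m \<le> (\<Sum>i\<in>I. w i * g i ^ m) / t * t ^ m"
    using t by (simp add: divide_le_eq)
  also have "t ^ m = t * t ^ (m - 1)" using m by (cases m) auto
  finally show ?thesis using t by (simp add: t_def[symmetric] mult.commute)
qed

text \<open>Two-point Jensen at \<open>a / k\<close> and \<open>b\<close> with weights k and 1. If
  \<open>a\<close> comes from k steps and \<open>b\<close> from one more, nothing is lost: constants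
  k^m and k^(m-1) pass exactly to k+1.\<close>

lemma power_add_le:
  fixes a b :: real
  assumes "0 \<le> a" "0 \<le> b" and "1 \<le> m" "1 \<le> k"
  shows "(a + b) ^ m \<le> real (k + 1) ^ (m - 1) * (a ^ m / real k ^ (m - 1) + b ^ m)"
proof -
  have k: "real k > 0" using assms by simp
  have "(\<Sum>i\<in>{True, False}. (if i then real k else 1) * (if i then a / real k else b)) ^ m
     \<le> (\<Sum>i\<in>{True, False}. if i then real k else 1) ^ (m - 1) *
        (\<Sum>i\<in>{True, False}. (if i then real k else 1) * (if i then a / real k else b) ^ m)"
    using assms by (intro power_weighted_sum_le) auto
  moreover have "real k * (a / real k) ^ m = a ^ m / real k ^ (m - 1)"
    using k \<open>1 \<le> m\<close> by (cases m) (auto simp: power_divide)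
  ultimately show ?thesis using k by (simp add: add.commute)
qed

text \<open>Picks a time at which a quantity moves no faster than on average. It serves minus the
  energy, minus its logarithm and the entropy, whose increments control gradients.\<close>

lemma exists_small_increment:
  fixes a :: "nat \<Rightarrow> real"
  assumes "0 < n" and "a (m + n) - a m \<le> B"
  shows "\<exists>k\<in>{m..<m + n}. a (Suc k) - a k \<le> B / n"
proof (rule ccontr)
  assume "\<not> ?thesis"
  then have "(\<Sum>k = m..<m + n. B / n) < (\<Sum>k = m..<m + n. a (Suc k) - a k)"
    using assms(1) by (intro sum_strict_mono) (auto simp: not_le)
  then show False using assms by (simp add: sum_Suc_diff')
qed

lemma abs_diff_sqrt: "0 \<le> x \<Longrightarrow> 0 \<le> y \<Longrightarrow> \<bar>x - y\<bar> = \<bar>sqrt x - sqrt y\<bar> * (sqrt x + sqrt y)"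
proof -
  assume "0 \<le> x" "0 \<le> y"
  then have "x - y = (sqrt x - sqrt y) * (sqrt x + sqrt y)"
    by (simp add: algebra_simps)
  then show ?thesis using \<open>0 \<le> x\<close> \<open>0 \<le> y\<close> by (simp add: abs_mult)
qed

lemma sqrt_sum_square_le: "0 \<le> x \<Longrightarrow> 0 \<le> y \<Longrightarrow> (sqrt x + sqrt y) ^ 2 \<le> 2 * (x + y)"
  using sum_squares_bound[of "sqrt x" "sqrt y"] by (simp add: power2_sum)

subsection \<open>Finitely supported functions on the group\<close>

text \<open>\<open>S_ne\<close> makes averages over \<open>S\<close> meaningful; the empty
  generating set, possible only for the trivial group, is treated in
  \<open>theorem1p1\<close>.\<close>

locale cayley_graph = group G for G (structure) +
  fixes S :: "'a set"
  assumes finite_S: "finite S" and S_ne: "S \<noteq> {}" and S_sub: "S \<subseteq> carrier G"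
    and S_inv: "s \<in> S \<Longrightarrow> inv s \<in> S" and S_gen: "generate G S = carrier G"
begin

lemma S_carrier [simp]: "s \<in> S \<Longrightarrow> s \<in> carrier G"
  using S_sub by auto

lemma card_S_pos: "real (card S) > 0"
  using finite_S S_ne by (simp add: card_gt_0_iff)

lemma bij_S_inv: "bij_betw (m_inv G) S S"
  by (rule bij_betw_byWitness[where f' = "m_inv G"]) (auto simp: S_inv)

lemma sum_S_inv: "(\<Sum>s\<in>S. g (inv s)) = (\<Sum>s\<in>S. (g s :: real))"
  by (rule sum.reindex_bij_betw[OF bij_S_inv])

lemma bij_mult_left: "a \<in> carrier G \<Longrightarrow> bij_betw (\<lambda>x. a \<otimes> x) (carrier G) (carrier G)"
  by (rule bij_betw_byWitness[where f' = "\<lambda>x. inv a \<otimes> x"]) (auto simp: m_assoc[symmetric])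

lemma bij_mult_right: "a \<in> carrier G \<Longrightarrow> bij_betw (\<lambda>x. x \<otimes> a) (carrier G) (carrier G)"
  by (rule bij_betw_byWitness[where f' = "\<lambda>x. x \<otimes> inv a"]) (auto simp: m_assoc)

lemma bij_inv: "bij_betw (m_inv G) (carrier G) (carrier G)"
  by (rule bij_betw_byWitness[where f' = "m_inv G"]) auto

definition supp :: "('a \<Rightarrow> real) \<Rightarrow> 'a set" where
  "supp g = {x \<in> carrier G. g x \<noteq> 0}"

abbreviation fs :: "('a \<Rightarrow> real) \<Rightarrow> bool" where
  "fs g \<equiv> finite (supp g)"

text \<open>An infinite sum, although summands have finite support: invariance under translation and
  inversion is then a reindexing of the carrier, with no support to track.\<close>

abbreviation tot :: "('a \<Rightarrow> real) \<Rightarrow> real" where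
  "tot g \<equiv> infsum g (carrier G)"

lemma fs_summable: "fs g \<Longrightarrow> g summable_on carrier G"
  by (rule finite_nonzero_values_imp_summable_on) (simp add: supp_def)

lemma fs_subset: "fs g \<Longrightarrow> (\<And>x. x \<in> carrier G \<Longrightarrow> g x = 0 \<Longrightarrow> h x = 0) \<Longrightarrow> fs h"
  by (erule finite_subset[rotated]) (auto simp: supp_def)

lemma fs_subset2: "fs f \<Longrightarrow> fs g \<Longrightarrow> (\<And>x. x \<in> carrier G \<Longrightarrow> f x = 0 \<Longrightarrow> g x = 0 \<Longrightarrow> h x = 0) \<Longrightarrow> fs h"
  by (rule finite_subset[of _ "supp f \<union> supp g"]) (auto simp: supp_def)

lemma fs_mult_left [intro]: "fs g \<Longrightarrow> fs (\<lambda>x. g x * h x)"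
  by (erule fs_subset) auto

lemma fs_mult_right [intro]: "fs g \<Longrightarrow> fs (\<lambda>x. h x * g x)"
  by (erule fs_subset) auto

lemma fs_divide [intro]: "fs g \<Longrightarrow> fs (\<lambda>x. g x / c)"
  by (erule fs_subset) auto

lemma fs_add [intro]: "fs g \<Longrightarrow> fs h \<Longrightarrow> fs (\<lambda>x. g x + h x)"
  by (erule (1) fs_subset2) auto

lemma fs_diff [intro]: "fs g \<Longrightarrow> fs h \<Longrightarrow> fs (\<lambda>x. g x - h x)"
  by (erule (1) fs_subset2) auto

lemma fs_minus [intro]: "fs g \<Longrightarrow> fs (\<lambda>x. - g x)"
  by (erule fs_subset) auto

lemma fs_power [intro]: "fs g \<Longrightarrow> 0 < n \<Longrightarrow> fs (\<lambda>x. g x ^ n)"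
  by (erule fs_subset) auto

lemma fs_abs [intro]: "fs g \<Longrightarrow> fs (\<lambda>x. \<bar>g x\<bar>)"
  by (erule fs_subset) auto

lemma fs_sqrt [intro]: "fs g \<Longrightarrow> fs (\<lambda>x. sqrt (g x))"
  by (erule fs_subset) auto

lemma fs_sum [intro]: "finite I \<Longrightarrow> (\<And>i. i \<in> I \<Longrightarrow> fs (g i)) \<Longrightarrow> fs (\<lambda>x. \<Sum>i\<in>I. g i x)"
  by (rule finite_subset[of _ "\<Union>i\<in>I. supp (g i)"]) (auto simp: supp_def intro: sum.neutral)

lemma fs_reindex: "fs g \<Longrightarrow> bij_betw \<phi> (carrier G) (carrier G) \<Longrightarrow> fs (\<lambda>x. g (\<phi> x))"
  unfolding supp_def
  by (rule finite_imageD[of \<phi>], rule finite_subset[of _ "supp g"])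
    (auto simp: supp_def bij_betw_def inj_on_def)

lemma fs_left: "fs g \<Longrightarrow> a \<in> carrier G \<Longrightarrow> fs (\<lambda>x. g (a \<otimes> x))"
  by (rule fs_reindex[OF _ bij_mult_left])

lemma fs_right: "fs g \<Longrightarrow> a \<in> carrier G \<Longrightarrow> fs (\<lambda>x. g (x \<otimes> a))"
  by (rule fs_reindex[OF _ bij_mult_right])

lemma tot_left: "a \<in> carrier G \<Longrightarrow> tot (\<lambda>x. g (a \<otimes> x)) = tot g"
  by (rule infsum_reindex_bij_betw[OF bij_mult_left])

lemma tot_right: "a \<in> carrier G \<Longrightarrow> tot (\<lambda>x. g (x \<otimes> a)) = tot g"
  by (rule infsum_reindex_bij_betw[OF bij_mult_right])

lemma tot_inv: "tot (\<lambda>x. g (inv x)) = tot g"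
  by (rule infsum_reindex_bij_betw[OF bij_inv])

lemma tot_add: "fs g \<Longrightarrow> fs h \<Longrightarrow> tot (\<lambda>x. g x + h x) = tot g + tot h"
  by (intro infsum_add fs_summable)

lemma tot_diff: "fs g \<Longrightarrow> fs h \<Longrightarrow> tot (\<lambda>x. g x - h x) = tot g - tot h"
  using tot_add[of g "\<lambda>x. - h x"] by (simp add: fs_minus infsum_uminus)

lemmas tot_cmult = infsum_cmult_right'[where A = "carrier G"]

lemma tot_cmult_right: "tot (\<lambda>x. g x * c) = tot g * c"
  by (rule infsum_cmult_left')

lemma tot_divide: "tot (\<lambda>x. g x / c) = tot g / c"
  using tot_cmult_right[of g "1/c"] by simp

lemma tot_mono: "fs g \<Longrightarrow> fs h \<Longrightarrow> (\<And>x. x \<in> carrier G \<Longrightarrow> g x \<le> h x) \<Longrightarrow> tot g \<le> tot h"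
  by (intro infsum_mono fs_summable)

lemma tot_nonneg: "(\<And>x. x \<in> carrier G \<Longrightarrow> 0 \<le> g x) \<Longrightarrow> 0 \<le> tot g"
  by (rule infsum_nonneg)

lemma tot_eq_sum: "finite W \<Longrightarrow> W \<subseteq> carrier G \<Longrightarrow> (\<And>x. x \<in> carrier G - W \<Longrightarrow> g x = 0) \<Longrightarrow> tot g = sum g W"
  by (subst infsum_finite[symmetric], assumption, rule infsum_cong_neutral) auto

lemma tot_eq_sum_supp: "fs g \<Longrightarrow> tot g = sum g (supp g)"
  by (rule tot_eq_sum) (auto simp: supp_def)

lemma tot_sum: "finite I \<Longrightarrow> (\<And>i. i \<in> I \<Longrightarrow> fs (g i)) \<Longrightarrow> tot (\<lambda>x. \<Sum>i\<in>I. g i x) = (\<Sum>i\<in>I. tot (g i))"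
  by (induction I rule: finite_induct) (auto simp: tot_add fs_sum)

lemma tot_point: "x \<in> carrier G \<Longrightarrow> fs g \<Longrightarrow> (\<And>y. y \<in> carrier G \<Longrightarrow> 0 \<le> g y) \<Longrightarrow> g x \<le> tot g"
  using finite_sum_le_infsum[of g "carrier G" "{x}"] fs_summable by auto

lemma tot_abs: "fs g \<Longrightarrow> \<bar>tot g\<bar> \<le> tot (\<lambda>x. \<bar>g x\<bar>)"
  using tot_mono[of g "\<lambda>x. \<bar>g x\<bar>"] tot_mono[of "\<lambda>x. - g x" "\<lambda>x. \<bar>g x\<bar>"]
  by (auto simp: infsum_uminus fs_abs fs_minus abs_le_iff)

lemma tot_Cauchy_Schwarz:
  assumes "fs g" "fs h"
  shows "tot (\<lambda>x. g x * h x) \<le> sqrt (tot (\<lambda>x. g x ^ 2)) * sqrt (tot (\<lambda>x. h x ^ 2))"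
proof -
  let ?W = "supp g \<union> supp h"
  have eq: "tot f = sum f ?W" if "\<And>x. g x = 0 \<Longrightarrow> h x = 0 \<Longrightarrow> f x = 0" for f
    using assms that by (intro tot_eq_sum) (auto simp: supp_def)
  have "tot (\<lambda>x. g x * h x) ^ 2 \<le> tot (\<lambda>x. g x ^ 2) * tot (\<lambda>x. h x ^ 2)"
    by (subst (1 2 3) eq) (auto intro: Cauchy_Schwarz_ineq_sum)
  then show ?thesis
    by (metis real_le_rsqrt real_sqrt_mult)
qed

lemma tot_power_le:
  assumes "fs w" and "\<And>x. x \<in> carrier G \<Longrightarrow> 0 \<le> w x" and "\<And>x. x \<in> carrier G \<Longrightarrow> 0 \<le> g x" and "1 \<le> m"
  shows "tot (\<lambda>x. w x * g x) ^ m \<le> tot w ^ (m - 1) * tot (\<lambda>x. w x * g x ^ m)"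
proof -
  have eq: "tot f = sum f (supp w)" if "\<And>x. x \<in> carrier G \<Longrightarrow> w x = 0 \<Longrightarrow> f x = 0" for f
    using assms that by (intro tot_eq_sum) (auto simp: supp_def)
  have "(\<Sum>x\<in>supp w. w x * g x) ^ m \<le> (\<Sum>x\<in>supp w. w x) ^ (m - 1) * (\<Sum>x\<in>supp w. w x * g x ^ m)"
    using assms by (intro power_weighted_sum_le) (auto simp: supp_def)
  then show ?thesis
    by (subst (1 2 3) eq) auto
qed

subsection \<open>Word balls and the lazy walk\<close>

primrec word_ball :: "nat \<Rightarrow> 'a set" where
  "word_ball 0 = {\<one>}"
| "word_ball (Suc n) = word_ball n \<union> (\<lambda>(x, s). x \<otimes> s) ` (word_ball n \<times> S)"

lemma finite_ball: "finite (word_ball n)"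
  by (induction n) (auto simp: finite_S)

lemma ball_carrier: "word_ball n \<subseteq> carrier G"
  by (induction n) auto

lemma ball_carrierD [dest]: "x \<in> word_ball n \<Longrightarrow> x \<in> carrier G"
  using ball_carrier by auto

lemma ball_mono: "m \<le> n \<Longrightarrow> word_ball m \<subseteq> word_ball n"
  by (rule lift_Suc_mono_le[of word_ball]) auto

lemma ball_mult_right: "x \<in> word_ball n \<Longrightarrow> s \<in> S \<Longrightarrow> x \<otimes> s \<in> word_ball (Suc n)"
  by force

text \<open>Balls grow by right multiplication, whereas the walk distributions and cutoffs are
  translated on the left.\<close>

lemma ball_mult_left: "x \<in> word_ball n \<Longrightarrow> s \<in> S \<Longrightarrow> s \<otimes> x \<in> word_ball (Suc n)"
proof (induction n arbitrary: x)
  case (Suc n)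
  show ?case
  proof (cases "x \<in> word_ball n")
    case True
    then show ?thesis using Suc ball_mono[of "Suc n" "Suc (Suc n)"] by auto
  next
    case False
    then obtain y t where yt: "y \<in> word_ball n" "t \<in> S" "x = y \<otimes> t" using Suc.prems by auto
    have "s \<otimes> x = (s \<otimes> y) \<otimes> t" using yt Suc.prems by (auto simp: m_assoc)
    then show ?thesis using ball_mult_right[OF Suc.IH[OF yt(1) Suc.prems(2)] yt(2)] by simp
  qed
qed force

lemma one_in_ball: "\<one> \<in> word_ball n"
  using ball_mono[of 0 n] by auto

lemma card_ball_pos: "card (word_ball n) > 0"
  using one_in_ball finite_ball card_gt_0_iff by blast

lemma ball_mult: "x \<in> word_ball m \<Longrightarrow> y \<in> word_ball n \<Longrightarrow> x \<otimes> y \<in> word_ball (m + n)"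
proof (induction n arbitrary: y)
  case (Suc n)
  show ?case
  proof (cases "y \<in> word_ball n")
    case True
    then show ?thesis using Suc ball_mono[of "m + n" "m + Suc n"] by auto
  next
    case False
    then obtain z t where zt: "z \<in> word_ball n" "t \<in> S" "y = z \<otimes> t" using Suc.prems by auto
    have "x \<otimes> y = (x \<otimes> z) \<otimes> t" using zt Suc.prems ball_carrierD by (auto simp: m_assoc)
    then show ?thesis using ball_mult_right[OF Suc.IH[OF Suc.prems(1) zt(1)] zt(2)] by simp
  qed
next
  case 0
  then show ?case using ball_carrierD[OF 0(1)] by simp
qed

lemma carrier_ball: "x \<in> carrier G \<Longrightarrow> \<exists>n. x \<in> word_ball n"
proof -
  assume "x \<in> carrier G"
  then have "x \<in> generate G S" by (simp add: S_gen)
  then show ?thesis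
  proof (induction rule: generate.induct)
    case one
    then show ?case using one_in_ball by blast
  next
    case (incl h)
    then have "h \<in> word_ball 1" using ball_mult_right[of \<one> 0 h] by simp
    then show ?case by blast
  next
    case (inv h)
    then have "inv h \<in> word_ball 1" using ball_mult_right[of \<one> 0 "inv h"] S_inv by simp
    then show ?case by blast
  next
    case (eng h1 h2)
    then show ?case using ball_mult by blast
  qed
qed

definition wlen :: "'a \<Rightarrow> nat" where
  "wlen x = (LEAST n. x \<in> word_ball n)"

lemma ball_wlen: "x \<in> carrier G \<Longrightarrow> x \<in> word_ball (wlen x)"
  unfolding wlen_def using carrier_ball by (metis LeastI_ex)

lemma wlen_le: "x \<in> word_ball n \<Longrightarrow> wlen x \<le> n"
  unfolding wlen_def by (rule Least_le)

lemma wlen_one: "wlen \<one> = 0"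
  using wlen_le[of \<one> 0] by simp

lemma wlen_mult_left: "x \<in> carrier G \<Longrightarrow> s \<in> S \<Longrightarrow> wlen (s \<otimes> x) \<le> wlen x + 1"
  using wlen_le[OF ball_mult_left[OF ball_wlen]] by auto

lemma wlen_mult_left': "x \<in> carrier G \<Longrightarrow> s \<in> S \<Longrightarrow> wlen x \<le> wlen (s \<otimes> x) + 1"
  using wlen_mult_left[of "s \<otimes> x" "inv s"] S_inv by (simp add: m_assoc[symmetric])

section \<open>Averages over the generators and the lazy walk\<close>

definition avg :: "('a \<Rightarrow> real) \<Rightarrow> real" where
  "avg g = (\<Sum>s\<in>S. g s) / card S"

lemma avg_const [simp]: "avg (\<lambda>s. c) = c"
  using card_S_pos by (simp add: avg_def)

lemma avg_cong: "(\<And>s. s \<in> S \<Longrightarrow> g s = h s) \<Longrightarrow> avg g = avg h"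
  by (simp add: avg_def)

lemma avg_add: "avg (\<lambda>s. g s + h s) = avg g + avg h"
  by (simp add: avg_def sum.distrib add_divide_distrib)

lemma avg_diff: "avg (\<lambda>s. g s - h s) = avg g - avg h"
  by (simp add: avg_def sum_subtractf diff_divide_distrib)

lemma avg_cmult: "avg (\<lambda>s. c * g s) = c * avg g"
  by (simp add: avg_def sum_distrib_left[symmetric])

lemma avg_divide: "avg (\<lambda>s. g s / c) = avg g / c"
  using avg_cmult[of "1 / c" g] by simp

lemma avg_inv: "avg (\<lambda>s. g (inv s)) = avg g"
  by (simp add: avg_def sum_S_inv)

lemma avg_mono: "(\<And>s. s \<in> S \<Longrightarrow> g s \<le> h s) \<Longrightarrow> avg g \<le> avg h"
  by (simp add: avg_def divide_right_mono sum_mono)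

lemma avg_nonneg: "(\<And>s. s \<in> S \<Longrightarrow> 0 \<le> g s) \<Longrightarrow> 0 \<le> avg g"
  by (simp add: avg_def sum_nonneg)

lemma avg_ge: "(\<And>s. s \<in> S \<Longrightarrow> 0 \<le> g s) \<Longrightarrow> t \<in> S \<Longrightarrow> g t \<le> card S * avg g"
  using card_S_pos member_le_sum[of t S g] finite_S S_ne by (simp add: avg_def)

lemma avg_power: "(\<And>s. s \<in> S \<Longrightarrow> 0 \<le> g s) \<Longrightarrow> 1 \<le> m \<Longrightarrow> avg g ^ m \<le> avg (\<lambda>s. g s ^ m)"
  using power_weighted_sum_le[OF finite_S, of "\<lambda>_. 1 / card S" g m] card_S_pos
  by (simp add: avg_def sum_divide_distrib)

lemma avg_abs: "\<bar>avg g\<bar> \<le> avg (\<lambda>s. \<bar>g s\<bar>)"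
  using sum_abs[of g S] by (simp add: avg_def divide_right_mono abs_divide)

lemma tot_avg: "(\<And>s. s \<in> S \<Longrightarrow> fs (g s)) \<Longrightarrow> tot (\<lambda>x. avg (\<lambda>s. g s x)) = avg (\<lambda>s. tot (g s))"
  unfolding avg_def by (simp add: tot_divide tot_sum finite_S)

lemma fs_avg [intro]: "(\<And>s. s \<in> S \<Longrightarrow> fs (g s)) \<Longrightarrow> fs (\<lambda>x. avg (\<lambda>s. g s x))"
  unfolding avg_def by (intro fs_divide fs_sum finite_S)

definition nbr_avg :: "('a \<Rightarrow> real) \<Rightarrow> 'a \<Rightarrow> real" where
  "nbr_avg g x = avg (\<lambda>s. g (x \<otimes> s))"

text \<open>Step distributions of the walk with holding probability \<open>1/2\<close>, which has the same harmonic
  functions as the simple walk but no parity obstruction.\<close>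

primrec lazy :: "nat \<Rightarrow> 'a \<Rightarrow> real" where
  "lazy 0 = indicat_real {\<one>}"
| "lazy (Suc n) = (\<lambda>x. (lazy n x + nbr_avg (lazy n) x) / 2)"

lemma lazy_nonneg: "0 \<le> lazy n x"
  by (induction n arbitrary: x) (auto simp: nbr_avg_def intro!: avg_nonneg add_nonneg_nonneg)

lemma lazy_outside: "x \<in> carrier G \<Longrightarrow> x \<notin> word_ball n \<Longrightarrow> lazy n x = 0"
proof (induction n arbitrary: x)
  case (Suc n)
  have "lazy n (x \<otimes> s) = 0" if "s \<in> S" for s
  proof (rule Suc.IH)
    show "x \<otimes> s \<notin> word_ball n"
      using ball_mult_right[of "x \<otimes> s" n "inv s"] that Suc.prems S_inv by (auto simp: m_assoc)
  qed (use that Suc.prems in auto)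
  then have "nbr_avg (lazy n) x = 0" by (simp add: nbr_avg_def avg_def)
  then show ?case using Suc by auto
qed auto

lemma fs_lazy [intro, simp]: "fs (lazy n)"
  by (rule finite_subset[OF _ finite_ball[of n]]) (auto simp: supp_def dest: lazy_outside)

lemma fs_lazy_left [intro, simp]: "a \<in> carrier G \<Longrightarrow> fs (\<lambda>x. lazy n (a \<otimes> x))"
  by (rule fs_left) auto

lemma fs_lazy_right [intro, simp]: "a \<in> carrier G \<Longrightarrow> fs (\<lambda>x. lazy n (x \<otimes> a))"
  by (rule fs_right) auto

lemma tot_nbr_avg: "fs g \<Longrightarrow> tot (nbr_avg g) = tot g"
  unfolding nbr_avg_def by (simp add: tot_avg fs_right tot_right cong: avg_cong)

lemma fs_nbr_avg [intro]: "fs g \<Longrightarrow> fs (nbr_avg g)"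
  unfolding nbr_avg_def by (intro fs_avg fs_right) auto

lemma tot_lazy: "tot (lazy n) = 1"
proof (induction n)
  case 0
  have "tot (lazy 0) = sum (lazy 0) {\<one>}" by (rule tot_eq_sum) auto
  then show ?case by simp
next
  case (Suc n)
  then show ?case by (simp add: tot_divide tot_add fs_nbr_avg tot_nbr_avg)
qed

text \<open>Left and right averaging commute, and they agree on the point mass at the identity; so
  right steps and left steps produce the same distributions.\<close>

lemma lazy_Suc_left: "x \<in> carrier G \<Longrightarrow> lazy (Suc n) x = (lazy n x + avg (\<lambda>s. lazy n (s \<otimes> x))) / 2"
proof (induction n arbitrary: x)
  case 0
  have "(x \<otimes> s = \<one>) = (s \<otimes> x = \<one>)" if "s \<in> S" for s
    using 0 that inv_comm[of x s] inv_comm[of s x] by auto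
  then have "nbr_avg (lazy 0) x = avg (\<lambda>s. lazy 0 (s \<otimes> x))"
    unfolding nbr_avg_def by (intro avg_cong) (auto simp: indicator_def)
  then show ?case by simp
next
  case (Suc n)
  have "nbr_avg (lazy (Suc n)) x = avg (\<lambda>s. (lazy n (x \<otimes> s) + avg (\<lambda>t. lazy n (t \<otimes> (x \<otimes> s)))) / 2)"
    unfolding nbr_avg_def using Suc by (intro avg_cong) auto
  also have "\<dots> = avg (\<lambda>s. (lazy n (s \<otimes> x) + nbr_avg (lazy n) (s \<otimes> x)) / 2)"
    (is "?L = ?R")
  proof -
    have "?L = (nbr_avg (lazy n) x + avg (\<lambda>s. avg (\<lambda>t. lazy n (t \<otimes> (x \<otimes> s))))) / 2"
      by (simp add: avg_add avg_divide nbr_avg_def add_divide_distrib)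
    moreover have "?R = (avg (\<lambda>s. lazy n (s \<otimes> x)) + avg (\<lambda>s. nbr_avg (lazy n) (s \<otimes> x))) / 2"
      by (simp add: avg_add avg_divide nbr_avg_def add_divide_distrib)
    moreover have "nbr_avg (lazy n) x = avg (\<lambda>s. lazy n (s \<otimes> x))"
      using Suc.IH[OF Suc.prems] by simp
    moreover have "avg (\<lambda>s. avg (\<lambda>t. lazy n (t \<otimes> (x \<otimes> s)))) = avg (\<lambda>s. nbr_avg (lazy n) (s \<otimes> x))"
      unfolding nbr_avg_def avg_def sum_divide_distrib[symmetric]
      by (subst sum.swap) (use Suc.prems in \<open>auto simp: m_assoc intro!: sum.cong arg_cong2[where f = "(/)"]\<close>)
    ultimately show ?thesis by simp
  qed
  finally have "nbr_avg (lazy (Suc n)) x = avg (\<lambda>s. lazy (Suc n) (s \<otimes> x))" by simp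
  then show ?case by (subst lazy.simps(2)) simp
qed

text \<open>Inversion exchanges right and left neighbours, so \<open>lazy_Suc_left\<close> closes
  the induction.\<close>

lemma lazy_inv: "x \<in> carrier G \<Longrightarrow> lazy n (inv x) = lazy n x"
proof (induction n arbitrary: x)
  case 0
  then show ?case by (auto simp: indicator_def)
next
  case (Suc n)
  have "nbr_avg (lazy n) (inv x) = avg (\<lambda>s. lazy n (inv s \<otimes> x))"
    unfolding nbr_avg_def
  proof (rule avg_cong)
    fix s assume "s \<in> S"
    then show "lazy n (inv x \<otimes> s) = lazy n (inv s \<otimes> x)"
      using Suc.IH[of "inv s \<otimes> x"] Suc.prems by (simp add: inv_mult_group)
  qed
  also have "\<dots> = avg (\<lambda>s. lazy n (s \<otimes> x))"
    by (rule avg_inv)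
  finally have "nbr_avg (lazy n) (inv x) = avg (\<lambda>s. lazy n (s \<otimes> x))" .
  then show ?case using Suc by (simp only: lazy_Suc_left) (simp add: Suc)
qed

text \<open>The n-th power of (I + P)/2 with P = \<open>nbr_avg\<close>, written through its kernel:
  the sum is finite for every \<open>g\<close>.\<close>

definition smear :: "nat \<Rightarrow> ('a \<Rightarrow> real) \<Rightarrow> 'a \<Rightarrow> real" where
  "smear n g x = tot (\<lambda>z. lazy n z * g (x \<otimes> z))"

lemma smear_0: "x \<in> carrier G \<Longrightarrow> smear 0 g x = g x"
proof -
  assume "x \<in> carrier G"
  have "tot (\<lambda>z. lazy 0 z * g (x \<otimes> z)) = sum (\<lambda>z. lazy 0 z * g (x \<otimes> z)) {\<one>}"
    by (rule tot_eq_sum) auto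
  then show ?thesis using \<open>x \<in> carrier G\<close> by (simp add: smear_def)
qed

lemma smear_add: "smear n (\<lambda>x. g x + h x) x = smear n g x + smear n h x"
  by (simp add: smear_def distrib_left tot_add fs_mult_left)

lemma smear_diff: "smear n (\<lambda>x. g x - h x) x = smear n g x - smear n h x"
  by (simp add: smear_def right_diff_distrib tot_diff fs_mult_left)

lemma smear_divide: "smear n (\<lambda>x. g x / c) x = smear n g x / c"
  using tot_divide[of "\<lambda>z. lazy n z * g (x \<otimes> z)" c] by (simp add: smear_def)

lemma smear_cong: "x \<in> carrier G \<Longrightarrow> (\<And>y. y \<in> carrier G \<Longrightarrow> g y = h y) \<Longrightarrow> smear n g x = smear n h x"
  by (simp add: smear_def cong: infsum_cong)

lemma smear_Suc:
  assumes x: "x \<in> carrier G"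
  shows "smear (Suc n) g x = (smear n g x + smear n (nbr_avg g) x) / 2"
proof -
  have "tot (\<lambda>z. nbr_avg (lazy n) z * g (x \<otimes> z)) = avg (\<lambda>s. tot (\<lambda>z. lazy n (z \<otimes> s) * g (x \<otimes> z)))"
    by (subst tot_avg[symmetric])
      (auto intro!: infsum_cong simp: nbr_avg_def avg_def sum_distrib_right)
  also have "\<dots> = avg (\<lambda>s. tot (\<lambda>z. lazy n z * g (x \<otimes> (z \<otimes> inv s))))"
  proof (rule avg_cong)
    fix s assume s: "s \<in> S"
    show "tot (\<lambda>z. lazy n (z \<otimes> s) * g (x \<otimes> z)) = tot (\<lambda>z. lazy n z * g (x \<otimes> (z \<otimes> inv s)))"
      using s by (subst tot_right[symmetric, of s "\<lambda>z. lazy n z * g (x \<otimes> (z \<otimes> inv s))"])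
        (auto intro!: infsum_cong simp: m_assoc)
  qed
  also have "\<dots> = avg (\<lambda>s. tot (\<lambda>z. lazy n z * g (x \<otimes> (z \<otimes> s))))"
    by (rule avg_inv)
  also have "\<dots> = smear n (nbr_avg g) x"
    unfolding smear_def nbr_avg_def
    by (subst tot_avg[symmetric])
      (use x in \<open>auto intro!: infsum_cong simp: avg_def sum_distrib_left m_assoc\<close>)
  finally have eq: "tot (\<lambda>z. nbr_avg (lazy n) z * g (x \<otimes> z)) = smear n (nbr_avg g) x" .
  have "smear (Suc n) g x = tot (\<lambda>z. (lazy n z * g (x \<otimes> z) + nbr_avg (lazy n) z * g (x \<otimes> z)) / 2)"
    unfolding smear_def by (rule infsum_cong) (simp add: field_simps)
  also have "\<dots> = (smear n g x + tot (\<lambda>z. nbr_avg (lazy n) z * g (x \<otimes> z))) / 2"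
    by (subst tot_divide, subst tot_add) (auto simp: smear_def intro!: fs_mult_left fs_nbr_avg)
  finally show ?thesis by (simp add: eq)
qed

lemma smear_harmonic:
  assumes "\<And>x. x \<in> carrier G \<Longrightarrow> nbr_avg f x = f x" and x: "x \<in> carrier G"
  shows "smear n f x = f x"
proof (induction n)
  case 0
  then show ?case using x by (rule smear_0)
next
  case (Suc n)
  then show ?case using smear_cong[OF x assms(1), where n = n] by (simp add: smear_Suc x)
qed

lemma smear_lazy:
  assumes x: "x \<in> carrier G"
  shows "smear n (lazy k) x = lazy (n + k) x"
proof (induction n arbitrary: k)
  case 0
  then show ?case using x by (simp add: smear_0)
next
  case (Suc n)
  have "smear (Suc n) (lazy k) x = smear n (lazy (Suc k)) x"
    by (simp add: smear_Suc x smear_add smear_divide)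
  then show ?case using Suc[of "Suc k"] by simp
qed

lemma smear_Suc_diff:
  "x \<in> carrier G \<Longrightarrow> smear (Suc n) g x - smear n g x = smear n (\<lambda>y. (nbr_avg g y - g y) / 2) x"
  by (simp add: smear_Suc smear_diff smear_divide field_simps)

text \<open>The squared l^2 norm of the walk distribution, which is also the lazy return probability
  at time 2n (\<open>energy_eq\<close>).\<close>

definition energy :: "nat \<Rightarrow> real" where
  "energy n = tot (\<lambda>x. lazy n x ^ 2)"

lemma energy_eq: "energy n = lazy (n + n) \<one>"
proof -
  have "lazy (n + n) \<one> = tot (\<lambda>z. lazy n z * lazy n (\<one> \<otimes> z))"
    by (simp add: smear_lazy[symmetric] smear_def)
  also have "\<dots> = energy n" unfolding energy_def
    by (rule infsum_cong) (simp add: power2_eq_square)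
  finally show ?thesis by simp
qed

text \<open>At even times the kernel peaks at the identity: each product in the convolution is at
  most the mean of two squares.\<close>

lemma lazy_le_energy: "x \<in> carrier G \<Longrightarrow> lazy (n + n) x \<le> energy n"
proof -
  assume x: "x \<in> carrier G"
  have "lazy (n + n) x = tot (\<lambda>z. lazy n z * lazy n (x \<otimes> z))"
    using x by (simp add: smear_lazy[symmetric] smear_def)
  also have "\<dots> \<le> tot (\<lambda>z. (lazy n z ^ 2 + lazy n (x \<otimes> z) ^ 2) / 2)"
  proof (rule tot_mono)
    fix z
    show "lazy n z * lazy n (x \<otimes> z) \<le> (lazy n z ^ 2 + lazy n (x \<otimes> z) ^ 2) / 2"
      using sum_squares_bound[of "lazy n z" "lazy n (x \<otimes> z)"] by simp
  qed (use x in \<open>auto intro!: fs_mult_left fs_divide fs_add fs_power fs_left\<close>)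
  also have "\<dots> = energy n"
    using x tot_left[OF x, of "\<lambda>z. lazy n z ^ 2"]
    by (simp add: tot_divide tot_add fs_power fs_left energy_def fs_left[of "\<lambda>z. lazy n z ^ 2"])
  finally show ?thesis .
qed

lemma lazy_bound_mono:
  assumes "n \<le> k" "\<And>x. x \<in> carrier G \<Longrightarrow> lazy n x \<le> b" "x \<in> carrier G"
  shows "lazy k x \<le> b"
  using assms
proof (induction k arbitrary: x rule: dec_induct)
  case (step k)
  have "nbr_avg (lazy k) x \<le> avg (\<lambda>s. b)"
    unfolding nbr_avg_def using step by (intro avg_mono) auto
  then show ?case using step.IH[of x] step.prems by simp
qed auto

lemma energy_pos: "energy n > 0"
proof -
  have "lazy n \<one> > 0" for n
  proof (induction n)
    case (Suc n)
    have "nbr_avg (lazy n) \<one> \<ge> 0" by (simp add: nbr_avg_def avg_nonneg lazy_nonneg)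
    then show ?case using Suc by simp
  qed auto
  then show ?thesis by (simp add: energy_eq)
qed

subsection \<open>Energy dissipation and decay of the walk\<close>

text \<open>For nonnegative \<open>g\<close> this says that the l^1 norm is at most
  \<open>D\<close>. Bounding finite partial sums handles functions of infinite support, such as
  powers of the gradient of \<open>f\<close>, without summability proofs.\<close>

definition lbound :: "('a \<Rightarrow> real) \<Rightarrow> real \<Rightarrow> bool" where
  "lbound g D \<longleftrightarrow> (\<forall>W. finite W \<longrightarrow> W \<subseteq> carrier G \<longrightarrow> sum g W \<le> D)"

lemma lboundI: "(\<And>W. finite W \<Longrightarrow> W \<subseteq> carrier G \<Longrightarrow> sum g W \<le> D) \<Longrightarrow> lbound g D"
  by (simp add: lbound_def)

lemma lboundD: "lbound g D \<Longrightarrow> finite W \<Longrightarrow> W \<subseteq> carrier G \<Longrightarrow> sum g W \<le> D"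
  by (simp add: lbound_def)

lemma lbound_nonneg: "lbound g D \<Longrightarrow> 0 \<le> D"
  using lboundD[of g D "{}"] by simp

lemma lbound_point: "lbound g D \<Longrightarrow> x \<in> carrier G \<Longrightarrow> g x \<le> D"
  using lboundD[of g D "{x}"] by simp

lemma lbound_mono: "lbound g D \<Longrightarrow> D \<le> D' \<Longrightarrow> (\<And>x. x \<in> carrier G \<Longrightarrow> h x \<le> g x) \<Longrightarrow> lbound h D'"
  unfolding lbound_def by (meson order_trans subset_iff sum_mono)

lemma lbound_cmult: "lbound g D \<Longrightarrow> 0 \<le> c \<Longrightarrow> lbound (\<lambda>x. c * g x) (c * D)"
  unfolding lbound_def by (simp add: mult_left_mono flip: sum_distrib_left)

lemma lbound_add: "lbound g D \<Longrightarrow> lbound h E \<Longrightarrow> lbound (\<lambda>x. g x + h x) (D + E)"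
  unfolding lbound_def by (simp add: add_mono sum.distrib)

lemma lbound_right:
  assumes "lbound g D" "z \<in> carrier G"
  shows "lbound (\<lambda>x. g (x \<otimes> z)) D"
proof (rule lboundI)
  fix W assume W: "finite W" "W \<subseteq> carrier G"
  have "inj_on (\<lambda>x. x \<otimes> z) W"
    by (rule inj_on_subset[OF bij_betw_imp_inj_on[OF bij_mult_right[OF assms(2)]] W(2)])
  then have "(\<Sum>x\<in>W. g (x \<otimes> z)) = sum g ((\<lambda>x. x \<otimes> z) ` W)"
    by (simp add: sum.reindex)
  also have "\<dots> \<le> D" using W assms by (intro lboundD) auto
  finally show "(\<Sum>x\<in>W. g (x \<otimes> z)) \<le> D" .
qed

lemma lbound_imp_tot: "fs g \<Longrightarrow> lbound g D \<Longrightarrow> tot g \<le> D"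
  by (simp add: tot_eq_sum_supp) (rule lboundD, auto simp: supp_def)

lemma tot_imp_lbound: "fs g \<Longrightarrow> (\<And>x. x \<in> carrier G \<Longrightarrow> 0 \<le> g x) \<Longrightarrow> tot g \<le> D \<Longrightarrow> lbound g D"
  by (rule lboundI, rule order_trans[OF finite_sum_le_infsum[of g "carrier G"]]) (auto simp: fs_summable)

lemma lbound_tot:
  assumes w: "fs w" "\<And>z. z \<in> carrier G \<Longrightarrow> 0 \<le> w z"
    and g: "\<And>z. z \<in> carrier G \<Longrightarrow> w z \<noteq> 0 \<Longrightarrow> lbound (g z) D"
  shows "lbound (\<lambda>x. tot (\<lambda>z. w z * g z x)) (tot w * D)"
proof (rule lboundI)
  fix W assume W: "finite W" "W \<subseteq> carrier G"
  have "(\<Sum>x\<in>W. tot (\<lambda>z. w z * g z x)) = tot (\<lambda>z. \<Sum>x\<in>W. w z * g z x)"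
    using W w by (simp add: tot_sum fs_mult_left)
  also have "\<dots> \<le> tot (\<lambda>z. w z * D)"
  proof (rule tot_mono)
    fix z assume z: "z \<in> carrier G"
    show "(\<Sum>x\<in>W. w z * g z x) \<le> w z * D"
      using g[OF z] w(2)[OF z] W
      by (cases "w z = 0") (auto simp: sum_distrib_left[symmetric] intro!: mult_left_mono dest: lboundD)
  qed (use w W in \<open>auto intro!: fs_mult_left fs_sum\<close>)
  finally show "(\<Sum>x\<in>W. tot (\<lambda>z. w z * g z x)) \<le> tot w * D"
    by (simp add: tot_cmult_right)
qed

text \<open>The l^m triangle inequality along a word of length k, stated for m-th powers; the
  weights in \<open>power_add_le\<close> keep the constant at exactly k^m.\<close>

lemma lbound_path:
  assumes m: "1 \<le> m" and D: "\<And>s. s \<in> S \<Longrightarrow> lbound (\<lambda>x. \<bar>T (x \<otimes> s) - T x\<bar> ^ m) D"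
  shows "z \<in> word_ball k \<Longrightarrow> lbound (\<lambda>x. \<bar>T (x \<otimes> z) - T x\<bar> ^ m) (real k ^ m * D)"
proof (induction k arbitrary: z)
  case 0
  then show ?case using m by (auto intro!: lboundI simp: power_0_left subset_iff)
next
  case (Suc k)
  have D0: "0 \<le> D" using S_ne D lbound_nonneg by blast
  consider "z \<in> word_ball k" | y s where "y \<in> word_ball k" "s \<in> S" "z = y \<otimes> s" using Suc.prems by auto
  then show ?case
  proof cases
    case 1
    then show ?thesis
      using D0 by (intro lbound_mono[OF Suc.IH]) (auto intro!: mult_right_mono power_mono)
  next
    case 2
    show ?thesis
    proof (cases "k = 0")
      case True
      then have "z = s" using 2 by auto
      then show ?thesis using True D[OF 2(2)] by simp
    next
      case False
      then have k: "1 \<le> k" "real k > 0" by auto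
      have "lbound (\<lambda>x. real (k + 1) ^ (m - 1) *
            (1 / real k ^ (m - 1) * \<bar>T (x \<otimes> y) - T x\<bar> ^ m + \<bar>T (x \<otimes> y \<otimes> s) - T (x \<otimes> y)\<bar> ^ m))
          (real (k + 1) ^ (m - 1) * (1 / real k ^ (m - 1) * (real k ^ m * D) + D))"
        using 2 by (intro lbound_cmult lbound_add Suc.IH lbound_right[OF D, where z = y]) auto
      moreover have "real (k + 1) ^ (m - 1) * (1 / real k ^ (m - 1) * (real k ^ m * D) + D) = real (Suc k) ^ m * D"
        using k m by (cases m) (auto simp: field_simps)
      ultimately show ?thesis
      proof (rule lbound_mono[OF _ eq_refl])
        fix x assume x: "x \<in> carrier G"
        have "x \<otimes> z = x \<otimes> y \<otimes> s" using 2 x by (auto simp: m_assoc)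
        then have "\<bar>T (x \<otimes> z) - T x\<bar> ^ m \<le>
            (\<bar>T (x \<otimes> y) - T x\<bar> + \<bar>T (x \<otimes> y \<otimes> s) - T (x \<otimes> y)\<bar>) ^ m"
          by (intro power_mono) auto
        also have "\<dots> \<le> real (k + 1) ^ (m - 1) * (\<bar>T (x \<otimes> y) - T x\<bar> ^ m / real k ^ (m - 1)
            + \<bar>T (x \<otimes> y \<otimes> s) - T (x \<otimes> y)\<bar> ^ m)"
          using k m by (intro power_add_le) auto
        finally show "\<bar>T (x \<otimes> z) - T x\<bar> ^ m \<le> real (k + 1) ^ (m - 1) *
            (1 / real k ^ (m - 1) * \<bar>T (x \<otimes> y) - T x\<bar> ^ m + \<bar>T (x \<otimes> y \<otimes> s) - T (x \<otimes> y)\<bar> ^ m)"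
          by simp
      qed
    qed
  qed
qed

lemma tot_diff_square:
  assumes "fs g" "fs h"
  shows "tot (\<lambda>x. (g x - h x) ^ 2) = tot (\<lambda>x. g x ^ 2) + tot (\<lambda>x. h x ^ 2) - 2 * tot (\<lambda>x. g x * h x)"
proof -
  have "tot (\<lambda>x. (g x - h x) ^ 2) = tot (\<lambda>x. (g x ^ 2 + h x ^ 2) - 2 * (g x * h x))"
    by (rule infsum_cong) (simp add: power2_diff)
  also have "\<dots> = tot (\<lambda>x. g x ^ 2 + h x ^ 2) - tot (\<lambda>x. 2 * (g x * h x))"
    using assms by (intro tot_diff fs_add fs_power fs_mult_right) auto
  finally show ?thesis using assms by (simp add: tot_add tot_cmult fs_power)
qed

lemma tot_add_square:
  assumes "fs g" "fs h"
  shows "tot (\<lambda>x. (g x + h x) ^ 2) = tot (\<lambda>x. g x ^ 2) + tot (\<lambda>x. h x ^ 2) + 2 * tot (\<lambda>x. g x * h x)"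
  using tot_diff_square[of g "\<lambda>x. - h x"] assms by (simp add: fs_minus infsum_uminus)

text \<open>With u = \<open>lazy n\<close>, the left side is 2|u|^2 - 2<Pu,u>. The next distribution
  is (u + Pu)/2; expanding its norm and using |Pu| \<le> |u| compares this with the energy loss. The
  holding probability supplies the cross term.\<close>

lemma energy_drop:
  "avg (\<lambda>s. tot (\<lambda>x. (lazy n (x \<otimes> s) - lazy n x) ^ 2)) \<le> 4 * (energy n - energy (Suc n))"
proof -
  let ?u = "lazy n" and ?P = "nbr_avg (lazy n)"
  have I: "avg (\<lambda>s. tot (\<lambda>x. ?u (x \<otimes> s) * ?u x)) = tot (\<lambda>x. ?P x * ?u x)"
    by (subst tot_avg[symmetric])
      (auto intro!: infsum_cong simp: nbr_avg_def avg_def sum_distrib_right)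
  have e: "tot (\<lambda>x. ?u (x \<otimes> s) ^ 2) = energy n" if "s \<in> S" for s
    using that tot_right[of s "\<lambda>x. ?u x ^ 2"] by (simp add: energy_def)
  have "avg (\<lambda>s. tot (\<lambda>x. (?u (x \<otimes> s) - ?u x) ^ 2))
      = avg (\<lambda>s. 2 * energy n - 2 * tot (\<lambda>x. ?u (x \<otimes> s) * ?u x))"
    by (rule avg_cong) (simp add: tot_diff_square e energy_def)
  then have 1: "avg (\<lambda>s. tot (\<lambda>x. (?u (x \<otimes> s) - ?u x) ^ 2)) = 2 * energy n - 2 * tot (\<lambda>x. ?P x * ?u x)"
    by (simp add: avg_diff avg_cmult I)
  have "tot (\<lambda>x. ?P x ^ 2) \<le> tot (nbr_avg (\<lambda>x. ?u x ^ 2))"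
  proof (rule tot_mono)
    show "?P x ^ 2 \<le> nbr_avg (\<lambda>x. ?u x ^ 2) x" for x
      unfolding nbr_avg_def by (rule avg_power) (auto simp: lazy_nonneg)
  qed (auto intro!: fs_power fs_nbr_avg)
  also have "\<dots> = energy n" by (simp add: tot_nbr_avg fs_power energy_def)
  finally have 2: "tot (\<lambda>x. ?P x ^ 2) \<le> energy n" .
  have "energy (Suc n) = tot (\<lambda>x. (?P x + ?u x) ^ 2 / 4)"
    unfolding energy_def by (rule infsum_cong) (simp add: power_divide add.commute)
  also have "\<dots> = (tot (\<lambda>x. ?P x ^ 2) + energy n + 2 * tot (\<lambda>x. ?P x * ?u x)) / 4"
    by (simp add: tot_divide tot_add_square fs_nbr_avg energy_def)
  finally show ?thesis using 1 2 by simp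
qed

lemma energy_drop_right:
  assumes "s \<in> S"
  shows "tot (\<lambda>x. (lazy n (x \<otimes> s) - lazy n x) ^ 2) \<le> 4 * card S * (energy n - energy (Suc n))"
proof -
  have "tot (\<lambda>x. (lazy n (x \<otimes> s) - lazy n x) ^ 2)
      \<le> card S * avg (\<lambda>s. tot (\<lambda>x. (lazy n (x \<otimes> s) - lazy n x) ^ 2))"
    using assms by (intro avg_ge tot_nonneg) auto
  also have "\<dots> \<le> card S * (4 * (energy n - energy (Suc n)))"
    using energy_drop by (intro mult_left_mono) auto
  finally show ?thesis by (simp add: algebra_simps)
qed

lemma energy_drop_left:
  assumes "s \<in> S"
  shows "tot (\<lambda>x. (lazy n (s \<otimes> x) - lazy n x) ^ 2) \<le> 4 * card S * (energy n - energy (Suc n))"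
proof -
  have "tot (\<lambda>x. (lazy n (s \<otimes> x) - lazy n x) ^ 2) = tot (\<lambda>x. (lazy n (s \<otimes> inv x) - lazy n (inv x)) ^ 2)"
    by (rule tot_inv[symmetric])
  also have "\<dots> = tot (\<lambda>x. (lazy n (x \<otimes> inv s) - lazy n x) ^ 2)"
  proof (rule infsum_cong)
    fix x assume x: "x \<in> carrier G"
    have "lazy n (s \<otimes> inv x) = lazy n (x \<otimes> inv s)"
      using lazy_inv[of "x \<otimes> inv s" n] x assms by (simp add: inv_mult_group)
    then show "(lazy n (s \<otimes> inv x) - lazy n (inv x)) ^ 2 = (lazy n (x \<otimes> inv s) - lazy n x) ^ 2"
      using x by (simp add: lazy_inv)
  qed
  also have "\<dots> \<le> 4 * card S * (energy n - energy (Suc n))"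
    by (rule energy_drop_right[OF S_inv[OF assms]])
  finally show ?thesis .
qed

lemma energy_Suc_le: "energy (Suc n) \<le> energy n"
proof -
  have "0 \<le> avg (\<lambda>s. tot (\<lambda>x. (lazy n (x \<otimes> s) - lazy n x) ^ 2))"
    by (intro avg_nonneg tot_nonneg) auto
  then show ?thesis using energy_drop[of n] by simp
qed

lemma energy_antimono: "n \<le> k \<Longrightarrow> energy k \<le> energy n"
  by (rule lift_Suc_antimono_le[of energy]) (rule energy_Suc_le)

lemma energy_0: "energy 0 = 1"
  using energy_eq[of 0] by simp

lemma energy_le_1: "energy n \<le> 1"
  using energy_antimono[of 0 n] energy_0 by simp

text \<open>Compare \<open>lazy n\<close> with its right translates by a ball: the mean of the inner products is at most the
  reciprocal of the volume, and the defect is controlled by the gradient.\<close>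

lemma energy_nash:
  "energy n \<le> 1 / card (word_ball r) + 2 * card S * real r ^ 2 * (energy n - energy (Suc n))"
proof -
  let ?u = "lazy n" and ?V = "real (card (word_ball r))"
  have V: "?V > 0" using card_ball_pos by simp
  \<comment> \<open>Both functions have squared norm \<open>energy n\<close>, so the defect is half
    their squared distance; \<open>lbound_path\<close> turns the one-step bound into r^2 times
    it.\<close>
  have z: "energy n - tot (\<lambda>x. ?u (x \<otimes> z) * ?u x) \<le> 2 * card S * real r ^ 2 * (energy n - energy (Suc n))"
    if "z \<in> word_ball r" for z
  proof -
    have zc: "z \<in> carrier G" using that by auto
    have "lbound (\<lambda>x. \<bar>?u (x \<otimes> s) - ?u x\<bar> ^ 2) (4 * card S * (energy n - energy (Suc n)))" if "s \<in> S" for s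
      using that energy_drop_right[OF that] by (intro tot_imp_lbound) (auto intro!: fs_power fs_diff)
    from lbound_path[where m = 2 and T = ?u, OF _ this that]
    have "tot (\<lambda>x. \<bar>?u (x \<otimes> z) - ?u x\<bar> ^ 2) \<le> real r ^ 2 * (4 * card S * (energy n - energy (Suc n)))"
      using zc by (intro lbound_imp_tot) (auto intro!: fs_power fs_diff)
    moreover have "tot (\<lambda>x. ?u (x \<otimes> z) ^ 2) = energy n"
      using zc tot_right[of z "\<lambda>x. ?u x ^ 2"] by (simp add: energy_def)
    ultimately show ?thesis using zc by (simp add: tot_diff_square energy_def[symmetric]) (simp add: algebra_simps)
  qed
  \<comment> \<open>Summing over z first: for fixed x the values \<open>?u (x \<otimes> z)\<close>
    add up to at most 1, whatever the size of the ball.\<close>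
  have "(\<Sum>z\<in>word_ball r. tot (\<lambda>x. ?u (x \<otimes> z) * ?u x)) = tot (\<lambda>x. \<Sum>z\<in>word_ball r. ?u (x \<otimes> z) * ?u x)"
    using finite_ball by (subst tot_sum) (auto intro!: fs_mult_right)
  also have "\<dots> \<le> tot ?u"
  proof (rule tot_mono)
    fix x assume x: "x \<in> carrier G"
    have "(\<Sum>z\<in>word_ball r. ?u (x \<otimes> z)) \<le> tot (\<lambda>z. ?u (x \<otimes> z))"
      using x ball_carrier by (intro finite_sum_le_infsum fs_summable) (auto simp: finite_ball lazy_nonneg)
    also have "\<dots> = 1" using x by (simp add: tot_left tot_lazy)
    finally have "(\<Sum>z\<in>word_ball r. ?u (x \<otimes> z)) * ?u x \<le> 1 * ?u x"
      by (rule mult_right_mono) (rule lazy_nonneg)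
    then show "(\<Sum>z\<in>word_ball r. ?u (x \<otimes> z) * ?u x) \<le> ?u x" by (simp add: sum_distrib_right)
  qed (auto intro!: fs_sum finite_ball fs_mult_right)
  finally have 1: "(\<Sum>z\<in>word_ball r. tot (\<lambda>x. ?u (x \<otimes> z) * ?u x)) \<le> 1" by (simp add: tot_lazy)
  have "?V * energy n - 1 \<le> (\<Sum>z\<in>word_ball r. energy n - tot (\<lambda>x. ?u (x \<otimes> z) * ?u x))"
    using 1 by (simp add: sum_subtractf)
  also have "\<dots> \<le> (\<Sum>z\<in>word_ball r. 2 * card S * real r ^ 2 * (energy n - energy (Suc n)))"
    by (rule sum_mono) (rule z)
  finally have "?V * energy n \<le> 1 + ?V * (2 * card S * real r ^ 2 * (energy n - energy (Suc n)))" by simp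
  then have "energy n \<le> (1 + ?V * (2 * card S * real r ^ 2 * (energy n - energy (Suc n)))) / ?V"
    using V by (simp add: le_divide_eq mult.commute)
  then show ?thesis using V by (simp add: add_divide_distrib)
qed

text \<open>The energy cannot lose more than \<open>energy n\<close> during [n, 2n), so some step
  there loses at most the n-th part; \<open>energy_nash\<close> applies at that step.\<close>

lemma energy_double:
  assumes "0 < n"
  shows "energy (n + n) \<le> 1 / card (word_ball r) + 2 * card S * real r ^ 2 * (energy n / n)"
proof -
  have "- energy (n + n) - - energy n \<le> energy n" using energy_pos[of "n + n"] by simp
  from exists_small_increment[OF assms this]
  obtain k where k: "k < n + n" "energy k - energy (Suc k) \<le> energy n / n" by auto
  have "energy (n + n) \<le> energy k" using k by (intro energy_antimono) simp
  also have "\<dots> \<le> 1 / card (word_ball r) + 2 * card S * real r ^ 2 * (energy k - energy (Suc k))"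
    by (rule energy_nash)
  also have "\<dots> \<le> 1 / card (word_ball r) + 2 * card S * real r ^ 2 * (energy n / n)"
    using k by (intro add_left_mono mult_left_mono) auto
  finally show ?thesis .
qed

text \<open>Decay of order n^(-d/2), by induction over the times 4^i with comparison radius 2^(i-j),
  a fixed small fraction of the diffusive scale.\<close>

lemma energy_decay:
  assumes c: "c > 0" and V: "\<And>r. 1 \<le> r \<Longrightarrow> c * real r ^ d \<le> card (word_ball r)"
  shows "\<exists>C>0. \<forall>i. energy (4 ^ i) \<le> C / 2 ^ (d * i)"
proof -
  \<comment> \<open>Chosen so that the factor 2 |S| r^2 / 4^i is at most 1/(2 * 2^d): the
    dissipation term takes half of the next target value.\<close>
  obtain j :: nat where j: "2 * card S * 2 ^ d * 2 < (2::real) ^ j"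
    using real_arch_pow[of 2 "2 * card S * 2 ^ d * 2"] by auto
  \<comment> \<open>The first summand lets the volume term fit into the other half; the second
    covers the scales up to j by \<open>energy_le_1\<close>.\<close>
  define C :: real where "C = 2 * 2 ^ (j * d + d) / c + 2 ^ (d * j)"
  have C: "C > 0" "C \<ge> 2 ^ (d * j)" "C \<ge> 2 * 2 ^ (j * d + d) / c"
    using c by (auto simp: C_def add_pos_pos)
  have "energy (4 ^ i) \<le> C / 2 ^ (d * i)" for i
  proof (induction i)
    case 0
    have "(1::real) \<le> 2 ^ (d * j)" by simp
    then have "1 \<le> C" using C(2) by linarith
    then show ?case using energy_le_1[of 1] by simp
  next
    case (Suc i)
    show ?case
    proof (cases "Suc i \<le> j")
      case True
      have "energy (4 ^ Suc i) \<le> 1" by (rule energy_le_1)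
      also have "1 \<le> C / 2 ^ (d * Suc i)"
      proof -
        have "d * Suc i \<le> d * j" using True by (rule mult_le_mono2)
        then have "(2::real) ^ (d * Suc i) \<le> 2 ^ (d * j)" by (intro power_increasing) auto
        then have "(2::real) ^ (d * Suc i) \<le> C" using C(2) by linarith
        then show ?thesis by (simp add: le_divide_eq del: mult_Suc_right)
      qed
      finally show ?thesis .
    next
      case False
      then have ij: "j \<le> i" by simp
      define r :: nat where "r = 2 ^ (i - j)"
      have r: "real r = 2 ^ i / 2 ^ j"
      proof -
        have "real r = 2 ^ (i - j)" by (simp add: r_def)
        then show ?thesis using ij by (simp add: power_diff)
      qed
      have "energy (4 ^ Suc i) \<le> energy (4 ^ i + 4 ^ i)" by (rule energy_antimono) simp
      also have "\<dots> \<le> 1 / card (word_ball r) + 2 * card S * real r ^ 2 * (energy (4 ^ i) / (4 ^ i))"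
        using energy_double[of "4 ^ i" r] by simp
      also have "1 / card (word_ball r) \<le> 1 / (c * real r ^ d)"
        using c V[of r] by (intro divide_left_mono) (auto simp: r_def card_ball_pos)
      also have "1 / (c * real r ^ d) = 2 ^ (j * d) / c / 2 ^ (d * i)"
        using c by (simp add: r power_divide power_mult[symmetric] mult.commute field_simps)
      also have "2 * card S * real r ^ 2 * (energy (4 ^ i) / (4 ^ i))
          = 2 * card S / (2 ^ j * 2 ^ j) * energy (4 ^ i)"
        using r by (simp add: power_divide power2_eq_square) (simp add: power_mult_distrib[symmetric])
      also have "\<dots> \<le> (1 / (2 * 2 ^ d)) * (C / 2 ^ (d * i))"
      proof (rule mult_mono[OF _ Suc.IH])
        have "2 * card S * (2 * 2 ^ d) \<le> (2::real) ^ j" using j by (simp add: mult_ac)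
        also have "\<dots> \<le> 2 ^ j * 2 ^ j" by simp
        finally show "2 * card S / (2 ^ j * 2 ^ j) \<le> (1 / (2 * 2 ^ d) :: real)" by (simp add: field_simps)
      qed (use energy_pos in \<open>auto intro: less_imp_le\<close>)
      finally have "energy (4 ^ Suc i) \<le> (2 ^ (j * d) / c + C / (2 * 2 ^ d)) / 2 ^ (d * i)"
        by (simp add: add_divide_distrib)
      also have "\<dots> \<le> (C / 2 ^ d) / 2 ^ (d * i)"
      proof (rule divide_right_mono)
        have "2 ^ (j * d) / c = (2 * 2 ^ (j * d + d) / c) / (2 * 2 ^ d)" by (simp add: power_add)
        also have "\<dots> \<le> C / (2 * 2 ^ d)" using C(3) by (rule divide_right_mono) simp
        finally have "2 ^ (j * d) / c \<le> C / (2 * 2 ^ d)" .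
        moreover have "C / 2 ^ d = C / (2 * 2 ^ d) + C / (2 * 2 ^ d)" by simp
        ultimately show "2 ^ (j * d) / c + C / (2 * 2 ^ d) \<le> C / 2 ^ d" by linarith
      qed simp
      finally show ?thesis by (simp add: power_add mult.commute)
    qed
  qed
  then show ?thesis using C(1) by blast
qed

text \<open>The exponent 4q is chosen so that the q-th root of the bound is of order n^(-2), hence
  summable over n.\<close>

lemma lazy_decay:
  assumes c: "c > 0" and V: "\<And>r. 1 \<le> r \<Longrightarrow> c * real r ^ (4 * q) \<le> card (word_ball r)"
  shows "\<exists>C>0. \<forall>n\<ge>1. \<forall>x\<in>carrier G. lazy n x \<le> C / (real n ^ 2) ^ q"
proof -
  obtain C where C: "C > 0" "\<And>i. energy (4 ^ i) \<le> C / 2 ^ (4 * q * i)"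
    using energy_decay[OF c V] by auto
  \<comment> \<open>64^q is (8^2)^q, from n \<le> 8 * 4^i; the summand 1 covers n = 1, where
    \<open>n div 2\<close> admits no power of 4 below it.\<close>
  define C' where "C' = C * 64 ^ q + 1"
  have C': "C' > 0" using C by (simp add: C'_def add_nonneg_pos)
  have "lazy n x \<le> C' / (real n ^ 2) ^ q" if n: "1 \<le> n" and x: "x \<in> carrier G" for n x
  proof (cases "n = 1")
    case True
    have "lazy n x \<le> tot (lazy n)" using x by (intro tot_point) (auto simp: lazy_nonneg)
    also have "\<dots> \<le> C'" using C by (simp add: tot_lazy C'_def)
    finally show ?thesis using True by simp
  next
    case False
    then have "1 \<le> n div 2" using n by simp
    then obtain i where i: "4 ^ i \<le> n div 2" "n div 2 < 4 ^ (i + 1)"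
      using ex_power_ivl1[of 4 "n div 2"] by auto
    have n1: "4 ^ i + 4 ^ i \<le> n" using i by simp
    have "n < 8 * 4 ^ i" using i by simp
    then have n2: "real n \<le> 8 * 4 ^ i" using of_nat_mono[of n "8 * 4 ^ i", where 'a = real] by simp
    have "lazy n x \<le> energy (4 ^ i)"
      using x by (intro lazy_bound_mono[OF n1 lazy_le_energy])
    also have "\<dots> \<le> C / 2 ^ (4 * q * i)" by (rule C)
    also have "(2::real) ^ (4 * q * i) = ((4 ^ i) ^ 2) ^ q"
    proof -
      have "(4::real) ^ i = 2 ^ (2 * i)" by (simp add: power_mult)
      then show ?thesis by (simp add: mult_ac flip: power_mult)
    qed
    also have "C / ((4 ^ i) ^ 2) ^ q \<le> C' / (real n ^ 2) ^ q"
    proof -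
      have "(real n ^ 2) ^ q \<le> ((8 * 4 ^ i) ^ 2) ^ q" using n2 by (intro power_mono) auto
      also have "\<dots> = 64 ^ q * ((4 ^ i) ^ 2) ^ q" by (simp add: power_mult_distrib)
      finally have "C * (real n ^ 2) ^ q \<le> C * (64 ^ q * ((4 ^ i) ^ 2) ^ q)" using C by simp
      also have "\<dots> \<le> C' * ((4 ^ i) ^ 2) ^ q" by (simp add: C'_def algebra_simps)
      finally show ?thesis using n by (simp add: field_simps)
    qed
    finally show ?thesis .
  qed
  then show ?thesis using C' by blast
qed

subsection \<open>Convergence at infinity of bounded functions\<close>

lemma lbound_left:
  assumes "lbound g D" "a \<in> carrier G"
  shows "lbound (\<lambda>x. g (a \<otimes> x)) D"
proof (rule lboundI)
  fix W assume W: "finite W" "W \<subseteq> carrier G"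
  have "inj_on (\<lambda>x. a \<otimes> x) W"
    by (rule inj_on_subset[OF bij_betw_imp_inj_on[OF bij_mult_left[OF assms(2)]] W(2)])
  then have "(\<Sum>x\<in>W. g (a \<otimes> x)) = sum g ((\<lambda>x. a \<otimes> x) ` W)"
    by (simp add: sum.reindex)
  also have "\<dots> \<le> D" using W assms by (intro lboundD) auto
  finally show "(\<Sum>x\<in>W. g (a \<otimes> x)) \<le> D" .
qed

lemma lbound_avg:
  assumes "\<And>s. s \<in> S \<Longrightarrow> lbound (g s) D"
  shows "lbound (\<lambda>x. avg (\<lambda>s. g s x)) D"
proof (rule lboundI)
  fix W assume W: "finite W" "W \<subseteq> carrier G"
  have "(\<Sum>x\<in>W. avg (\<lambda>s. g s x)) = avg (\<lambda>s. \<Sum>x\<in>W. g s x)"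
    unfolding avg_def sum_divide_distrib[symmetric] by (subst sum.swap) simp
  also have "\<dots> \<le> avg (\<lambda>s. D)" using assms W by (intro avg_mono lboundD)
  finally show "(\<Sum>x\<in>W. avg (\<lambda>s. g s x)) \<le> D" by simp
qed

lemma lbound_finite:
  assumes g: "lbound g D" and e: "\<epsilon> > 0"
  shows "finite {x \<in> carrier G. \<epsilon> < g x}"
proof (rule ccontr)
  assume inf: "infinite {x \<in> carrier G. \<epsilon> < g x}"
  obtain n :: nat where n: "D < n * \<epsilon>" using e by (metis reals_Archimedean3)
  obtain W where W: "finite W" "card W = n" "W \<subseteq> {x \<in> carrier G. \<epsilon> < g x}"
    using infinite_arbitrarily_large[OF inf] by blast
  have "n * \<epsilon> = (\<Sum>x\<in>W. \<epsilon>)" using W by simp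
  also have "\<dots> \<le> sum g W" using W by (intro sum_mono) auto
  also have "\<dots> \<le> D" using W g by (intro lboundD) auto
  finally show False using n by simp
qed

lemma tot_weighted_diff:
  assumes "fs w" "tot w = 1"
  shows "tot (\<lambda>z. w z * g z) - c = tot (\<lambda>z. w z * (g z - c))"
  using assms by (simp add: right_diff_distrib tot_diff fs_mult_left tot_cmult_right)

lemma abs_tot_weighted_power_le:
  assumes "fs w" "1 \<le> q"
  shows "\<bar>tot (\<lambda>z. w z * g z)\<bar> ^ q \<le> tot (\<lambda>z. \<bar>w z\<bar>) ^ (q - 1) * tot (\<lambda>z. \<bar>w z\<bar> * \<bar>g z\<bar> ^ q)"
proof -
  have "\<bar>tot (\<lambda>z. w z * g z)\<bar> \<le> tot (\<lambda>z. \<bar>w z * g z\<bar>)"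
    using assms by (intro tot_abs fs_mult_left)
  then have "\<bar>tot (\<lambda>z. w z * g z)\<bar> ^ q \<le> tot (\<lambda>z. \<bar>w z\<bar> * \<bar>g z\<bar>) ^ q"
    by (intro power_mono) (auto simp: abs_mult)
  also have "\<dots> \<le> tot (\<lambda>z. \<bar>w z\<bar>) ^ (q - 1) * tot (\<lambda>z. \<bar>w z\<bar> * \<bar>g z\<bar> ^ q)"
    using assms by (intro tot_power_le fs_abs) auto
  finally show ?thesis .
qed

definition cutoff :: "nat \<Rightarrow> ('a \<Rightarrow> real) \<Rightarrow> bool" where
  "cutoff k w \<longleftrightarrow> fs w \<and> (\<forall>z\<in>carrier G. 0 \<le> w z) \<and> tot w = 1 \<and>
     (\<forall>z\<in>carrier G. w z \<noteq> 0 \<longrightarrow> z \<in> word_ball k)"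

lemma cutoff_lazy: "cutoff k (lazy k)"
  unfolding cutoff_def using lazy_outside by (auto simp: lazy_nonneg tot_lazy)

text \<open>The l^1 cost of a translation. The inverse appears because moving x to
  \<open>x \<otimes> s\<close> in a convolution shifts the weight by \<open>inv s\<close>.\<close>

definition translate_diff :: "('a \<Rightarrow> real) \<Rightarrow> 'a \<Rightarrow> real" where
  "translate_diff w s = tot (\<lambda>z. \<bar>w (inv s \<otimes> z) - w z\<bar>)"

text \<open>The translation passes from the function to the weight. Both weights have total 1, so
  \<open>T x\<close> may be subtracted, which leaves differences of \<open>T\<close> over short
  paths.\<close>

lemma conv_translate_diff:
  assumes w: "fs w" "tot w = 1" and s: "s \<in> carrier G" and x: "x \<in> carrier G"
  shows "tot (\<lambda>z. w z * T (x \<otimes> s \<otimes> z)) - tot (\<lambda>z. w z * T (x \<otimes> z))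
    = tot (\<lambda>z. (w (inv s \<otimes> z) - w z) * (T (x \<otimes> z) - T x))"
proof -
  have fs: "fs (\<lambda>z. w (inv s \<otimes> z))" using w s by (intro fs_left) auto
  have "tot (\<lambda>z. w z * T (x \<otimes> s \<otimes> z)) = tot (\<lambda>z. w (inv s \<otimes> z) * T (x \<otimes> s \<otimes> (inv s \<otimes> z)))"
    using s by (intro tot_left[symmetric]) auto
  also have "\<dots> = tot (\<lambda>z. w (inv s \<otimes> z) * T (x \<otimes> z))"
  proof (rule infsum_cong)
    fix z assume z: "z \<in> carrier G"
    have "s \<otimes> (inv s \<otimes> z) = z" using s z by (simp add: m_assoc[symmetric])
    then have "x \<otimes> s \<otimes> (inv s \<otimes> z) = x \<otimes> z" using x s z by (simp add: m_assoc)
    then show "w (inv s \<otimes> z) * T (x \<otimes> s \<otimes> (inv s \<otimes> z)) = w (inv s \<otimes> z) * T (x \<otimes> z)"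
      using x s by simp
  qed
  also have "\<dots> - T x = tot (\<lambda>z. w (inv s \<otimes> z) * (T (x \<otimes> z) - T x))"
    using fs w s by (intro tot_weighted_diff) (auto simp: tot_left)
  moreover have "tot (\<lambda>z. w z * T (x \<otimes> z)) - T x = tot (\<lambda>z. w z * (T (x \<otimes> z) - T x))"
    using w by (intro tot_weighted_diff) auto
  moreover have "tot (\<lambda>z. (w (inv s \<otimes> z) - w z) * (T (x \<otimes> z) - T x))
    = tot (\<lambda>z. w (inv s \<otimes> z) * (T (x \<otimes> z) - T x)) - tot (\<lambda>z. w z * (T (x \<otimes> z) - T x))"
    by (simp add: left_diff_distrib tot_diff fs w fs_mult_left)
  ultimately show ?thesis by simp
qed

section \<open>Convolving a bounded function with a cutoff\<close>

context
  fixes T :: "'a \<Rightarrow> real" and b D :: real and m q :: nat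
  assumes b: "0 \<le> b" "\<And>x y. x \<in> carrier G \<Longrightarrow> y \<in> carrier G \<Longrightarrow> \<bar>T x - T y\<bar> \<le> b"
    and D: "\<And>s. s \<in> S \<Longrightarrow> lbound (\<lambda>x. \<bar>T (x \<otimes> s) - T x\<bar> ^ m) D"
    and mq: "1 \<le> m" "m \<le> q"
begin

lemma D_nonneg: "0 \<le> D"
  using S_ne D lbound_nonneg by blast

text \<open>Truncation pays off here: q - m of the factors are replaced by the oscillation b, so the
  q-th power of the norm grows like k^m instead of k^q.\<close>

lemma lbound_path_bounded:
  assumes z: "z \<in> word_ball k"
  shows "lbound (\<lambda>x. \<bar>T (x \<otimes> z) - T x\<bar> ^ q) (b ^ (q - m) * (real k ^ m * D))"
proof (rule lbound_mono[OF lbound_cmult[OF lbound_path[OF mq(1) D z]] eq_refl])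
  show "b ^ (q - m) * (real k ^ m * D) = b ^ (q - m) * (real k ^ m * D)" ..
  fix x assume x: "x \<in> carrier G"
  have "\<bar>T (x \<otimes> z) - T x\<bar> ^ q = \<bar>T (x \<otimes> z) - T x\<bar> ^ (q - m) * \<bar>T (x \<otimes> z) - T x\<bar> ^ m"
    using mq by (simp flip: power_add)
  also have "\<dots> \<le> b ^ (q - m) * \<bar>T (x \<otimes> z) - T x\<bar> ^ m"
    using b x z by (intro mult_right_mono power_mono) auto
  finally show "\<bar>T (x \<otimes> z) - T x\<bar> ^ q \<le> b ^ (q - m) * \<bar>T (x \<otimes> z) - T x\<bar> ^ m" .
qed (use b in auto)

lemma lbound_conv_diff:
  assumes "cutoff k w"
  shows "lbound (\<lambda>x. \<bar>T x - tot (\<lambda>z. w z * T (x \<otimes> z))\<bar> ^ q) (b ^ (q - m) * (real k ^ m * D))"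
proof -
  have w: "fs w" "\<And>z. z \<in> carrier G \<Longrightarrow> 0 \<le> w z" "tot w = 1"
    "\<And>z. z \<in> carrier G \<Longrightarrow> w z \<noteq> 0 \<Longrightarrow> z \<in> word_ball k"
    using assms by (auto simp: cutoff_def)
  have "lbound (\<lambda>x. tot (\<lambda>z. w z * \<bar>T (x \<otimes> z) - T x\<bar> ^ q)) (tot w * (b ^ (q - m) * (real k ^ m * D)))"
    using w by (intro lbound_tot lbound_path_bounded) auto
  then show ?thesis
  proof (rule lbound_mono)
    fix x assume x: "x \<in> carrier G"
    have abs: "tot (\<lambda>z. \<bar>w z\<bar> * h z) = tot (\<lambda>z. w z * h z)" for h
      using w by (intro infsum_cong) auto
    have "\<bar>T x - tot (\<lambda>z. w z * T (x \<otimes> z))\<bar> = \<bar>tot (\<lambda>z. w z * (T (x \<otimes> z) - T x))\<bar>"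
      using tot_weighted_diff[OF w(1,3), of "\<lambda>z. T (x \<otimes> z)" "T x"] by (simp add: abs_minus_commute)
    then show "\<bar>T x - tot (\<lambda>z. w z * T (x \<otimes> z))\<bar> ^ q \<le> tot (\<lambda>z. w z * \<bar>T (x \<otimes> z) - T x\<bar> ^ q)"
      using abs_tot_weighted_power_le[OF w(1), of q "\<lambda>z. T (x \<otimes> z) - T x"] mq abs[of "\<lambda>_. 1"] w(3)
      by (simp add: abs)
  qed (simp add: w)
qed

text \<open>Hoelder against the signed weight gives q - 1 factors \<open>translate_diff\<close>;
  summation over x gives the last one.\<close>

lemma lbound_conv_gradient:
  assumes "cutoff k w" and s: "s \<in> S"
  shows "lbound (\<lambda>x. \<bar>tot (\<lambda>z. w z * T (x \<otimes> s \<otimes> z)) - tot (\<lambda>z. w z * T (x \<otimes> z))\<bar> ^ q)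
    (translate_diff w s ^ q * (b ^ (q - m) * (real (k + 1) ^ m * D)))"
proof -
  have w: "fs w" "\<And>z. z \<in> carrier G \<Longrightarrow> 0 \<le> w z" "tot w = 1"
    "\<And>z. z \<in> carrier G \<Longrightarrow> w z \<noteq> 0 \<Longrightarrow> z \<in> word_ball k"
    using assms by (auto simp: cutoff_def)
  let ?v = "\<lambda>z. w (inv s \<otimes> z) - w z"
  have v: "fs ?v" using w s by (intro fs_diff fs_left) auto
  \<comment> \<open>The translated weight may reach one step beyond the ball of radius k, hence k +
    1 in the bound.\<close>
  have vsupp: "z \<in> word_ball (k + 1)" if z: "z \<in> carrier G" "\<bar>?v z\<bar> \<noteq> 0" for z
  proof (cases "w z = 0")
    case True
    then have "inv s \<otimes> z \<in> word_ball k" using z s by (intro w) auto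
    from ball_mult_left[OF this s] show ?thesis using z s by (simp add: m_assoc[symmetric])
  next
    case False
    then show ?thesis using w(4)[OF z(1)] by auto
  qed
  let ?B = "b ^ (q - m) * (real (k + 1) ^ m * D)"
  have "lbound (\<lambda>x. tot (\<lambda>z. \<bar>?v z\<bar> * \<bar>T (x \<otimes> z) - T x\<bar> ^ q)) (tot (\<lambda>z. \<bar>?v z\<bar>) * ?B)"
    using v vsupp by (intro lbound_tot lbound_path_bounded fs_abs) auto
  then have "lbound (\<lambda>x. translate_diff w s ^ (q - 1) * tot (\<lambda>z. \<bar>?v z\<bar> * \<bar>T (x \<otimes> z) - T x\<bar> ^ q))
      (translate_diff w s ^ (q - 1) * (translate_diff w s * ?B))"
    unfolding translate_diff_def by (rule lbound_cmult) (auto intro!: zero_le_power tot_nonneg)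
  then show ?thesis
  proof (rule lbound_mono)
    fix x assume x: "x \<in> carrier G"
    show "\<bar>tot (\<lambda>z. w z * T (x \<otimes> s \<otimes> z)) - tot (\<lambda>z. w z * T (x \<otimes> z))\<bar> ^ q
      \<le> translate_diff w s ^ (q - 1) * tot (\<lambda>z. \<bar>?v z\<bar> * \<bar>T (x \<otimes> z) - T x\<bar> ^ q)"
      using abs_tot_weighted_power_le[OF v, of q "\<lambda>z. T (x \<otimes> z) - T x"] mq
      by (simp add: conv_translate_diff[OF w(1,3) S_carrier[OF s] x] translate_diff_def)
  qed (use mq in \<open>cases q; simp\<close>)
qed

end

text \<open>The bound from l^q to l^inf: Jensen moves the power inside the average, then the
  supremum of the kernel replaces the weights.\<close>

lemma smear_power_le:
  assumes g: "lbound (\<lambda>x. \<bar>g x\<bar> ^ q) A" and q: "1 \<le> q"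
    and N: "\<And>x. x \<in> carrier G \<Longrightarrow> lazy n x \<le> \<beta>" and x: "x \<in> carrier G"
  shows "\<bar>smear n g x\<bar> ^ q \<le> \<beta> * A"
proof -
  let ?W = "supp (lazy n)"
  have W: "finite ?W" "?W \<subseteq> carrier G" using fs_lazy by (auto simp: supp_def)
  have \<beta>: "0 \<le> \<beta>" using N[OF x] lazy_nonneg[of n x] by simp
  have "\<bar>smear n g x\<bar> ^ q \<le> tot (\<lambda>z. \<bar>lazy n z\<bar>) ^ (q - 1) * tot (\<lambda>z. \<bar>lazy n z\<bar> * \<bar>g (x \<otimes> z)\<bar> ^ q)"
    unfolding smear_def using q by (intro abs_tot_weighted_power_le) auto
  also have "\<dots> = tot (\<lambda>z. lazy n z * \<bar>g (x \<otimes> z)\<bar> ^ q)"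
    by (simp add: lazy_nonneg tot_lazy)
  also have "\<dots> = (\<Sum>z\<in>?W. lazy n z * \<bar>g (x \<otimes> z)\<bar> ^ q)"
    using W by (intro tot_eq_sum) (auto simp: supp_def)
  also have "\<dots> \<le> (\<Sum>z\<in>?W. \<beta> * \<bar>g (x \<otimes> z)\<bar> ^ q)"
    using W N by (intro sum_mono mult_right_mono) auto
  also have "\<dots> = \<beta> * (\<Sum>z\<in>?W. \<bar>g (x \<otimes> z)\<bar> ^ q)" by (simp add: sum_distrib_left)
  also have "\<dots> \<le> \<beta> * A"
    using lboundD[OF lbound_left[OF g x] W] \<beta> by (intro mult_left_mono)
  finally show ?thesis .
qed

end

section \<open>Boundedness of the Green operator and limits at infinity\<close>

lemma telescope_inverse_squares:
  fixes a :: "nat \<Rightarrow> real"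
  assumes a: "\<And>n. 1 \<le> n \<Longrightarrow> \<bar>a (Suc n) - a n\<bar> \<le> c / real n ^ 2" and c: "0 \<le> c" and "1 \<le> N" "N \<le> M"
  shows "\<bar>a M - a N\<bar> \<le> 2 * c / N"
proof -
  \<comment> \<open>The subtracted term makes the induction close, by 1/M^2 \<le> 2/(M(M+1)) = 2/M -
    2/(M+1).\<close>
  have "\<bar>a M - a N\<bar> \<le> 2 * c / N - 2 * c / M"
    using \<open>N \<le> M\<close>
  proof (induction M rule: dec_induct)
    case (step M)
    have M: "real M \<ge> 1" using step \<open>1 \<le> N\<close> by simp
    have "2 * c / real M - 2 * c / (real M + 1) = 2 * c / (real M * (real M + 1))"
      using M by (simp add: field_simps)
    moreover have "c / real M ^ 2 \<le> 2 * c / (real M * (real M + 1))"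
    proof -
      have "real M * (real M + 1) \<le> 2 * real M ^ 2" using M by (simp add: power2_eq_square)
      moreover have "0 < 2 * real M ^ 2 * (real M * (real M + 1))" using M by simp
      ultimately have "2 * c / (2 * real M ^ 2) \<le> 2 * c / (real M * (real M + 1))"
        using c by (intro divide_left_mono) simp_all
      then show ?thesis by simp
    qed
    moreover have "\<bar>a (Suc M) - a M\<bar> \<le> c / real M ^ 2" using a[of M] step \<open>1 \<le> N\<close> by simp
    ultimately show ?case using step.IH by (simp add: add.commute)
  qed auto
  also have "\<dots> \<le> 2 * c / N" using c by simp
  finally show ?thesis .
qed

context cayley_graph
begin

context
  fixes q :: nat and C R :: real
  assumes q: "1 \<le> q" and R: "0 \<le> R" "R ^ q = C"
    and decay: "\<And>n x. 1 \<le> n \<Longrightarrow> x \<in> carrier G \<Longrightarrow> lazy n x \<le> C / (real n ^ 2) ^ q"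
begin

lemma smear_decay:
  assumes g: "lbound (\<lambda>x. \<bar>g x\<bar> ^ q) (\<alpha> ^ q)" and \<alpha>: "0 \<le> \<alpha>" and n: "1 \<le> n" and x: "x \<in> carrier G"
  shows "\<bar>smear n g x\<bar> \<le> R * \<alpha> / real n ^ 2"
proof -
  have "\<bar>smear n g x\<bar> ^ q \<le> C / (real n ^ 2) ^ q * \<alpha> ^ q"
    using g q decay[OF n] x by (rule smear_power_le)
  also have "\<dots> = (R * \<alpha> / real n ^ 2) ^ q"
    by (simp add: power_mult_distrib power_divide flip: R(2))
  finally show ?thesis using R(1) \<alpha> q by (subst (asm) power_mono_iff) auto
qed

lemma lbound_laplacian:
  assumes F: "\<And>s. s \<in> S \<Longrightarrow> lbound (\<lambda>x. \<bar>F (x \<otimes> s) - F x\<bar> ^ q) A"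
  shows "lbound (\<lambda>x. \<bar>(nbr_avg F x - F x) / 2\<bar> ^ q) A"
proof (rule lbound_mono[OF lbound_avg[OF F] order_refl])
  fix x
  have "\<bar>(nbr_avg F x - F x) / 2\<bar> \<le> \<bar>avg (\<lambda>s. F (x \<otimes> s) - F x)\<bar>"
    by (simp add: nbr_avg_def avg_diff)
  also have "\<dots> \<le> avg (\<lambda>s. \<bar>F (x \<otimes> s) - F x\<bar>)" by (rule avg_abs)
  finally have "\<bar>(nbr_avg F x - F x) / 2\<bar> ^ q \<le> avg (\<lambda>s. \<bar>F (x \<otimes> s) - F x\<bar>) ^ q"
    by (intro power_mono) auto
  also have "\<dots> \<le> avg (\<lambda>s. \<bar>F (x \<otimes> s) - F x\<bar> ^ q)" using q by (intro avg_power) auto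
  finally show "\<bar>(nbr_avg F x - F x) / 2\<bar> ^ q \<le> avg (\<lambda>s. \<bar>F (x \<otimes> s) - F x\<bar> ^ q)" .
qed auto

text \<open>Successive averages of \<open>F\<close> differ by a lazy average of its Laplacian, of
  size R \<delta> / n^2; adding these up is the Green operator estimate.\<close>

lemma smear_Cauchy:
  assumes F: "\<And>s. s \<in> S \<Longrightarrow> lbound (\<lambda>x. \<bar>F (x \<otimes> s) - F x\<bar> ^ q) (\<delta> ^ q)" and \<delta>: "0 \<le> \<delta>"
    and x: "x \<in> carrier G" and N: "1 \<le> N" "N \<le> M"
  shows "\<bar>smear M F x - smear N F x\<bar> \<le> 2 * (R * \<delta>) / N"
proof (rule telescope_inverse_squares[OF _ _ N])
  fix n :: nat assume n: "1 \<le> n"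
  show "\<bar>smear (Suc n) F x - smear n F x\<bar> \<le> R * \<delta> / real n ^ 2"
    using smear_decay[OF lbound_laplacian[OF F] \<delta> n x] by (simp add: smear_Suc_diff x)
qed (use R \<delta> in auto)

text \<open>The step from time 0 to time 1 has no kernel decay; it is at most \<delta> by the l^q
  bound itself, and the later steps add 2R\<delta>.\<close>

lemma smear_dist:
  assumes F: "\<And>s. s \<in> S \<Longrightarrow> lbound (\<lambda>x. \<bar>F (x \<otimes> s) - F x\<bar> ^ q) (\<delta> ^ q)" and \<delta>: "0 \<le> \<delta>"
    and x: "x \<in> carrier G" and N: "1 \<le> N"
  shows "\<bar>smear N F x - F x\<bar> \<le> \<delta> * (1 + 2 * R)"
proof -
  have "\<bar>(nbr_avg F x - F x) / 2\<bar> ^ q \<le> \<delta> ^ q"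
    using lbound_point[OF lbound_laplacian[OF F] x] by simp
  then have "\<bar>(nbr_avg F x - F x) / 2\<bar> \<le> \<delta>"
    using \<delta> q by (subst (asm) power_mono_iff) auto
  moreover have "smear 1 F x - F x = (nbr_avg F x - F x) / 2"
    using smear_Suc[OF x, of 0 F] x by (simp add: smear_0 field_simps)
  moreover have "\<bar>smear N F x - smear 1 F x\<bar> \<le> 2 * (R * \<delta>) / (1::nat)"
    by (rule smear_Cauchy[OF F \<delta> x _ N]) auto
  ultimately show ?thesis by (simp add: algebra_simps abs_le_iff)
qed

text \<open>The averages \<open>smear n T\<close> converge uniformly to a limit \<open>L\<close>.
  Replacing \<open>T\<close> by a convolution \<open>F\<close> of tiny gradient, with
  \<open>T - F\<close> in l^q, shows that \<open>L\<close> is constant. Finally \<open>T\<close>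
  differs from \<open>smear N T\<close> by an l^q function, and \<open>smear N T\<close> is
  uniformly close to \<open>L\<close>.\<close>

lemma converges_at_infinity:
  assumes b: "0 \<le> b" "\<And>x y. x \<in> carrier G \<Longrightarrow> y \<in> carrier G \<Longrightarrow> \<bar>T x - T y\<bar> \<le> b"
    and D: "\<And>s. s \<in> S \<Longrightarrow> lbound (\<lambda>x. \<bar>T (x \<otimes> s) - T x\<bar> ^ m) D"
    and m: "1 \<le> m" "m \<le> q"
    and cut: "\<And>\<epsilon>. \<epsilon> > 0 \<Longrightarrow> \<exists>k w. cutoff k w \<and> (\<forall>s\<in>S. translate_diff w s ^ q * real (k + 1) ^ m \<le> \<epsilon>)"
  shows "\<exists>c. \<forall>\<epsilon>>0. finite {x \<in> carrier G. \<epsilon> < \<bar>T x - c\<bar>}"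
proof -
  have D0: "0 \<le> D" by (rule D_nonneg[OF b D m])
  have root: "root q A ^ q = A" "0 \<le> root q A" if "0 \<le> A" for A :: real
    using that q by (auto simp: real_root_pow_pos2)
  define B where "B = b ^ (q - m) * D"
  have B: "0 \<le> B" using b D0 by (simp add: B_def)
  have T: "lbound (\<lambda>x. \<bar>T (x \<otimes> s) - T x\<bar> ^ q) (root q B ^ q)" if s: "s \<in> S" for s
  proof -
    have "s \<in> word_ball 1" using ball_mult_right[OF one_in_ball s, of 0] s by simp
    from lbound_path_bounded[OF b D m this] show ?thesis
      by (simp add: root(1)[OF B[unfolded B_def]] B_def)
  qed
  define K where "K = 2 * (R * root q B)"
  have K: "\<bar>smear M T x - smear N T x\<bar> \<le> K / N" if "x \<in> carrier G" "1 \<le> N" "N \<le> M" for x M N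
    unfolding K_def using smear_Cauchy[OF T root(2)[OF B] that] .
  have K0: "0 \<le> K" using R root(2)[OF B] by (simp add: K_def)
  have Cauchy: "Cauchy (\<lambda>n. smear n T x)" if x: "x \<in> carrier G" for x
  proof (rule CauchyI')
    fix e :: real assume e: "0 < e"
    obtain n :: nat where "K < n * e" using e by (metis reals_Archimedean3)
    then have n: "K < real (Suc n) * e" using e by (simp add: algebra_simps)
    show "\<exists>M0. \<forall>i\<ge>M0. \<forall>j>i. dist (smear i T x) (smear j T x) < e"
    proof (intro exI[of _ "Suc n"] allI impI)
      fix i j assume i: "Suc n \<le> i" and j: "i < j"
      have "dist (smear i T x) (smear j T x) \<le> K / i"
        using K[OF x, of i j] i j by (simp add: dist_real_def abs_minus_commute)
      also have "\<dots> < e"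
      proof -
        have "real (Suc n) * e \<le> real i * e" using i e by (intro mult_right_mono) auto
        then show ?thesis using n i by (simp add: divide_less_eq mult.commute)
      qed
      finally show "dist (smear i T x) (smear j T x) < e" .
    qed
  qed
  define L where "L x = lim (\<lambda>n. smear n T x)" for x
  have L: "(\<lambda>n. smear n T x) \<longlonglongrightarrow> L x" if "x \<in> carrier G" for x
    using Cauchy[OF that] unfolding L_def by (simp add: Cauchy_convergent_iff convergent_LIMSEQ_iff)
  have step: "L (x \<otimes> s) = L x" if x: "x \<in> carrier G" and s: "s \<in> S" for x s
  proof -
    have "\<bar>L (x \<otimes> s) - L x\<bar> \<le> \<epsilon>" if \<epsilon>: "\<epsilon> > 0" for \<epsilon>
    proof -
      \<comment> \<open>One step of \<open>F\<close> costs \<delta>, and comparing \<open>F\<close>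
        with its average at two points costs 2\<delta>(1 + 2R); the sum is \<delta>(3 + 4R).\<close>
      define \<delta> where "\<delta> = \<epsilon> / (3 + 4 * R)"
      have \<delta>: "\<delta> > 0" using \<epsilon> R by (simp add: \<delta>_def add_pos_nonneg)
      \<comment> \<open>The q-th power of the l^q gradient of \<open>F\<close> is at most B times
        the cutoff quantity; B + 1 avoids a division by zero.\<close>
      define \<eta> where "\<eta> = \<delta> ^ q / (B + 1)"
      have "\<eta> > 0" using \<delta> B by (simp add: \<eta>_def add_nonneg_pos)
      then obtain k w where w: "cutoff k w" "\<And>s. s \<in> S \<Longrightarrow> translate_diff w s ^ q * real (k + 1) ^ m \<le> \<eta>"
        using cut by blast
      define F where "F x = tot (\<lambda>z. w z * T (x \<otimes> z))" for x
      have gradF: "lbound (\<lambda>x. \<bar>F (x \<otimes> s) - F x\<bar> ^ q) (\<delta> ^ q)" if s: "s \<in> S" for s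
      proof (rule lbound_mono[OF lbound_conv_gradient[OF b D m w(1) s]])
        have "translate_diff w s ^ q * (b ^ (q - m) * (real (k + 1) ^ m * D))
          = (translate_diff w s ^ q * real (k + 1) ^ m) * B" by (simp add: B_def mult_ac)
        also have "\<dots> \<le> \<eta> * B" using w(2)[OF s] B by (rule mult_right_mono)
        also have "\<dots> \<le> \<eta> * (B + 1)" using \<open>\<eta> > 0\<close> by (intro mult_left_mono) auto
        also have "\<dots> = \<delta> ^ q" using B by (simp add: \<eta>_def)
        finally show "translate_diff w s ^ q * (b ^ (q - m) * (real (k + 1) ^ m * D)) \<le> \<delta> ^ q" .
      qed (simp_all add: F_def)
      \<comment> \<open>E depends on k and may be huge, but k stays fixed while n tends to infinity,
        so the average of \<open>T - F\<close> vanishes in the limit.\<close>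
      define E where "E = b ^ (q - m) * (real k ^ m * D)"
      have E: "0 \<le> E" using b D0 by (simp add: E_def)
      have TF: "lbound (\<lambda>x. \<bar>T x - F x\<bar> ^ q) (root q E ^ q)"
        using lbound_conv_diff[OF b D m w(1)] by (simp add: root E F_def flip: E_def)
      have xs: "x \<otimes> s \<in> carrier G" using x s by simp
      have bound: "\<bar>smear n T (x \<otimes> s) - smear n T x\<bar> \<le> \<epsilon> + 2 * (R * root q E / real n ^ 2)" if n: "1 \<le> n" for n
      proof -
        have "\<bar>F (x \<otimes> s) - F x\<bar> ^ q \<le> \<delta> ^ q" using lbound_point[OF gradF[OF s] x] .
        then have "\<bar>F (x \<otimes> s) - F x\<bar> \<le> \<delta>" using \<delta> q by (subst (asm) power_mono_iff) auto
        moreover have "\<bar>smear n F y - F y\<bar> \<le> \<delta> * (1 + 2 * R)" if "y \<in> carrier G" for y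
          using smear_dist[OF gradF _ that n] \<delta> by simp
        from this[OF x] this[OF xs]
        have "\<bar>smear n F x - F x\<bar> \<le> \<delta> * (1 + 2 * R)" "\<bar>smear n F (x \<otimes> s) - F (x \<otimes> s)\<bar> \<le> \<delta> * (1 + 2 * R)" .
        moreover have "\<bar>smear n T y - smear n F y\<bar> \<le> R * root q E / real n ^ 2" if "y \<in> carrier G" for y
          using smear_decay[OF TF root(2)[OF E] n that] by (simp add: smear_diff)
        from this[OF x] this[OF xs]
        have "\<bar>smear n T x - smear n F x\<bar> \<le> R * root q E / real n ^ 2"
          "\<bar>smear n T (x \<otimes> s) - smear n F (x \<otimes> s)\<bar> \<le> R * root q E / real n ^ 2" .
        moreover have "\<delta> + 2 * (\<delta> * (1 + 2 * R)) = \<epsilon>"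
        proof -
          have "\<delta> + 2 * (\<delta> * (1 + 2 * R)) = \<delta> * (3 + 4 * R)" by (simp add: algebra_simps)
          then show ?thesis using R by (simp add: \<delta>_def)
        qed
        ultimately show ?thesis by linarith
      qed
      have lim: "(\<lambda>n. \<epsilon> + 2 * (R * root q E / real n ^ 2)) \<longlonglongrightarrow> \<epsilon> + 2 * 0"
        by (intro tendsto_intros real_tendsto_divide_at_top filterlim_pow_at_top filterlim_real_sequentially) auto
      have "(\<lambda>n. \<bar>smear n T (x \<otimes> s) - smear n T x\<bar>) \<longlonglongrightarrow> \<bar>L (x \<otimes> s) - L x\<bar>"
        using L[OF x] L[OF xs] by (intro tendsto_intros)
      from tendsto_le[OF _ lim this] bound show ?thesis
        by (simp add: eventually_sequentially) (metis One_nat_def)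
    qed
    then show ?thesis using field_le_epsilon[of "\<bar>L (x \<otimes> s) - L x\<bar>" 0] by simp
  qed
  have const: "L x = L \<one>" if "x \<in> word_ball n" for x n
    using that
  proof (induction n arbitrary: x)
    case (Suc n)
    then show ?case using step[OF ball_carrierD[of _ n]] by auto
  qed auto
  have "finite {x \<in> carrier G. \<epsilon> < \<bar>T x - L \<one>\<bar>}" if \<epsilon>: "\<epsilon> > 0" for \<epsilon>
  proof -
    obtain n :: nat where "2 * K < n * \<epsilon>" using \<epsilon> by (metis reals_Archimedean3)
    then have n: "2 * K < real (Suc n) * \<epsilon>" using \<epsilon> by (simp add: algebra_simps)
    let ?N = "Suc n"
    have KN: "K / ?N \<le> \<epsilon> / 2" using n by (simp add: divide_le_eq mult.commute del: of_nat_Suc)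
    have close: "\<bar>smear ?N T x - L \<one>\<bar> \<le> K / ?N" if x: "x \<in> carrier G" for x
    proof -
      have "L x = L \<one>" using const carrier_ball[OF x] by blast
      then have lim: "(\<lambda>M. \<bar>smear M T x - smear ?N T x\<bar>) \<longlonglongrightarrow> \<bar>L \<one> - smear ?N T x\<bar>"
        using L[OF x] by (intro tendsto_intros) simp
      have "\<bar>L \<one> - smear ?N T x\<bar> \<le> K / ?N"
        by (rule LIMSEQ_le_const2[OF lim]) (use K[OF x, of ?N] in auto)
      then show ?thesis by (simp add: abs_minus_commute)
    qed
    have "lbound (\<lambda>x. \<bar>T x - smear ?N T x\<bar> ^ q) (b ^ (q - m) * (real ?N ^ m * D))"
      using lbound_conv_diff[OF b D m cutoff_lazy[of ?N]] by (simp add: smear_def)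
    from lbound_finite[OF this, of "(\<epsilon> / 2) ^ q"] \<epsilon>
    have "finite {x \<in> carrier G. (\<epsilon> / 2) ^ q < \<bar>T x - smear ?N T x\<bar> ^ q}" by simp
    then show ?thesis
    proof (rule finite_subset[rotated], safe)
      fix x assume x: "x \<in> carrier G" and "\<epsilon> < \<bar>T x - L \<one>\<bar>"
      then have "\<epsilon> / 2 < \<bar>T x - smear ?N T x\<bar>" using close[OF x] KN by linarith
      then show "(\<epsilon> / 2) ^ q < \<bar>T x - smear ?N T x\<bar> ^ q"
        using \<epsilon> q by (intro power_strict_mono) auto
    qed
  qed
  then show ?thesis by blast
qed

end

end

text \<open>The even binomial coefficients carry half of 2^n. This transfers the lower bound, known
  at even times only, from the simple walk to the lazy walk.\<close>

lemma half_le_sum_even_choose: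
  fixes r :: "nat \<Rightarrow> real"
  assumes n: "0 < n" and r0: "\<And>j. 0 \<le> r j" and r: "\<And>j. even j \<Longrightarrow> j \<le> n \<Longrightarrow> \<beta> \<le> r j"
  shows "\<beta> / 2 \<le> (\<Sum>j\<le>n. real (n choose j) * r j) / 2 ^ n"
proof -
  have "\<beta> * 2 ^ n / 2 = \<beta> * (\<Sum>j\<le>n. if even j then real (n choose j) else 0)"
    using choose_even_sum[OF n, where 'a = real] by (simp add: if_distrib[of real])
  also have "\<dots> = (\<Sum>j\<le>n. if even j then real (n choose j) * \<beta> else 0)"
    by (auto simp: sum_distrib_left intro!: sum.cong)
  also have "\<dots> \<le> (\<Sum>j\<le>n. real (n choose j) * r j)"
    using r0 r by (intro sum_mono) (auto intro: mult_left_mono)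
  finally show ?thesis by (simp add: le_divide_eq)
qed

context cayley_graph
begin

subsection \<open>Cutoffs from the return probability\<close>

lemma neighbours_cayley: "x \<in> carrier G \<Longrightarrow> neighbours (cayley_edges G S) x = (\<lambda>s. x \<otimes> s) ` S"
  by (auto simp: neighbours_def cayley_edges_def)

lemma inj_on_mult_left: "x \<in> carrier G \<Longrightarrow> inj_on (\<lambda>s. x \<otimes> s) S"
  using S_sub by (auto simp: inj_on_def)

lemma neighbours_average:
  "x \<in> carrier G \<Longrightarrow> (1 / real (card (neighbours (cayley_edges G S) x))) *
     (\<Sum>y\<in>neighbours (cayley_edges G S) x. f y) = nbr_avg f x"
  by (simp add: neighbours_cayley card_image inj_on_mult_left sum.reindex nbr_avg_def avg_def)

lemma walk_operator_cayley:
  "x \<in> carrier G \<Longrightarrow> walk_operator (cayley_edges G S) f x = nbr_avg f x"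
  unfolding walk_operator_def by (rule neighbours_average)

abbreviation walk :: "nat \<Rightarrow> 'a \<Rightarrow> real" where
  "walk n \<equiv> (walk_operator (cayley_edges G S) ^^ n) (indicat_real {\<one>})"

lemma walk_nonneg: "0 \<le> walk n x"
  by (induction n arbitrary: x) (auto simp: walk_operator_def intro!: sum_nonneg divide_nonneg_nonneg)

lemma lazy_binomial:
  "x \<in> carrier G \<Longrightarrow> lazy n x = (\<Sum>j\<le>n. real (n choose j) * walk j x) / 2 ^ n"
proof (induction n arbitrary: x)
  case (Suc n)
  \<comment> \<open>Pascal's rule: the binomial expansion of ((I + P)/2)^n gains one factor.\<close>
  have shift: "(\<Sum>j\<le>Suc n. real (Suc n choose j) * a j) = (\<Sum>j\<le>n. real (n choose j) * a j) + (\<Sum>j\<le>n. real (n choose j) * a (Suc j))"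
    for a :: "nat \<Rightarrow> real"
  proof -
    have "(\<Sum>j\<le>Suc n. real (Suc n choose j) * a j) = a 0 + (\<Sum>j\<le>n. real (Suc n choose Suc j) * a (Suc j))"
      by (subst sum.atMost_Suc_shift) simp
    also have "\<dots> = (a 0 + (\<Sum>j\<le>n. real (n choose Suc j) * a (Suc j))) + (\<Sum>j\<le>n. real (n choose j) * a (Suc j))"
      by (simp add: distrib_right sum.distrib)
    also have "a 0 + (\<Sum>j\<le>n. real (n choose Suc j) * a (Suc j)) = (\<Sum>j\<le>Suc n. real (n choose j) * a j)"
      by (subst sum.atMost_Suc_shift) simp
    finally show ?thesis by simp
  qed
  have walk_Suc: "walk (Suc j) x = nbr_avg (walk j) x" for j
    using walk_operator_cayley[OF Suc.prems, of "walk j"] by simp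
  have "nbr_avg (lazy n) x = avg (\<lambda>s. (\<Sum>j\<le>n. real (n choose j) * walk j (x \<otimes> s)) / 2 ^ n)"
    unfolding nbr_avg_def using Suc by (intro avg_cong) auto
  also have "\<dots> = (\<Sum>j\<le>n. real (n choose j) * nbr_avg (walk j) x) / 2 ^ n"
    unfolding avg_divide unfolding avg_def nbr_avg_def
    by (subst sum.swap) (simp add: sum_distrib_left sum_divide_distrib)
  also have "\<dots> = (\<Sum>j\<le>n. real (n choose j) * walk (Suc j) x) / 2 ^ n"
    by (simp only: walk_Suc)
  finally have "nbr_avg (lazy n) x = (\<Sum>j\<le>n. real (n choose j) * walk (Suc j) x) / 2 ^ n" .
  then show ?case using Suc.IH[OF Suc.prems] unfolding shift lazy.simps
    by (simp add: add_divide_distrib mult.commute)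
qed (auto simp: indicator_def)

text \<open>\<open>min 1 K\<^sub>1\<close> covers time 0, which the hypothesis on the return
  probability omits; every other even j up to 2n is bounded by its value at 2n.\<close>

lemma energy_lower_bound:
  assumes K: "K\<^sub>1 > 0" "K\<^sub>2 > 0" and \<gamma>: "0 < \<gamma>"
    and ret: "\<And>n::nat. even n \<Longrightarrow> n \<ge> 1 \<Longrightarrow>
      return_probability (cayley_edges G S) \<one> n \<ge> K\<^sub>1 * exp (- K\<^sub>2 * real n powr \<gamma>)"
    and n: "0 < n"
  shows "min 1 K\<^sub>1 / 2 * exp (- K\<^sub>2 * real (2 * n) powr \<gamma>) \<le> energy n"
proof -
  have "min 1 K\<^sub>1 * exp (- K\<^sub>2 * real (n + n) powr \<gamma>) / 2
      \<le> (\<Sum>j\<le>n + n. real (n + n choose j) * walk j \<one>) / 2 ^ (n + n)"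
  proof (rule half_le_sum_even_choose)
    fix j :: nat assume j: "even j" "j \<le> n + n"
    have e: "exp (- K\<^sub>2 * real (n + n) powr \<gamma>) \<le> exp (- K\<^sub>2 * real j powr \<gamma>)"
    proof -
      have "real j powr \<gamma> \<le> real (n + n) powr \<gamma>"
        using j \<gamma> by (intro powr_mono2) auto
      then show ?thesis using K by (simp del: of_nat_add)
    qed
    show "min 1 K\<^sub>1 * exp (- K\<^sub>2 * real (n + n) powr \<gamma>) \<le> walk j \<one>"
    proof (cases "j = 0")
      case True
      have "min 1 K\<^sub>1 * exp (- K\<^sub>2 * real (n + n) powr \<gamma>) \<le> 1 * 1"
        using K by (intro mult_mono) auto
      then show ?thesis using True by simp
    next
      case False
      have "min 1 K\<^sub>1 * exp (- K\<^sub>2 * real (n + n) powr \<gamma>) \<le> K\<^sub>1 * exp (- K\<^sub>2 * real j powr \<gamma>)"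
        using K e by (intro mult_mono) auto
      also have "\<dots> \<le> walk j \<one>" using ret[of j] j False by (simp add: return_probability_def)
      finally show ?thesis .
    qed
  qed (use n walk_nonneg in auto)
  also have "\<dots> = energy n" unfolding energy_eq by (rule lazy_binomial[symmetric]) simp
  finally show ?thesis unfolding mult_2 by simp
qed

text \<open>Squaring turns a small relative \<open>l\<^sup>2\<close> gradient into a small \<open>l\<^sup>1\<close> gradient.\<close>

definition cutoff_of :: "nat \<Rightarrow> 'a \<Rightarrow> real" where
  "cutoff_of n z = lazy n z ^ 2 / energy n"

lemma cutoff_cutoff_of: "cutoff n (cutoff_of n)"
proof -
  have "fs (\<lambda>z. lazy n z ^ 2)" by (intro fs_power) auto
  then have "fs (cutoff_of n)" unfolding cutoff_of_def by (rule fs_divide)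
  moreover have "tot (cutoff_of n) = 1"
    using energy_pos[of n] unfolding cutoff_of_def[abs_def] tot_divide by (simp add: energy_def)
  moreover have "0 \<le> cutoff_of n z" for z
    using energy_pos[of n] by (simp add: cutoff_of_def)
  moreover have "z \<in> word_ball n" if "z \<in> carrier G" "cutoff_of n z \<noteq> 0" for z
    using lazy_outside[of z n] that by (cases "z \<in> word_ball n") (simp_all add: cutoff_of_def)
  ultimately show ?thesis by (simp add: cutoff_def)
qed

text \<open>Factor the difference of squares and apply Cauchy-Schwarz: one factor is the energy
  loss, the other is at most 4 times the energy.\<close>

lemma translate_diff_cutoff_of:
  assumes s: "s \<in> S"
  shows "translate_diff (cutoff_of n) s \<le> 4 * sqrt (card S * ((energy n - energy (Suc n)) / energy n))"
proof -
  let ?u = "lazy n" and ?e = "energy n"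
  have e: "?e > 0" by (rule energy_pos)
  let ?v = "\<lambda>z. ?u (inv s \<otimes> z)"
  have v: "fs ?v" "fs (\<lambda>z. ?v z ^ 2)" using s by (auto intro!: fs_power)
  have ev: "tot (\<lambda>z. ?v z ^ 2) = ?e"
    using s tot_left[of "inv s" "\<lambda>z. ?u z ^ 2"] by (simp add: energy_def)
  have 1: "tot (\<lambda>z. \<bar>?v z - ?u z\<bar> ^ 2) \<le> 4 * card S * (?e - energy (Suc n))"
    using energy_drop_left[OF S_inv[OF s], of n] by simp
  have "tot (\<lambda>z. (?v z + ?u z) ^ 2) \<le> tot (\<lambda>z. 2 * ?v z ^ 2 + 2 * ?u z ^ 2)"
  proof (rule tot_mono)
    show "(?v z + ?u z) ^ 2 \<le> 2 * ?v z ^ 2 + 2 * ?u z ^ 2" for z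
      using sum_squares_bound[of "?v z" "?u z"] by (simp add: power2_sum)
  qed (use v in \<open>auto intro!: fs_power fs_add fs_mult_right\<close>)
  also have "\<dots> = 4 * ?e"
    using v by (simp add: tot_add tot_cmult fs_mult_right fs_power ev energy_def[symmetric])
  finally have 2: "tot (\<lambda>z. (?v z + ?u z) ^ 2) \<le> 4 * ?e" .
  have "translate_diff (cutoff_of n) s = tot (\<lambda>z. \<bar>?v z - ?u z\<bar> * (?v z + ?u z) / ?e)"
    unfolding translate_diff_def cutoff_of_def
  proof (rule infsum_cong)
    fix z
    have "\<bar>?v z ^ 2 / ?e - ?u z ^ 2 / ?e\<bar> = \<bar>(?v z - ?u z) * (?v z + ?u z)\<bar> / ?e"
      using e by (simp add: power2_eq_square algebra_simps flip: diff_divide_distrib)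
    then show "\<bar>?v z ^ 2 / ?e - ?u z ^ 2 / ?e\<bar> = \<bar>?v z - ?u z\<bar> * (?v z + ?u z) / ?e"
      by (simp add: abs_mult lazy_nonneg)
  qed
  also have "\<dots> = tot (\<lambda>z. \<bar>?v z - ?u z\<bar> * (?v z + ?u z)) / ?e" by (rule tot_divide)
  also have "\<dots> \<le> (sqrt (4 * card S * (?e - energy (Suc n))) * sqrt (4 * ?e)) / ?e"
  proof (rule divide_right_mono)
    have "tot (\<lambda>z. \<bar>?v z - ?u z\<bar> * (?v z + ?u z))
        \<le> sqrt (tot (\<lambda>z. \<bar>?v z - ?u z\<bar> ^ 2)) * sqrt (tot (\<lambda>z. (?v z + ?u z) ^ 2))"
      using v by (intro tot_Cauchy_Schwarz fs_abs fs_diff fs_add fs_lazy)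
    also have "\<dots> \<le> sqrt (4 * card S * (?e - energy (Suc n))) * sqrt (4 * ?e)"
      using 1 2 by (intro mult_mono real_sqrt_le_mono) (auto intro!: tot_nonneg mult_nonneg_nonneg simp: energy_Suc_le)
    finally show "tot (\<lambda>z. \<bar>?v z - ?u z\<bar> * (?v z + ?u z)) \<le> \<dots>" .
  qed (use e in simp)
  also have "\<dots> = 4 * sqrt (card S * ((?e - energy (Suc n)) / ?e))"
  proof -
    have "sqrt (4 * card S * (?e - energy (Suc n))) * sqrt (4 * ?e) / ?e
      = 4 * (sqrt (card S * (?e - energy (Suc n))) * sqrt ?e) / ?e"
      by (simp add: real_sqrt_mult)
    also have "sqrt ?e / ?e = 1 / sqrt ?e" using e by (simp add: real_div_sqrt divide_eq_eq)
    then have "4 * (sqrt (card S * (?e - energy (Suc n))) * sqrt ?e) / ?e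
      = 4 * (sqrt (card S * (?e - energy (Suc n))) / sqrt ?e)"
      by (metis times_divide_eq_right mult.right_neutral)
    also have "\<dots> = 4 * sqrt (card S * ((?e - energy (Suc n)) / ?e))"
      by (simp flip: real_sqrt_divide)
    finally show ?thesis .
  qed
  finally show ?thesis .
qed

text \<open>As - ln \<open>energy\<close> grows at most like N^\<gamma>, some n in [N, 2N) has
  relative energy loss O(N^(\<gamma>-1)), and the square root of this bounds
  \<open>translate_diff\<close>.\<close>

lemma exists_cutoff:
  assumes K: "K\<^sub>1 > 0" "K\<^sub>2 > 0" and \<gamma>: "0 < \<gamma>" "\<gamma> < 1"
    and ret: "\<And>n::nat. even n \<Longrightarrow> n \<ge> 1 \<Longrightarrow>
      return_probability (cayley_edges G S) \<one> n \<ge> K\<^sub>1 * exp (- K\<^sub>2 * real n powr \<gamma>)"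
    and q: "real q * (1 - \<gamma>) > 2 * real m" and \<epsilon>: "\<epsilon> > 0"
  shows "\<exists>k w. cutoff k w \<and> (\<forall>s\<in>S. translate_diff w s ^ q * real (k + 1) ^ m \<le> \<epsilon>)"
proof -
  define \<beta> where "\<beta> = min 1 K\<^sub>1 / 2"
  have \<beta>: "0 < \<beta>" "\<beta> \<le> 1" using K by (auto simp: \<beta>_def)
  \<comment> \<open>The 4 arises since \<open>energy (N + N)\<close> is a return probability at time
    4N; the constant - ln \<beta> is absorbed into N^\<gamma> as N \<ge> 1.\<close>
  define A where "A = - ln \<beta> + K\<^sub>2 * 4 powr \<gamma>"
  define B where "B = 4 * sqrt (card S * A)"
  have A: "0 \<le> A"
  proof -
    have "ln \<beta> \<le> 0" "0 \<le> K\<^sub>2 * 4 powr \<gamma>" using \<beta> K by auto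
    then show ?thesis unfolding A_def by linarith
  qed
  \<comment> \<open>The power of N left after q factors \<open>translate_diff\<close> and m factors
    of the radius.\<close>
  define e where "e = real q * ((\<gamma> - 1) / 2) + real m"
  have e: "e < 0" using q by (simp add: e_def field_simps)
  have bound: "\<exists>k w. cutoff k w \<and> (\<forall>s\<in>S. translate_diff w s ^ q * real (k + 1) ^ m \<le> B ^ q * 2 ^ m * real N powr e)"
    if N: "1 \<le> N" for N
  proof -
    have "- ln (energy (N + N)) - - ln (energy N) \<le> A * real N powr \<gamma>"
    proof -
      have "ln (\<beta> * exp (- K\<^sub>2 * real (2 * (N + N)) powr \<gamma>)) \<le> ln (energy (N + N))"
        using energy_lower_bound[OF K \<gamma>(1) ret, of "N + N"] \<beta> N energy_pos by (simp add: \<beta>_def)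
      then have 1: "- ln (energy (N + N)) \<le> - ln \<beta> + K\<^sub>2 * (4 * real N) powr \<gamma>"
        using \<beta> by (simp add: ln_mult mult.commute)
      have "ln (energy N) \<le> 0" using energy_le_1[of N] energy_pos[of N] by simp
      moreover have "- ln \<beta> * 1 \<le> - ln \<beta> * real N powr \<gamma>"
        using \<beta> N \<gamma> by (intro mult_left_mono ge_one_powr_ge_zero) auto
      moreover have "A * real N powr \<gamma> = - ln \<beta> * real N powr \<gamma> + K\<^sub>2 * (4 * real N) powr \<gamma>"
        using N by (simp add: A_def powr_mult algebra_simps)
      ultimately show ?thesis using 1 by linarith
    qed
    from exists_small_increment[OF _ this] N
    obtain n where n: "n < N + N" "- ln (energy (Suc n)) + ln (energy n) \<le> A * real N powr \<gamma> / N"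
      by auto
    have "(energy n - energy (Suc n)) / energy n = 1 - energy (Suc n) / energy n"
      using energy_pos[of n] by (simp add: diff_divide_distrib)
    also have "\<dots> \<le> - ln (energy (Suc n) / energy n)"
      using ln_le_minus_one[of "energy (Suc n) / energy n"] energy_pos by simp
    also have "\<dots> = - ln (energy (Suc n)) + ln (energy n)"
      using energy_pos[of n] energy_pos[of "Suc n"] by (simp add: ln_div)
    also have "\<dots> \<le> A * real N powr \<gamma> / N" by (rule n)
    also have "\<dots> = A * real N powr (\<gamma> - 1)" using N by (simp add: powr_diff)
    finally have drop: "(energy n - energy (Suc n)) / energy n \<le> A * real N powr (\<gamma> - 1)" .
    have "translate_diff (cutoff_of n) s ^ q * real (n + 1) ^ m \<le> B ^ q * 2 ^ m * real N powr e"
      if s: "s \<in> S" for s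
    proof -
      have "translate_diff (cutoff_of n) s \<le> 4 * sqrt (card S * (A * real N powr (\<gamma> - 1)))"
        by (rule order_trans[OF translate_diff_cutoff_of[OF s]]) (intro mult_left_mono real_sqrt_le_mono drop; simp)
      also have "\<dots> = B * real N powr ((\<gamma> - 1) / 2)"
      proof -
        have "sqrt (real N powr (\<gamma> - 1)) = real N powr ((\<gamma> - 1) / 2)"
          using N by (simp add: powr_half_sqrt[symmetric] powr_powr)
        then show ?thesis by (simp add: B_def real_sqrt_mult mult.assoc)
      qed
      finally have "translate_diff (cutoff_of n) s ^ q \<le> (B * real N powr ((\<gamma> - 1) / 2)) ^ q"
        by (intro power_mono) (simp_all add: translate_diff_def tot_nonneg)
      moreover have "real (n + 1) ^ m \<le> (2 * real N) ^ m" using n by (intro power_mono) auto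
      ultimately have "translate_diff (cutoff_of n) s ^ q * real (n + 1) ^ m
          \<le> (B * real N powr ((\<gamma> - 1) / 2)) ^ q * (2 * real N) ^ m"
        by (intro mult_mono) (auto simp: B_def A)
      also have "\<dots> = B ^ q * 2 ^ m * (real N powr (real q * ((\<gamma> - 1) / 2)) * real N powr real m)"
        using N by (simp add: power_mult_distrib powr_power powr_realpow mult_ac)
      also have "\<dots> = B ^ q * 2 ^ m * real N powr e"
        by (simp add: e_def powr_add)
      finally show ?thesis .
    qed
    then show ?thesis using cutoff_cutoff_of by blast
  qed
  have "((\<lambda>N. B ^ q * 2 ^ m * real N powr e) \<longlongrightarrow> B ^ q * 2 ^ m * 0) sequentially"
    by (intro tendsto_intros tendsto_neg_powr e filterlim_real_sequentially)
  then have "eventually (\<lambda>N. B ^ q * 2 ^ m * real N powr e < \<epsilon>) sequentially"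
    using \<epsilon> by (auto dest: order_tendstoD(2))
  then have "eventually (\<lambda>N. 1 \<le> N \<and> B ^ q * 2 ^ m * real N powr e < \<epsilon>) sequentially"
    using eventually_ge_at_top[of "1::nat"] by eventually_elim auto
  then obtain N where "1 \<le> N" "B ^ q * 2 ^ m * real N powr e < \<epsilon>"
    by (auto dest: eventually_happens)
  then show ?thesis using bound[of N] by (meson less_imp_le order_trans)
qed

end

text \<open>From ln t \<le> t - 1 at t = sqrt q / sqrt p. The extra p - q cancels once two
  distributions of equal mass are summed.\<close>

lemma hellinger_le_kl_pointwise:
  fixes p q :: real
  assumes "0 \<le> p" "0 \<le> q" "p > 0 \<Longrightarrow> q > 0"
  shows "(sqrt p - sqrt q) ^ 2 + p - q \<le> p * ln p - p * ln q"
proof (cases "p = 0")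
  case False
  then have p: "p > 0" "q > 0" using assms by auto
  have "ln (sqrt q / sqrt p) \<le> sqrt q / sqrt p - 1"
    using p by (intro ln_le_minus_one) auto
  then have "p * ((ln q - ln p) / 2) \<le> p * (sqrt q / sqrt p - 1)"
    using p by (intro mult_left_mono) (auto simp: ln_div ln_sqrt diff_divide_distrib)
  moreover have "p * (sqrt q / sqrt p - 1) = sqrt p * sqrt q - p"
    using p real_div_sqrt[of p] by (simp add: algebra_simps) (metis times_divide_eq_left)
  ultimately have "p * (ln q - ln p) \<le> 2 * (sqrt p * sqrt q - p)" by simp
  then have "2 * p - 2 * (sqrt p * sqrt q) \<le> p * ln p - p * ln q" by (simp add: algebra_simps)
  moreover have "(sqrt p - sqrt q) ^ 2 = p + q - 2 * (sqrt p * sqrt q)"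
    using p by (simp add: power2_diff)
  ultimately show ?thesis by linarith
qed (use assms in simp)

context cayley_graph
begin

subsection \<open>Entropy and the second moment of the walk\<close>

definition entropy :: "nat \<Rightarrow> real" where
  "entropy n = tot (\<lambda>z. - (lazy n z * ln (lazy n z)))"

text \<open>Gibbs' inequality against the uniform distribution on the ball; the corrections
  \<open>1 / ?V - ?u z\<close> sum to zero.\<close>

lemma entropy_le: "entropy n \<le> ln (card (word_ball n))"
proof -
  let ?B = "word_ball n" and ?V = "real (card (word_ball n))" and ?u = "lazy n"
  have V: "?V > 0" using card_ball_pos by simp
  have sum: "sum ?u ?B = 1"
    using tot_eq_sum[of ?B ?u] finite_ball ball_carrier lazy_outside tot_lazy by simp
  have "entropy n = (\<Sum>z\<in>?B. - (?u z * ln (?u z)))"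
    unfolding entropy_def using finite_ball ball_carrier lazy_outside by (intro tot_eq_sum) auto
  also have "\<dots> \<le> (\<Sum>z\<in>?B. ?u z * ln ?V + (1 / ?V - ?u z))"
  proof (rule sum_mono)
    fix z assume "z \<in> ?B"
    show "- (?u z * ln (?u z)) \<le> ?u z * ln ?V + (1 / ?V - ?u z)"
    proof (cases "?u z = 0")
      case False
      then have u: "?u z > 0" using lazy_nonneg[of n z] by simp
      have "?u z * ln (1 / (?u z * ?V)) \<le> ?u z * (1 / (?u z * ?V) - 1)"
        using u V by (intro mult_left_mono ln_le_minus_one) auto
      then show ?thesis using u V by (simp add: ln_div ln_mult algebra_simps)
    qed simp
  qed
  also have "\<dots> = ln ?V"
    using V by (simp add: sum.distrib sum_subtractf sum sum_distrib_right[symmetric])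
  finally show ?thesis .
qed

lemma entropy_0: "entropy 0 = 0"
  unfolding entropy_def by (intro infsum_0) (auto simp: indicator_def)

lemma hellinger_le_kl:
  assumes p: "fs p" "\<And>z. z \<in> carrier G \<Longrightarrow> 0 \<le> p z" and q: "fs q" "\<And>z. z \<in> carrier G \<Longrightarrow> 0 \<le> q z"
    and pq: "\<And>z. z \<in> carrier G \<Longrightarrow> p z > 0 \<Longrightarrow> q z > 0" and eq: "tot p = tot q"
  shows "tot (\<lambda>z. (sqrt (p z) - sqrt (q z)) ^ 2) \<le> tot (\<lambda>z. p z * ln (p z)) - tot (\<lambda>z. p z * ln (q z))"
proof -
  have fs: "fs (\<lambda>z. (sqrt (p z) - sqrt (q z)) ^ 2)"
    using p q by (intro fs_power fs_diff fs_sqrt) auto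
  have "tot (\<lambda>z. (sqrt (p z) - sqrt (q z)) ^ 2) = tot (\<lambda>z. (sqrt (p z) - sqrt (q z)) ^ 2 + p z - q z)"
    using fs p q eq by (simp add: tot_diff tot_add fs_add)
  also have "\<dots> \<le> tot (\<lambda>z. p z * ln (p z) - p z * ln (q z))"
    using fs p q pq by (intro tot_mono hellinger_le_kl_pointwise fs_diff fs_add fs_mult_left) auto
  also have "\<dots> = tot (\<lambda>z. p z * ln (p z)) - tot (\<lambda>z. p z * ln (q z))"
    using p by (intro tot_diff fs_mult_left)
  finally show ?thesis .
qed

definition hellinger :: "'a \<Rightarrow> nat \<Rightarrow> real" where
  "hellinger s n = tot (\<lambda>z. (sqrt (lazy n (s \<otimes> z)) - sqrt (lazy n z)) ^ 2)"

lemma hellinger_nonneg: "0 \<le> hellinger s n"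
  unfolding hellinger_def by (intro tot_nonneg) auto

text \<open>\<open>lazy (Suc n)\<close> is a mixture of \<open>lazy n\<close> and its left
  translates, all of equal entropy. Hence the entropy increment is the mean relative entropy of the
  components with respect to the mixture, which dominates their Hellinger distances to it.\<close>

lemma hellinger_le_entropy:
  assumes s: "s \<in> S"
  shows "hellinger s n \<le> 8 * card S * (entropy (Suc n) - entropy n)"
proof -
  let ?u = "lazy n" and ?q = "lazy (Suc n)"
  let ?us = "\<lambda>s z. lazy n (s \<otimes> z)"
  define Hu where "Hu = tot (\<lambda>z. (sqrt (?u z) - sqrt (?q z)) ^ 2)"
  define Hs where "Hs s = tot (\<lambda>z. (sqrt (?us s z) - sqrt (?q z)) ^ 2)" for s
  have H0: "0 \<le> Hu" "\<And>s. 0 \<le> Hs s" unfolding Hu_def Hs_def by (auto intro!: tot_nonneg)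
  have q: "?q z = (?u z + avg (\<lambda>s. ?us s z)) / 2" if "z \<in> carrier G" for z
    using lazy_Suc_left[OF that] .
  \<comment> \<open>The mixture charges every point charged by a component, so no logarithm of 0
    enters with positive weight.\<close>
  have qpos: "?q z > 0" if z: "z \<in> carrier G" and "?u z > 0 \<or> (\<exists>s\<in>S. ?us s z > 0)" for z
  proof -
    have "0 \<le> avg (\<lambda>s. ?us s z)" by (intro avg_nonneg lazy_nonneg)
    moreover have "0 < avg (\<lambda>s. ?us s z)" if "s \<in> S" "?us s z > 0" for s
    proof -
      have "0 < card S * avg (\<lambda>s. ?us s z)"
        using avg_ge[of "\<lambda>s. ?us s z" s] that by (simp add: lazy_nonneg)
      then show ?thesis by (simp add: zero_less_mult_iff)
    qed
    ultimately show ?thesis using that lazy_nonneg[of n z] unfolding q[OF z] by force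
  qed
  have 1: "Hu \<le> tot (\<lambda>z. ?u z * ln (?u z)) - tot (\<lambda>z. ?u z * ln (?q z))"
    unfolding Hu_def by (rule hellinger_le_kl) (use qpos in \<open>auto simp: lazy_nonneg tot_lazy simp del: lazy.simps\<close>)
  have 2: "Hs s \<le> tot (\<lambda>z. ?u z * ln (?u z)) - tot (\<lambda>z. ?us s z * ln (?q z))" if s: "s \<in> S" for s
  proof -
    have "Hs s \<le> tot (\<lambda>z. ?us s z * ln (?us s z)) - tot (\<lambda>z. ?us s z * ln (?q z))"
      unfolding Hs_def
      by (rule hellinger_le_kl) (use s qpos in \<open>auto simp: lazy_nonneg tot_lazy tot_left simp del: lazy.simps\<close>)
    then show ?thesis using s tot_left[of s "\<lambda>z. ?u z * ln (?u z)"] by simp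
  qed
  have ent: "tot (\<lambda>z. ?u z * ln (?u z)) = - entropy n"
    by (simp add: entropy_def infsum_uminus)
  have "- entropy (Suc n) = tot (\<lambda>z. ?q z * ln (?q z))"
    unfolding entropy_def by (simp only: infsum_uminus minus_minus)
  also have "\<dots> = tot (\<lambda>z. (?u z * ln (?q z) + avg (\<lambda>s. ?us s z * ln (?q z))) / 2)"
  proof (rule infsum_cong)
    fix z assume z: "z \<in> carrier G"
    have "?q z * ln (?q z) = (?u z + avg (\<lambda>s. ?us s z)) / 2 * ln (?q z)"
      by (subst (1) q[OF z]) simp
    also have "\<dots> = (?u z * ln (?q z) + avg (\<lambda>s. ?us s z * ln (?q z))) / 2"
      using avg_cmult[of "ln (?q z)" "\<lambda>s. ?us s z"] by (simp add: algebra_simps del: lazy.simps)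
    finally show "?q z * ln (?q z) = (?u z * ln (?q z) + avg (\<lambda>s. ?us s z * ln (?q z))) / 2" .
  qed
  also have "\<dots> = (tot (\<lambda>z. ?u z * ln (?q z)) + avg (\<lambda>s. tot (\<lambda>z. ?us s z * ln (?q z)))) / 2"
    by (subst tot_divide, subst tot_add, rule fs_mult_left, simp, rule fs_avg, rule fs_mult_left, simp,
        subst tot_avg, rule fs_mult_left, simp, rule refl)
  finally have 3: "2 * entropy (Suc n) = - tot (\<lambda>z. ?u z * ln (?q z)) - avg (\<lambda>s. tot (\<lambda>z. ?us s z * ln (?q z)))"
    by (simp del: lazy.simps)
  have "avg Hs \<le> avg (\<lambda>s. - entropy n - tot (\<lambda>z. ?us s z * ln (?q z)))"
    using 2 by (intro avg_mono) (auto simp: ent simp del: lazy.simps)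
  then have 4: "Hu + avg Hs \<le> 2 * (entropy (Suc n) - entropy n)"
    using 1 3 by (simp add: avg_diff ent del: lazy.simps)
  define \<Delta> where "\<Delta> = entropy (Suc n) - entropy n"
  have avg0: "0 \<le> avg Hs" using H0 by (intro avg_nonneg)
  have c1: "real (card S) \<ge> 1" using card_S_pos by simp
  have d0: "0 \<le> \<Delta>" using 4 H0 avg0 by (simp add: \<Delta>_def)
  have "Hs s \<le> card S * avg Hs" using H0 s by (intro avg_ge) auto
  also have "\<dots> \<le> card S * (2 * \<Delta> - Hu)" using 4 by (intro mult_left_mono) (auto simp: \<Delta>_def)
  finally have Hs: "Hs s \<le> 2 * card S * \<Delta> - card S * Hu" by (simp add: algebra_simps)
  moreover have "Hu \<le> card S * Hu" using c1 H0 mult_right_mono[of 1 "real (card S)" Hu] by simp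
  ultimately have sum: "2 * Hs s + 2 * Hu \<le> 8 * card S * \<Delta>"
    using mult_nonneg_nonneg[OF _ d0, of "real (card S)"] by simp
  have "hellinger s n \<le> tot (\<lambda>z. 2 * (sqrt (?us s z) - sqrt (?q z)) ^ 2 + 2 * (sqrt (?u z) - sqrt (?q z)) ^ 2)"
    unfolding hellinger_def
  proof (rule tot_mono)
    fix z
    have "(a - b) ^ 2 \<le> 2 * (a - c) ^ 2 + 2 * (b - c) ^ 2" for a b c :: real
      using zero_le_power2[of "a + b - 2 * c"] by (simp add: power2_eq_square algebra_simps)
    then show "(sqrt (?us s z) - sqrt (?u z)) ^ 2
      \<le> 2 * (sqrt (?us s z) - sqrt (?q z)) ^ 2 + 2 * (sqrt (?u z) - sqrt (?q z)) ^ 2" .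
  qed (use s in \<open>auto intro!: fs_power fs_add fs_mult_right fs_diff fs_sqrt simp del: lazy.simps\<close>)
  also have "\<dots> = 2 * Hs s + 2 * Hu"
  proof -
    have "fs (\<lambda>z. 2 * (sqrt (?us s z) - sqrt (?q z)) ^ 2)" "fs (\<lambda>z. 2 * (sqrt (?u z) - sqrt (?q z)) ^ 2)"
      using s by (auto intro!: fs_power fs_mult_right fs_diff fs_sqrt simp del: lazy.simps)
    from tot_add[OF this] show ?thesis by (simp only: tot_cmult Hs_def Hu_def)
  qed
  finally show ?thesis using sum by (simp add: \<Delta>_def)
qed

end

text \<open>The hypothesis bounds t^2 by E^(2/m) (L^2)^(1-1/m). The concave power is then dominated
  by an affine function of L^2, so a bound R on the second moment of L yields a mean of at most 2
  R^(1-1/m).\<close>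

lemma power_interpolation:
  fixes t E L R :: real
  assumes t: "0 \<le> t" "t ^ m \<le> L ^ (m - 1) * E" and L: "1 \<le> L" and E: "0 \<le> E" and R: "0 < R" and m: "1 \<le> m"
  shows "t ^ 2 \<le> E powr (2 / m) * (L ^ 2 * R powr (- 1 / m) + R powr (1 - 1 / m))"
proof (cases "t = 0")
  case False
  then have t0: "0 < t" using t by simp
  have "(t ^ m) powr (2 / m) = (t powr m) powr (2 / m)" using t0 by (simp only: powr_realpow)
  also have "\<dots> = t ^ 2" using t0 m by (simp add: powr_powr)
  finally have "t ^ 2 = (t ^ m) powr (2 / m)" ..
  also have "\<dots> \<le> (L ^ (m - 1) * E) powr (2 / m)"
    using t t0 by (intro powr_mono2) auto
  also have "\<dots> = (L ^ (m - 1)) powr (2 / m) * E powr (2 / m)"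
    using L E by (intro powr_mult)
  also have "(L ^ (m - 1)) powr (2 / m) = (L ^ 2) powr (1 - 1 / m)"
  proof -
    have "real (m - 1) * (2 / m) = 2 * (1 - 1 / m)" using m by (simp add: of_nat_diff field_simps)
    moreover have "L ^ (m - 1) = L powr real (m - 1)" "L ^ 2 = L powr real 2"
      using L by (simp_all only: powr_realpow)
    ultimately show ?thesis by (simp only: powr_powr of_nat_numeral)
  qed
  finally have 1: "t ^ 2 \<le> (L ^ 2) powr (1 - 1 / m) * E powr (2 / m)" .
  have "(L ^ 2) powr (1 - 1 / m) \<le> L ^ 2 * R powr (- 1 / m) + R powr (1 - 1 / m)"
  proof (cases "L ^ 2 \<le> R")
    case True
    then have "(L ^ 2) powr (1 - 1 / m) \<le> R powr (1 - 1 / m)"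
      using m by (intro powr_mono2) (auto simp: field_simps)
    then show ?thesis by (simp add: add_increasing)
  next
    case False
    have "(L ^ 2) powr (1 - 1 / m) = L ^ 2 * (L ^ 2) powr (- 1 / m)"
      using L powr_add[of "L ^ 2" 1 "- 1 / m"] by simp
    also have "\<dots> \<le> L ^ 2 * R powr (- 1 / m)"
      using False R by (intro mult_left_mono powr_mono2') auto
    finally show ?thesis by (simp add: add_increasing2)
  qed
  then have "E powr (2 / m) * (L ^ 2) powr (1 - 1 / m)
      \<le> E powr (2 / m) * (L ^ 2 * R powr (- 1 / m) + R powr (1 - 1 / m))"
    by (rule mult_left_mono) simp
  then show ?thesis using 1 by (simp add: mult.commute)
qed simp

section \<open>Second moment of the word length\<close>

context cayley_graph
begin

text \<open>The added 1 keeps the values at neighbouring points comparable, also near the identity,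
  and gives L \<ge> 1 in \<open>power_interpolation\<close>.\<close>

definition wsq :: "'a \<Rightarrow> real" where
  "wsq z = (real (wlen z) + 1) ^ 2"

definition moment :: "nat \<Rightarrow> real" where
  "moment n = tot (\<lambda>z. lazy n z * wsq z)"

lemma moment_nonneg: "0 \<le> moment n"
  unfolding moment_def by (intro tot_nonneg) (auto simp: lazy_nonneg wsq_def)

lemma tot_left_moment: "s \<in> S \<Longrightarrow> tot (\<lambda>z. lazy n (s \<otimes> z) * wsq (s \<otimes> z)) = moment n"
  using tot_left[of s "\<lambda>z. lazy n z * wsq z"] by (simp add: moment_def)

text \<open>Substituting \<open>s \<otimes> z\<close> for \<open>z\<close> antisymmetrises the drift of the second moment, so that it is
  bounded by the Hellinger distance of \<open>lazy n\<close> to its left translate, hence by an entropy increment.\<close>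

lemma moment_drift_aux:
  assumes s: "s \<in> S"
  shows "tot (\<lambda>z. (lazy n z - lazy n (s \<otimes> z)) * (wsq (s \<otimes> z) - wsq z)) \<le> sqrt (hellinger s n) * sqrt (40 * moment n)"
proof -
  let ?u = "lazy n" and ?v = "\<lambda>z. lazy n (s \<otimes> z)"
  let ?a = "\<lambda>z. real (wlen (s \<otimes> z)) + 1" and ?b = "\<lambda>z. real (wlen z) + 1"
  let ?h = "\<lambda>z. (sqrt (?v z) + sqrt (?u z)) * (?a z + ?b z)"
  have v: "fs ?v" using s by auto
  have fs_h: "fs ?h" using v by (intro fs_mult_left fs_add fs_sqrt) auto
  have fs_g: "fs (\<lambda>z. \<bar>sqrt (?v z) - sqrt (?u z)\<bar>)" using v by (intro fs_abs fs_diff fs_sqrt) auto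
  have "tot (\<lambda>z. (?u z - ?v z) * (wsq (s \<otimes> z) - wsq z)) \<le> tot (\<lambda>z. \<bar>sqrt (?v z) - sqrt (?u z)\<bar> * ?h z)"
  proof (rule tot_mono)
    fix z assume z: "z \<in> carrier G"
    have ab: "\<bar>?a z - ?b z\<bar> \<le> 1"
      using wlen_mult_left[OF z s] wlen_mult_left'[OF z s] by linarith
    have "wsq (s \<otimes> z) - wsq z = (?a z - ?b z) * (?a z + ?b z)"
      by (simp add: wsq_def power2_eq_square algebra_simps)
    then have "\<bar>wsq (s \<otimes> z) - wsq z\<bar> = \<bar>?a z - ?b z\<bar> * (?a z + ?b z)"
      by (simp only: abs_mult)
    also have "\<dots> \<le> 1 * (?a z + ?b z)"
      using ab by (intro mult_right_mono) auto
    finally have "\<bar>wsq (s \<otimes> z) - wsq z\<bar> \<le> 1 * (?a z + ?b z)" .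
    then have "\<bar>?u z - ?v z\<bar> * \<bar>wsq (s \<otimes> z) - wsq z\<bar> \<le> \<bar>?v z - ?u z\<bar> * (?a z + ?b z)"
      unfolding abs_minus_commute[of "?u z"] by (intro mult_left_mono) auto
    also have "\<dots> = \<bar>sqrt (?v z) - sqrt (?u z)\<bar> * ?h z"
      by (subst abs_diff_sqrt) (simp_all add: lazy_nonneg)
    finally show "(?u z - ?v z) * (wsq (s \<otimes> z) - wsq z) \<le> \<bar>sqrt (?v z) - sqrt (?u z)\<bar> * ?h z"
      using abs_ge_self[of "(?u z - ?v z) * (wsq (s \<otimes> z) - wsq z)"] unfolding abs_mult by linarith
  qed (use v fs_g in \<open>auto intro!: fs_mult_left fs_diff\<close>)
  also have "\<dots> \<le> sqrt (tot (\<lambda>z. \<bar>sqrt (?v z) - sqrt (?u z)\<bar> ^ 2)) * sqrt (tot (\<lambda>z. ?h z ^ 2))"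
    using fs_g fs_h by (rule tot_Cauchy_Schwarz)
  also have "tot (\<lambda>z. \<bar>sqrt (?v z) - sqrt (?u z)\<bar> ^ 2) = hellinger s n"
    by (simp add: hellinger_def)
  also have "sqrt (hellinger s n) * sqrt (tot (\<lambda>z. ?h z ^ 2)) \<le> sqrt (hellinger s n) * sqrt (40 * moment n)"
  proof (intro mult_left_mono real_sqrt_le_mono)
    have "tot (\<lambda>z. ?h z ^ 2) \<le> tot (\<lambda>z. 20 * (?v z * wsq (s \<otimes> z) + ?u z * wsq z))"
    proof (rule tot_mono)
      fix z assume z: "z \<in> carrier G"
      have ab: "?a z \<le> 2 * ?b z" "?b z \<le> 2 * ?a z"
        using wlen_mult_left[OF z s] wlen_mult_left'[OF z s] by auto
      have b: "(?a z + ?b z) ^ 2 \<le> 10 * ?b z ^ 2" "(?a z + ?b z) ^ 2 \<le> 10 * ?a z ^ 2"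
      proof -
        have "(?a z + ?b z) ^ 2 \<le> (3 * ?b z) ^ 2" "(?a z + ?b z) ^ 2 \<le> (3 * ?a z) ^ 2"
          using ab by (auto intro!: power_mono)
        moreover have "(3 * x) ^ 2 \<le> 10 * x ^ 2" for x :: real by (simp add: power_mult_distrib)
        ultimately show "(?a z + ?b z) ^ 2 \<le> 10 * ?b z ^ 2" "(?a z + ?b z) ^ 2 \<le> 10 * ?a z ^ 2"
          by (blast intro: order_trans)+
      qed
      have "?h z ^ 2 = (sqrt (?v z) + sqrt (?u z)) ^ 2 * (?a z + ?b z) ^ 2"
        by (rule power_mult_distrib)
      also have "\<dots> \<le> (2 * (?v z + ?u z)) * (?a z + ?b z) ^ 2"
        by (intro mult_right_mono sqrt_sum_square_le) (auto simp: lazy_nonneg)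
      also have "\<dots> = 2 * (?v z * (?a z + ?b z) ^ 2 + ?u z * (?a z + ?b z) ^ 2)"
        by (simp add: algebra_simps)
      also have "\<dots> \<le> 2 * (?v z * (10 * ?a z ^ 2) + ?u z * (10 * ?b z ^ 2))"
        using b by (intro mult_left_mono add_mono) (auto simp: lazy_nonneg)
      finally show "?h z ^ 2 \<le> 20 * (?v z * wsq (s \<otimes> z) + ?u z * wsq z)"
        by (simp add: wsq_def)
    qed (intro fs_power[OF fs_h] fs_mult_right[OF fs_add[OF fs_mult_left[OF v] fs_mult_left]]; simp)+
    also have "\<dots> = 40 * moment n"
      using s v by (subst tot_cmult, subst tot_add)
        (auto simp: tot_left_moment moment_def[symmetric] intro!: fs_mult_left)
    finally show "tot (\<lambda>z. ?h z ^ 2) \<le> 40 * moment n" .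
  qed (use hellinger_nonneg in auto)
  finally show ?thesis .
qed

lemma entropy_mono_Suc: "entropy n \<le> entropy (Suc n)"
proof -
  obtain s where s: "s \<in> S" using S_ne by auto
  have "0 \<le> 8 * card S * (entropy (Suc n) - entropy n)"
    using hellinger_le_entropy[OF s, of n] hellinger_nonneg[of s n] by linarith
  then show ?thesis using card_S_pos by (simp add: zero_le_mult_iff)
qed

lemma entropy_mono: "k \<le> n \<Longrightarrow> entropy k \<le> entropy n"
  by (rule lift_Suc_mono_le[of entropy]) (rule entropy_mono_Suc)

text \<open>The drift is of order sqrt(\<Delta> M), with \<Delta> the entropy increment and M the
  moment; so sqrt M grows by order sqrt \<Delta>, and such increments add up over time.\<close>

lemma moment_step:
  "sqrt (moment (Suc n)) \<le> sqrt (moment n) + sqrt (5 * card S) * sqrt (entropy (Suc n) - entropy n)"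
proof -
  let ?u = "lazy n" and ?\<Delta> = "entropy (Suc n) - entropy n" and ?M = "moment n"
  define X where "X = avg (\<lambda>s. tot (\<lambda>z. ?u (s \<otimes> z) * wsq z))"
  have \<Delta>: "0 \<le> ?\<Delta>" using entropy_mono_Suc by simp
  have "moment (Suc n) = tot (\<lambda>z. (?u z * wsq z + avg (\<lambda>s. ?u (s \<otimes> z) * wsq z)) / 2)"
    unfolding moment_def
  proof (rule infsum_cong)
    fix z assume z: "z \<in> carrier G"
    show "lazy (Suc n) z * wsq z = (?u z * wsq z + avg (\<lambda>s. ?u (s \<otimes> z) * wsq z)) / 2"
      using avg_cmult[of "wsq z" "\<lambda>s. ?u (s \<otimes> z)"] unfolding lazy_Suc_left[OF z]
      by (simp add: algebra_simps)
  qed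
  also have "\<dots> = (?M + X) / 2"
    by (subst tot_divide, subst tot_add, rule fs_mult_left, simp, rule fs_avg, rule fs_mult_left, simp,
        subst tot_avg, rule fs_mult_left, simp, simp add: X_def moment_def)
  finally have 1: "moment (Suc n) = (?M + X) / 2" .
  \<comment> \<open>By symmetry of \<open>S\<close> the two mixed terms of the antisymmetrised drift
    have the same average.\<close>
  have X': "X = avg (\<lambda>s. tot (\<lambda>z. ?u z * wsq (s \<otimes> z)))"
  proof -
    have "X = avg (\<lambda>s. tot (\<lambda>z. ?u (inv s \<otimes> z) * wsq z))"
      unfolding X_def by (rule avg_inv[symmetric])
    also have "\<dots> = avg (\<lambda>s. tot (\<lambda>z. ?u z * wsq (s \<otimes> z)))"
    proof (rule avg_cong)
      fix s assume s: "s \<in> S"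
      have "tot (\<lambda>z. ?u (inv s \<otimes> z) * wsq z) = tot (\<lambda>z. ?u (inv s \<otimes> (s \<otimes> z)) * wsq (s \<otimes> z))"
        using s by (intro tot_left[symmetric]) auto
      also have "\<dots> = tot (\<lambda>z. ?u z * wsq (s \<otimes> z))"
        using s by (intro infsum_cong) (auto simp: m_assoc[symmetric])
      finally show "tot (\<lambda>z. ?u (inv s \<otimes> z) * wsq z) = tot (\<lambda>z. ?u z * wsq (s \<otimes> z))" .
    qed
    finally show ?thesis .
  qed
  have term_eq: "tot (\<lambda>z. (?u z - ?u (s \<otimes> z)) * (wsq (s \<otimes> z) - wsq z))
    = tot (\<lambda>z. ?u z * wsq (s \<otimes> z)) + tot (\<lambda>z. ?u (s \<otimes> z) * wsq z) - 2 * ?M" if s: "s \<in> S" for s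
  proof -
    have v: "fs (\<lambda>z. ?u (s \<otimes> z))" using s by simp
    have "tot (\<lambda>z. (?u z - ?u (s \<otimes> z)) * (wsq (s \<otimes> z) - wsq z))
      = tot (\<lambda>z. (?u z * wsq (s \<otimes> z) + ?u (s \<otimes> z) * wsq z) - (?u z * wsq z + ?u (s \<otimes> z) * wsq (s \<otimes> z)))"
      by (rule infsum_cong) (simp add: algebra_simps)
    also have "\<dots> = (tot (\<lambda>z. ?u z * wsq (s \<otimes> z)) + tot (\<lambda>z. ?u (s \<otimes> z) * wsq z)) -
        (tot (\<lambda>z. ?u z * wsq z) + tot (\<lambda>z. ?u (s \<otimes> z) * wsq (s \<otimes> z)))"
      using v by (subst tot_diff, (intro fs_add fs_mult_left; simp)+, (subst tot_add, (intro fs_mult_left; simp)+)+) simp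
    finally show ?thesis using s by (simp add: tot_left_moment moment_def[symmetric])
  qed
  have "avg (\<lambda>s. tot (\<lambda>z. (?u z - ?u (s \<otimes> z)) * (wsq (s \<otimes> z) - wsq z)))
    = avg (\<lambda>s. tot (\<lambda>z. ?u z * wsq (s \<otimes> z)) + tot (\<lambda>z. ?u (s \<otimes> z) * wsq z) - 2 * ?M)"
    by (rule avg_cong) (rule term_eq)
  also have "\<dots> = 2 * X - 2 * ?M"
    using X' by (simp add: avg_diff avg_add X_def[symmetric])
  finally have "avg (\<lambda>s. tot (\<lambda>z. (?u z - ?u (s \<otimes> z)) * (wsq (s \<otimes> z) - wsq z))) = 2 * X - 2 * ?M" .
  moreover have "avg (\<lambda>s. tot (\<lambda>z. (?u z - ?u (s \<otimes> z)) * (wsq (s \<otimes> z) - wsq z)))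
      \<le> avg (\<lambda>s. sqrt (8 * card S * ?\<Delta>) * sqrt (40 * ?M))"
  proof (rule avg_mono)
    fix s assume s: "s \<in> S"
    have "sqrt (hellinger s n) * sqrt (40 * ?M) \<le> sqrt (8 * card S * ?\<Delta>) * sqrt (40 * ?M)"
      using hellinger_le_entropy[OF s, of n] moment_nonneg[of n] by (intro mult_right_mono) auto
    then show "tot (\<lambda>z. (?u z - ?u (s \<otimes> z)) * (wsq (s \<otimes> z) - wsq z)) \<le> sqrt (8 * card S * ?\<Delta>) * sqrt (40 * ?M)"
      using moment_drift_aux[OF s, of n] by linarith
  qed
  moreover have "sqrt (8 * card S * ?\<Delta>) * sqrt (40 * ?M) = 8 * (sqrt (5 * card S) * sqrt ?\<Delta>) * sqrt ?M"
  proof -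
    have "sqrt (8 * card S * ?\<Delta>) * sqrt (40 * ?M) = sqrt (8 ^ 2 * (5 * card S * ?\<Delta> * ?M))"
      by (simp add: real_sqrt_mult[symmetric] mult_ac del: real_sqrt_mult)
    also have "\<dots> = 8 * sqrt (5 * card S * ?\<Delta> * ?M)"
      by (subst real_sqrt_mult) simp
    also have "sqrt (5 * card S * ?\<Delta> * ?M) = sqrt (5 * card S) * sqrt ?\<Delta> * sqrt ?M"
      by (simp only: real_sqrt_mult)
    finally show ?thesis by simp
  qed
  ultimately have "X - ?M \<le> 4 * (sqrt (5 * card S) * sqrt ?\<Delta>) * sqrt ?M" by simp
  then have "moment (Suc n) \<le> ?M + 2 * (sqrt (5 * card S) * sqrt ?\<Delta>) * sqrt ?M" using 1 by simp
  also have "\<dots> \<le> (sqrt ?M + sqrt (5 * card S) * sqrt ?\<Delta>) ^ 2"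
  proof -
    have "(sqrt ?M + r) ^ 2 = ?M + r ^ 2 + 2 * r * sqrt ?M" for r
      using moment_nonneg[of n] by (simp add: power2_sum)
    from this[of "sqrt (5 * card S) * sqrt ?\<Delta>"] show ?thesis
      using zero_le_power2[of "sqrt (5 * card S) * sqrt ?\<Delta>"] by linarith
  qed
  finally have "moment (Suc n) \<le> (sqrt ?M + sqrt (5 * card S) * sqrt ?\<Delta>) ^ 2" .
  moreover have "0 \<le> sqrt ?M + sqrt (5 * card S) * sqrt ?\<Delta>"
    using moment_nonneg[of n] \<Delta> by (intro add_nonneg_nonneg mult_nonneg_nonneg real_sqrt_ge_zero) auto
  ultimately show ?thesis by (intro real_le_lsqrt)
qed

text \<open>Cauchy-Schwarz on the square roots of the entropy increments, which telescope to
  \<open>entropy k\<close>; with logarithmic entropy the walk is diffusive up to a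
  logarithm.\<close>

lemma moment_le:
  fixes h :: real
  assumes kn: "k \<le> n" and h: "entropy n \<le> h"
  shows "moment k \<le> 2 + 10 * card S * n * h"
proof -
  have "sqrt (moment k) \<le> 1 + sqrt (5 * card S) * (\<Sum>j<k. sqrt (entropy (Suc j) - entropy j))"
  proof (induction k)
    case 0
    have "moment 0 = (\<Sum>z\<in>{\<one>}. lazy 0 z * wsq z)" unfolding moment_def by (rule tot_eq_sum) auto
    then show ?case by (simp add: wsq_def wlen_one)
  next
    case (Suc k)
    then show ?case using moment_step[of k] by (simp add: distrib_left)
  qed
  also have "\<dots> \<le> 1 + sqrt (5 * card S) * sqrt (entropy k * k)"
  proof -
    have "(\<Sum>j<k. sqrt (entropy (Suc j) - entropy j)) ^ 2 \<le> (\<Sum>j<k. (sqrt (entropy (Suc j) - entropy j)) ^ 2) * card {..<k}"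
      by (rule sum_squared_le_sum_of_squares)
    also have "(\<Sum>j<k. (sqrt (entropy (Suc j) - entropy j)) ^ 2) = (\<Sum>j<k. entropy (Suc j) - entropy j)"
      by (intro sum.cong) (auto simp: entropy_mono_Suc)
    also have "\<dots> = entropy k"
      by (simp add: sum_lessThan_telescope entropy_0)
    finally show ?thesis by (intro add_left_mono mult_left_mono real_le_rsqrt) auto
  qed
  also have "\<dots> = 1 + sqrt (5 * card S * (entropy k * k))" by (simp only: real_sqrt_mult)
  also have "\<dots> \<le> 1 + sqrt (5 * card S * (h * n))"
  proof -
    have "0 \<le> entropy k" using entropy_mono[of 0 k] entropy_0 by simp
    moreover have "entropy k \<le> h" using entropy_mono[OF kn] h by simp
    ultimately show ?thesis using kn by (intro add_left_mono real_sqrt_le_mono mult_left_mono mult_mono) auto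
  qed
  finally have 1: "sqrt (moment k) \<le> 1 + sqrt (5 * card S * (h * n))" .
  have h0: "0 \<le> h" using entropy_mono[of 0 n] entropy_0 h by simp
  have "moment k = sqrt (moment k) ^ 2" using moment_nonneg by simp
  also have "\<dots> \<le> (1 + sqrt (5 * card S * (h * n))) ^ 2"
    using 1 moment_nonneg by (intro power_mono) auto
  also have "\<dots> \<le> 2 * (1 + 5 * card S * (h * n))"
    using sqrt_sum_square_le[of 1 "5 * card S * (h * n)"] h0 by simp
  finally show ?thesis by (simp add: mult_ac)
qed

subsection \<open>Harmonic functions on groups of polynomial growth\<close>

text \<open>One power of the length is saved over \<open>lbound_path\<close>: a geodesic visits
  distinct vertices, so its edges share a single total gradient budget.\<close>

lemma growth_along_geodesic:
  fixes D :: real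
  assumes D: "\<And>s. s \<in> S \<Longrightarrow> lbound (\<lambda>x. \<bar>f (x \<otimes> s) - f x\<bar> ^ m) D"
    and m: "1 \<le> m" and x: "x \<in> carrier G" and z: "z \<in> word_ball (Suc n)"
  shows "\<bar>f (x \<otimes> z) - f x\<bar> ^ m \<le> real (Suc n) ^ (m - 1) * (card S * D)"
proof -
  have D0: "0 \<le> D" using S_ne D lbound_nonneg by blast
  define e where "e y = (\<Sum>s\<in>S. \<bar>f (x \<otimes> y \<otimes> s) - f (x \<otimes> y)\<bar> ^ m)" for y
  have e0: "0 \<le> e y" for y by (simp add: e_def sum_nonneg)
  \<comment> \<open>The edge reached at distance \<open>k\<close> starts on the sphere of radius \<open>k\<close>, hence it is not
     yet counted in the sum over the ball of radius \<open>k - 1\<close>.\<close>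
  have main: "z \<in> word_ball (Suc k) \<Longrightarrow> \<bar>f (x \<otimes> z) - f x\<bar> ^ m \<le> real (Suc k) ^ (m - 1) * sum e (word_ball k)"
    for k z
  proof (induction k arbitrary: z)
    case 0
    then consider "z = \<one>" | "z \<in> S" by auto
    then show ?case
    proof cases
      case 1
      then show ?thesis using m x e0 by (simp add: power_0_left)
    next
      case 2
      then have "\<bar>f (x \<otimes> z) - f x\<bar> ^ m \<le> e \<one>"
        unfolding e_def using x finite_S member_le_sum[of z S "\<lambda>s. \<bar>f (x \<otimes> \<one> \<otimes> s) - f (x \<otimes> \<one>)\<bar> ^ m"] by simp
      then show ?thesis by simp
    qed
  next
    case (Suc k)
    show ?case
    proof (cases "z \<in> word_ball (Suc k)")
      case True
      have "\<bar>f (x \<otimes> z) - f x\<bar> ^ m \<le> real (Suc k) ^ (m - 1) * sum e (word_ball k)"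
        by (rule Suc.IH[OF True])
      also have "\<dots> \<le> real (Suc (Suc k)) ^ (m - 1) * sum e (word_ball (Suc k))"
        using ball_mono[of k "Suc k"] finite_ball[of "Suc k"] e0
        by (intro mult_mono power_mono sum_mono2 sum_nonneg) auto
      finally show ?thesis .
    next
      case False
      then obtain y s where ys: "y \<in> word_ball (Suc k)" "s \<in> S" "z = y \<otimes> s"
        using Suc.prems by (auto simp del: word_ball.simps simp: word_ball.simps(2)[of "Suc k"])
      have yk: "y \<notin> word_ball k" using False ys ball_mult_right[of y k s] by auto
      have yc: "y \<in> carrier G" using ys(1) ball_carrierD by blast
      let ?a = "\<bar>f (x \<otimes> y) - f x\<bar>" and ?b = "\<bar>f (x \<otimes> y \<otimes> s) - f (x \<otimes> y)\<bar>"
      have "\<bar>f (x \<otimes> z) - f x\<bar> ^ m \<le> (?a + ?b) ^ m"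
        using ys yc x by (intro power_mono) (auto simp: m_assoc)
      also have "\<dots> \<le> real (Suc k + 1) ^ (m - 1) * (?a ^ m / real (Suc k) ^ (m - 1) + ?b ^ m)"
        using m by (intro power_add_le) auto
      also have "\<dots> \<le> real (Suc k + 1) ^ (m - 1) * (sum e (word_ball k) + e y)"
      proof (intro mult_left_mono add_mono)
        show "?a ^ m / real (Suc k) ^ (m - 1) \<le> sum e (word_ball k)"
          using Suc.IH[OF ys(1)] by (simp add: divide_le_eq mult.commute del: of_nat_Suc)
        show "?b ^ m \<le> e y"
          unfolding e_def using ys(2) finite_S
          by (intro member_le_sum[of s S "\<lambda>s. \<bar>f (x \<otimes> y \<otimes> s) - f (x \<otimes> y)\<bar> ^ m"]) auto
      qed simp
      also have "sum e (word_ball k) + e y = sum e (insert y (word_ball k))"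
        using yk finite_ball by simp
      also have "real (Suc k + 1) ^ (m - 1) * sum e (insert y (word_ball k))
          \<le> real (Suc k + 1) ^ (m - 1) * sum e (word_ball (Suc k))"
        using ys(1) ball_mono[of k "Suc k"] finite_ball[of "Suc k"] e0
        by (intro mult_left_mono sum_mono2) auto
      finally show ?thesis by simp
    qed
  qed
  have "\<bar>f (x \<otimes> z) - f x\<bar> ^ m \<le> real (Suc n) ^ (m - 1) * sum e (word_ball n)"
    by (rule main[OF z])
  also have "\<dots> \<le> real (Suc n) ^ (m - 1) * (card S * D)"
  proof (rule mult_left_mono)
    have "sum e (word_ball n) = (\<Sum>s\<in>S. \<Sum>y\<in>word_ball n. \<bar>f (x \<otimes> y \<otimes> s) - f (x \<otimes> y)\<bar> ^ m)"
      unfolding e_def by (rule sum.swap)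
    also have "\<dots> \<le> (\<Sum>s\<in>S. D)"
      using lboundD[OF lbound_left[OF D x] finite_ball ball_carrier] by (intro sum_mono) auto
    finally show "sum e (word_ball n) \<le> card S * D" by simp
  qed simp
  finally show ?thesis .
qed

text \<open>The mean value property writes the increment of \<open>f\<close> as its integral against
  a translate difference of \<open>lazy k\<close>. Cauchy-Schwarz on square roots splits this into a
  Hellinger distance, small for a well-chosen k < n, and a mean of the squared growth of
  \<open>f\<close>, bounded through the moment.\<close>

lemma harmonic_gradient_bound:
  fixes D h :: real
  assumes harm: "\<And>x. x \<in> carrier G \<Longrightarrow> nbr_avg f x = f x"
    and D: "\<And>s. s \<in> S \<Longrightarrow> lbound (\<lambda>x. \<bar>f (x \<otimes> s) - f x\<bar> ^ m) D" and m: "1 \<le> m"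
    and n: "0 < n" and h: "entropy n \<le> h" and x: "x \<in> carrier G" and s: "s \<in> S"
  shows "(f (x \<otimes> s) - f x) ^ 2 \<le> 64 * card S * (card S * D) powr (2 / m) *
    (h / n * (2 + 10 * card S * n * h) powr (1 - 1 / m))"
proof -
  have D0: "0 \<le> D" using S_ne D lbound_nonneg by blast
  have h0: "0 \<le> h" using entropy_mono[of 0 n] entropy_0 h by simp
  have "entropy (0 + n) - entropy 0 \<le> h" using h entropy_0 by simp
  from exists_small_increment[OF n this]
  obtain k where k: "k < n" "entropy (Suc k) - entropy k \<le> h / n" by auto
  define R where "R = 2 + 10 * card S * n * h"
  have R: "0 < R" using h0 by (simp add: R_def add_pos_nonneg)
  have M: "moment k \<le> R" using moment_le[of k n h] k h by (simp add: R_def)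
  define E where "E = (card S * D) powr (2 / m)"
  let ?u = "lazy k" and ?v = "\<lambda>z. lazy k (inv s \<otimes> z)" and ?g = "\<lambda>z. f (x \<otimes> z) - f x"
  have si: "inv s \<in> S" using S_inv[OF s] .
  have v: "fs ?v" using si by auto
  let ?r = "\<lambda>z. R powr (- 1 / m) * wsq z + R powr (1 - 1 / m)"
  \<comment> \<open>Allowing radius \<open>Suc (wlen y)\<close> serves y = z and y =
    \<open>inv s \<otimes> z\<close> alike, so each of the two distributions is paired with its own
    length function.\<close>
  have g2: "?g z ^ 2 \<le> E * ?r y" if "y \<in> carrier G" "z \<in> word_ball (Suc (wlen y))" for y z
  proof -
    have "\<bar>?g z\<bar> ^ m \<le> (real (wlen y) + 1) ^ (m - 1) * (card S * D)"
      using growth_along_geodesic[OF D m x that(2)] by (simp add: add.commute)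
    then have "\<bar>?g z\<bar> ^ 2 \<le> (card S * D) powr (2 / m) *
        ((real (wlen y) + 1) ^ 2 * R powr (- 1 / m) + R powr (1 - 1 / m))"
      by (intro power_interpolation) (use D0 R m in auto)
    then show ?thesis by (simp add: E_def wsq_def mult.commute)
  qed
  have g: "?g z ^ 2 \<le> E * ?r z" "?g z ^ 2 \<le> E * ?r (inv s \<otimes> z)" if z: "z \<in> carrier G" for z
  proof -
    show "?g z ^ 2 \<le> E * ?r z"
      using ball_wlen[OF z] ball_mono[of "wlen z" "Suc (wlen z)"] z by (intro g2) auto
    have "inv s \<otimes> z \<in> carrier G" using z s by simp
    from ball_mult_left[OF ball_wlen[OF this] s] this
    show "?g z ^ 2 \<le> E * ?r (inv s \<otimes> z)"
      using z s by (intro g2) (auto simp: m_assoc[symmetric] simp del: word_ball.simps)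
  qed
  let ?k = "\<lambda>z. (sqrt (?v z) + sqrt (?u z)) * \<bar>?g z\<bar>"
  let ?d = "\<lambda>z. \<bar>sqrt (?v z) - sqrt (?u z)\<bar>"
  have fs: "fs ?d" "fs ?k" using v by (intro fs_abs fs_diff fs_sqrt fs_mult_left fs_add fs_lazy; simp)+
  have E0: "0 \<le> E" by (simp add: E_def)
  have ur: "fs (\<lambda>z. ?u z * ?r z)" "fs (\<lambda>z. ?v z * ?r (inv s \<otimes> z))"
    using v by (auto intro!: fs_mult_left)
  have tot_ur: "tot (\<lambda>z. ?u z * ?r z) \<le> 2 * R powr (1 - 1 / m)"
  proof -
    have "tot (\<lambda>z. ?u z * ?r z) = tot (\<lambda>z. R powr (- 1 / m) * (?u z * wsq z) + R powr (1 - 1 / m) * ?u z)"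
      by (rule infsum_cong) (simp add: algebra_simps)
    also have "\<dots> = R powr (- 1 / m) * moment k + R powr (1 - 1 / m)"
      by (subst tot_add[OF fs_mult_right[OF fs_mult_left[OF fs_lazy]] fs_mult_right[OF fs_lazy]])
        (simp add: tot_cmult tot_lazy moment_def)
    also have "\<dots> \<le> R powr (- 1 / m) * R + R powr (1 - 1 / m)"
      using M by (intro add_right_mono mult_left_mono) auto
    also have "R powr (- 1 / m) * R = R powr (1 - 1 / m)"
      using powr_add[of R "- 1 / m" 1] R by simp
    finally show ?thesis by simp
  qed
  have tot_vr: "tot (\<lambda>z. ?v z * ?r (inv s \<otimes> z)) = tot (\<lambda>z. ?u z * ?r z)"
    using si by (intro tot_left[of "inv s" "\<lambda>z. ?u z * ?r z"]) auto
  have "tot (\<lambda>z. ?k z ^ 2) \<le> tot (\<lambda>z. (2 * E) * (?v z * ?r (inv s \<otimes> z) + ?u z * ?r z))"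
  proof (rule tot_mono)
    fix z assume z: "z \<in> carrier G"
    have "?k z ^ 2 = (sqrt (?v z) + sqrt (?u z)) ^ 2 * ?g z ^ 2" by (simp add: power_mult_distrib)
    also have "\<dots> \<le> (2 * (?v z + ?u z)) * ?g z ^ 2"
      by (intro mult_right_mono sqrt_sum_square_le) (auto simp: lazy_nonneg)
    also have "\<dots> = 2 * (?v z * ?g z ^ 2 + ?u z * ?g z ^ 2)" by (simp add: algebra_simps)
    also have "\<dots> \<le> 2 * (?v z * (E * ?r (inv s \<otimes> z)) + ?u z * (E * ?r z))"
      using g[OF z] by (intro mult_left_mono add_mono) (auto simp: lazy_nonneg)
    finally show "?k z ^ 2 \<le> (2 * E) * (?v z * ?r (inv s \<otimes> z) + ?u z * ?r z)" by (simp add: algebra_simps)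
  qed (intro fs_power[OF fs(2)] fs_mult_right[OF fs_add[OF ur(2) ur(1)]]; simp)+
  also have "\<dots> = (2 * E) * (tot (\<lambda>z. ?v z * ?r (inv s \<otimes> z)) + tot (\<lambda>z. ?u z * ?r z))"
    by (subst tot_cmult, subst tot_add[OF ur(2) ur(1)]) (rule refl)
  also have "\<dots> \<le> (2 * E) * (4 * R powr (1 - 1 / m))"
    using tot_ur E0 unfolding tot_vr by (intro mult_left_mono) auto
  finally have tot_k: "tot (\<lambda>z. ?k z ^ 2) \<le> 8 * E * R powr (1 - 1 / m)" by simp
  have "f (x \<otimes> s) - f x = smear k f (x \<otimes> s) - smear k f x"
    using x s by (simp add: smear_harmonic[OF harm])
  also have "\<dots> = tot (\<lambda>z. (?v z - ?u z) * ?g z)"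
    unfolding smear_def using x s by (intro conv_translate_diff) (auto simp: tot_lazy)
  finally have "\<bar>f (x \<otimes> s) - f x\<bar> \<le> tot (\<lambda>z. \<bar>(?v z - ?u z) * ?g z\<bar>)"
    using v by (simp only:) (intro tot_abs fs_mult_left fs_diff fs_lazy)
  also have "\<dots> = tot (\<lambda>z. ?d z * ?k z)"
  proof (rule infsum_cong)
    fix z
    have "\<bar>?v z - ?u z\<bar> = ?d z * (sqrt (?v z) + sqrt (?u z))"
      by (intro abs_diff_sqrt lazy_nonneg)
    then show "\<bar>(?v z - ?u z) * ?g z\<bar> = ?d z * ?k z" by (simp only: abs_mult mult.assoc)
  qed
  also have "\<dots> \<le> sqrt (tot (\<lambda>z. ?d z ^ 2)) * sqrt (tot (\<lambda>z. ?k z ^ 2))"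
    using fs by (rule tot_Cauchy_Schwarz)
  also have "tot (\<lambda>z. ?d z ^ 2) = hellinger (inv s) k" by (simp add: hellinger_def)
  finally have "\<bar>f (x \<otimes> s) - f x\<bar> ^ 2 \<le> (sqrt (hellinger (inv s) k) * sqrt (tot (\<lambda>z. ?k z ^ 2))) ^ 2"
    by (intro power_mono) auto
  also have "\<dots> = hellinger (inv s) k * tot (\<lambda>z. ?k z ^ 2)"
    using hellinger_nonneg by (simp add: power_mult_distrib tot_nonneg)
  also have "\<dots> \<le> (8 * card S * (h / n)) * (8 * E * R powr (1 - 1 / m))"
  proof (rule mult_mono[OF _ tot_k])
    have "hellinger (inv s) k \<le> 8 * card S * (entropy (Suc k) - entropy k)"
      by (rule hellinger_le_entropy[OF si])
    also have "\<dots> \<le> 8 * card S * (h / n)" using k by (intro mult_left_mono) auto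
    finally show "hellinger (inv s) k \<le> 8 * card S * (h / n)" .
  qed (use h0 in \<open>auto intro!: tot_nonneg\<close>)
  finally show ?thesis by (simp add: E_def R_def mult_ac)
qed

text \<open>At a radius with polynomial volume the entropy is at most d ln n, and the gradient bound
  becomes ln n / n times (n ln n)^\<theta>. It vanishes along these radii because \<theta> = 1 - 1/m
  < 1.\<close>

lemma harmonic_constant_of_growth:
  fixes D :: real
  assumes harm: "\<And>x. x \<in> carrier G \<Longrightarrow> nbr_avg f x = f x"
    and D: "\<And>s. s \<in> S \<Longrightarrow> lbound (\<lambda>x. \<bar>f (x \<otimes> s) - f x\<bar> ^ m) D" and m: "1 \<le> m"
    and V: "\<And>N. \<exists>n\<ge>N. real (card (word_ball n)) \<le> real n ^ d"
    and x: "x \<in> carrier G" and s: "s \<in> S"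
  shows "f (x \<otimes> s) = f x"
proof -
  define \<theta> where "\<theta> = 1 - 1 / real m"
  have \<theta>: "0 \<le> \<theta>" "\<theta> < 1" using m by (auto simp: \<theta>_def)
  define c1 where "c1 = 64 * card S * (card S * D) powr (2 / m)"
  define c2 where "c2 = 10 * real (card S) * real d"
  define \<phi> where "\<phi> n = c1 * (real d * ln (real n) / real n * (2 + c2 * (real n * ln (real n))) powr \<theta>)" for n :: nat
  have bound: "(f (x \<otimes> s) - f x) ^ 2 \<le> \<phi> n" if n: "0 < n" "real (card (word_ball n)) \<le> real n ^ d" for n
  proof -
    have "entropy n \<le> ln (card (word_ball n))" by (rule entropy_le)
    also have "\<dots> \<le> ln (real n ^ d)" using n card_ball_pos[of n] by (simp add: ln_mono)
    also have "\<dots> = real d * ln n" using n by (simp add: ln_realpow)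
    finally have "entropy n \<le> real d * ln n" .
    from harmonic_gradient_bound[OF harm D m n(1) this x s] show ?thesis
      by (simp add: \<phi>_def c1_def c2_def \<theta>_def mult_ac)
  qed
  have "c2 \<ge> 0" by (simp add: c2_def)
  then have "\<phi> \<longlonglongrightarrow> c1 * (real d * 0)"
  proof -
    assume c2: "c2 \<ge> 0"
    have "(\<lambda>n. ln (real n) / real n * (2 + c2 * (real n * ln (real n))) powr \<theta>) \<longlonglongrightarrow> 0"
    proof (rule tendsto_sandwich[OF _ _ tendsto_const])
      show "\<forall>\<^sub>F n in sequentially. 0 \<le> ln (real n) / real n * (2 + c2 * (real n * ln (real n))) powr \<theta>"
        using eventually_ge_at_top[of "1::nat"] by eventually_elim auto
      show "\<forall>\<^sub>F n in sequentially. ln (real n) / real n * (2 + c2 * (real n * ln (real n))) powr \<theta>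
          \<le> (2 + c2) powr \<theta> * (ln (real n) / real n * (real n * ln (real n)) powr \<theta>)"
        using eventually_ge_at_top[of "3::nat"]
      proof eventually_elim
        case (elim n)
        have "exp 1 \<le> (3::real)" by (rule exp_le)
        then have "1 \<le> ln (real n)" using elim by (subst ln_ge_iff) auto
        then have "1 \<le> real n * ln (real n)" using elim mult_mono[of 1 "real n" 1 "ln (real n)"] by simp
        then have "2 + c2 * (real n * ln (real n)) \<le> (2 + c2) * (real n * ln (real n))"
          by (simp add: algebra_simps)
        moreover have "0 \<le> 2 + c2 * (real n * ln (real n))" using c2 elim by simp
        ultimately have "(2 + c2 * (real n * ln (real n))) powr \<theta> \<le> ((2 + c2) * (real n * ln (real n))) powr \<theta>"
          using \<theta> by (intro powr_mono2) auto
        also have "\<dots> = (2 + c2) powr \<theta> * (real n * ln (real n)) powr \<theta>"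
          using c2 elim by (simp add: powr_mult)
        finally have "ln (real n) / real n * (2 + c2 * (real n * ln (real n))) powr \<theta>
          \<le> ln (real n) / real n * ((2 + c2) powr \<theta> * (real n * ln (real n)) powr \<theta>)"
          using elim by (intro mult_left_mono) auto
        then show ?case by (simp add: mult_ac)
      qed
      have "(\<lambda>n. ln (real n) / real n * (real n * ln (real n)) powr \<theta>) \<longlonglongrightarrow> 0"
        using \<theta> by real_asymp
      then show "(\<lambda>n. (2 + c2) powr \<theta> * (ln (real n) / real n * (real n * ln (real n)) powr \<theta>)) \<longlonglongrightarrow> 0"
        by (rule tendsto_mult_right_zero)
    qed
    then have "(\<lambda>n. c1 * (real d * (ln (real n) / real n * (2 + c2 * (real n * ln (real n))) powr \<theta>))) \<longlonglongrightarrow> c1 * (real d * 0)"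
      by (intro tendsto_intros)
    then show ?thesis by (simp add: \<phi>_def[abs_def] mult_ac)
  qed
  then have \<phi>: "\<phi> \<longlonglongrightarrow> 0" by simp
  have "(f (x \<otimes> s) - f x) ^ 2 \<le> \<epsilon>" if \<epsilon>: "0 < \<epsilon>" for \<epsilon>
  proof -
    have "\<forall>\<^sub>F n in sequentially. \<phi> n < \<epsilon>" using order_tendstoD(2)[OF \<phi> \<epsilon>] .
    then obtain N where N: "\<And>n. N \<le> n \<Longrightarrow> \<phi> n < \<epsilon>" by (auto simp: eventually_sequentially)
    obtain n where "n \<ge> max 1 N" "real (card (word_ball n)) \<le> real n ^ d" using V by blast
    then show ?thesis using bound[of n] N[of n] by auto
  qed
  then have "(f (x \<otimes> s) - f x) ^ 2 \<le> 0" using field_le_epsilon[of "(f (x \<otimes> s) - f x) ^ 2" 0] by simp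
  then show ?thesis by simp
qed

subsection \<open>Conclusion\<close>

lemma constant_of_steps:
  assumes "\<And>x s. x \<in> carrier G \<Longrightarrow> s \<in> S \<Longrightarrow> P x \<Longrightarrow> P (x \<otimes> s)" and "x0 \<in> carrier G" "P x0" and x: "x \<in> carrier G"
  shows "P x"
proof -
  have "P (x0 \<otimes> z)" if "z \<in> word_ball n" for n z
    using that
  proof (induction n arbitrary: z)
    case 0
    then show ?case using assms by simp
  next
    case (Suc n)
    then consider "z \<in> word_ball n" | y s where "y \<in> word_ball n" "s \<in> S" "z = y \<otimes> s" by auto
    then show ?case
    proof cases
      case 1
      then show ?thesis by (rule Suc.IH)
    next
      case 2
      then have "P (x0 \<otimes> y \<otimes> s)" using assms(1)[of "x0 \<otimes> y" s] Suc.IH[of y] assms(2) by auto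
      then show ?thesis using 2 assms(2) by (auto simp: m_assoc)
    qed
  qed
  moreover obtain n where "inv x0 \<otimes> x \<in> word_ball n" using carrier_ball x assms(2) by blast
  ultimately have "P (x0 \<otimes> (inv x0 \<otimes> x))" by blast
  then show ?thesis using x assms(2) by (simp add: m_assoc[symmetric])
qed

text \<open>The finite sublevel set provides a global minimum; there the nonnegative increments to
  the neighbours average to zero, so the minimal value spreads over the group.\<close>

lemma constant_of_finite_sublevel:
  assumes harm: "\<And>x. x \<in> carrier G \<Longrightarrow> nbr_avg f x = f x"
    and fin: "finite {x \<in> carrier G. f x < t}" and a: "a \<in> carrier G" "f a < t" and x: "x \<in> carrier G"
  shows "f x = f a"
proof -
  let ?W = "{x \<in> carrier G. f x < t}"
  have "Min (f ` ?W) \<in> f ` ?W" using fin a by (intro Min_in) auto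
  then obtain x0 where x0: "x0 \<in> ?W" "f x0 = Min (f ` ?W)" by auto
  have min: "f x0 \<le> f y" if "y \<in> carrier G" for y
  proof (cases "f y < t")
    case True
    then show ?thesis using x0 fin that by (auto intro: Min_le)
  qed (use x0 in auto)
  have const: "f y = f x0" if "y \<in> carrier G" for y
  proof (rule constant_of_steps[where P = "\<lambda>y. f y = f x0" and ?x0.0 = x0, OF _ _ refl that])
    fix y s assume y: "y \<in> carrier G" and s: "s \<in> S" and eq: "f y = f x0"
    have "avg (\<lambda>s. f (y \<otimes> s) - f y) = 0"
      using harm[OF y] by (simp add: avg_diff nbr_avg_def)
    moreover have "f (y \<otimes> s) - f y \<le> card S * avg (\<lambda>s. f (y \<otimes> s) - f y)"
      using s y min eq by (intro avg_ge[of "\<lambda>s. f (y \<otimes> s) - f y"]) auto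
    ultimately show "f (y \<otimes> s) = f x0" using min[of "y \<otimes> s"] y s eq by simp
  qed (use x0 in auto)
  show ?thesis using const[OF x] const[OF a(1)] by simp
qed

text \<open>If a truncation of \<open>f\<close> converges to \<open>c\<close> at infinity, then \<open>f\<close> attains its minimum or its maximum,
  according to the position of \<open>c\<close> in the truncation interval.\<close>

lemma constant_of_clamp_convergence:
  assumes harm: "\<And>x. x \<in> carrier G \<Longrightarrow> nbr_avg f x = f x"
    and conv: "\<And>\<alpha> \<beta>. \<alpha> < \<beta> \<Longrightarrow> \<exists>c. \<forall>\<epsilon>>0. finite {x \<in> carrier G. \<epsilon> < \<bar>max \<alpha> (min \<beta> (f x)) - c\<bar>}"
    and ab: "a \<in> carrier G" "b \<in> carrier G"
  shows "\<not> f a < f b"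
proof
  assume lt: "f a < f b"
  obtain c where c: "\<And>\<epsilon>. \<epsilon> > 0 \<Longrightarrow> finite {x \<in> carrier G. \<epsilon> < \<bar>max (f a) (min (f b) (f x)) - c\<bar>}"
    using conv[OF lt] by blast
  show False
  proof (cases "f a < c")
    case True
    \<comment> \<open>Points with f x < t have truncated value below t, hence farther than (c - t)/2
      from c; as f a < t, the sublevel set is nonempty.\<close>
    define t where "t = (f a + min c (f b)) / 2"
    have t: "f a < t" "t < f b" "t < c" using True lt by (auto simp: t_def min_def field_simps)
    have "finite {x \<in> carrier G. f x < t}"
      by (rule finite_subset[OF _ c[of "(c - t) / 2"]]) (use t in auto)
    from constant_of_finite_sublevel[OF harm this ab(1) t(1) ab(2)] lt show False by simp
  next
    case False
    define t where "t = (f b + max c (f a)) / 2"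
    have t: "f a < t" "t < f b" "c < t" using False lt by (auto simp: t_def max_def field_simps)
    have "finite {x \<in> carrier G. t < f x}"
      by (rule finite_subset[OF _ c[of "(t - c) / 2"]]) (use t in auto)
    then have fin: "finite {x \<in> carrier G. - f x < - t}" by simp
    have "nbr_avg (\<lambda>x. - f x) x = - f x" if "x \<in> carrier G" for x
      using harm[OF that] avg_cmult[of "-1" "\<lambda>s. f (x \<otimes> s)"] by (simp add: nbr_avg_def)
    from constant_of_finite_sublevel[OF this fin ab(2) _ ab(1)] t lt show False by simp
  qed
qed

theorem harmonic_constant:
  fixes D :: real
  assumes harm: "\<And>x. x \<in> carrier G \<Longrightarrow> nbr_avg f x = f x"
    and D: "\<And>s. s \<in> S \<Longrightarrow> lbound (\<lambda>x. \<bar>f (x \<otimes> s) - f x\<bar> ^ m) D" and m: "1 \<le> m"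
    and K: "K\<^sub>1 > 0" "K\<^sub>2 > 0" and \<gamma>: "0 < \<gamma>" "\<gamma> < 1"
    and ret: "\<And>n::nat. even n \<Longrightarrow> n \<ge> 1 \<Longrightarrow>
      return_probability (cayley_edges G S) \<one> n \<ge> K\<^sub>1 * exp (- K\<^sub>2 * real n powr \<gamma>)"
    and ab: "a \<in> carrier G" "b \<in> carrier G"
  shows "f a = f b"
proof -
  \<comment> \<open>The requirement of \<open>exists_cutoff\<close>; since 1 - \<gamma> < 1 it also
    forces m \<le> q, as the interpolation with b needs.\<close>
  obtain q :: nat where q: "2 * real m < real q * (1 - \<gamma>)"
    using \<gamma> reals_Archimedean3[of "1 - \<gamma>"] by auto
  have "real q * (1 - \<gamma>) \<le> real q * 1" using \<gamma> by (intro mult_left_mono) auto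
  then have mq: "m \<le> q" using q by linarith
  show ?thesis
  proof (cases "\<exists>c>0. \<forall>r\<ge>1. c * real r ^ (4 * q) \<le> card (word_ball r)")
    case True
    then obtain c where "c > 0" "\<And>r. 1 \<le> r \<Longrightarrow> c * real r ^ (4 * q) \<le> card (word_ball r)" by blast
    from lazy_decay[OF this] obtain C where C: "C > 0"
      "\<And>n x. 1 \<le> n \<Longrightarrow> x \<in> carrier G \<Longrightarrow> lazy n x \<le> C / (real n ^ 2) ^ q" by blast
    have q1: "1 \<le> q" using m mq by simp
    have R: "0 \<le> root q C" "root q C ^ q = C" using C q1 by (auto simp: real_root_pow_pos2)
    have conv: "\<exists>c. \<forall>\<epsilon>>0. finite {x \<in> carrier G. \<epsilon> < \<bar>max \<alpha> (min \<beta> (f x)) - c\<bar>}" if "\<alpha> < \<beta>" for \<alpha> \<beta>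
    proof (rule converges_at_infinity[OF q1 R C(2) _ _ _ m mq])
      show "0 \<le> \<beta> - \<alpha>" using that by simp
      show "\<bar>max \<alpha> (min \<beta> (f x)) - max \<alpha> (min \<beta> (f y))\<bar> \<le> \<beta> - \<alpha>" for x y
        using that by (auto simp: max_def min_def)
      show "lbound (\<lambda>x. \<bar>max \<alpha> (min \<beta> (f (x \<otimes> s))) - max \<alpha> (min \<beta> (f x))\<bar> ^ m) D" if "s \<in> S" for s
        by (rule lbound_mono[OF D[OF that] order_refl]) (intro power_mono; auto simp: max_def min_def)
      show "\<exists>k w. cutoff k w \<and> (\<forall>s\<in>S. translate_diff w s ^ q * real (k + 1) ^ m \<le> \<epsilon>)" if "\<epsilon> > 0" for \<epsilon>
        using exists_cutoff[OF K \<gamma> ret q that] .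
    qed auto
    show ?thesis
      using constant_of_clamp_convergence[OF harm conv ab]
        constant_of_clamp_convergence[OF harm conv ab(2,1)] by simp
  next
    case False
    have "\<exists>n\<ge>N. real (card (word_ball n)) \<le> real n ^ (4 * q)" for N
    proof -
      \<comment> \<open>So small a constant forces a large radius: a ball has at least one element,
        so the failing r satisfies r^(4q) > (N+1)^(4q).\<close>
      define c where "c = 1 / real (Suc N) ^ (4 * q)"
      have c: "0 < c" "c \<le> 1" by (auto simp: c_def)
      then obtain r where r: "1 \<le> r" "card (word_ball r) < c * real r ^ (4 * q)" using False by (auto simp: not_le)
      have "1 \<le> real (card (word_ball r))" using card_ball_pos[of r] by simp
      then have "1 * real (Suc N) ^ (4 * q) \<le> card (word_ball r) * real (Suc N) ^ (4 * q)"
        by (rule mult_right_mono) simp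
      also have "\<dots> < real r ^ (4 * q)" using r by (simp add: c_def less_divide_eq del: of_nat_Suc)
      finally have "real (Suc N) ^ (4 * q) < real r ^ (4 * q)" by simp
      then have "Suc N < r" using power_less_imp_less_base by fastforce
      moreover have "c * real r ^ (4 * q) \<le> 1 * real r ^ (4 * q)" using c by (intro mult_right_mono) auto
      ultimately have "N \<le> r" "real (card (word_ball r)) \<le> real r ^ (4 * q)" using r by linarith+
      then show ?thesis by blast
    qed
    from harmonic_constant_of_growth[OF harm D m this]
    have step: "x \<in> carrier G \<Longrightarrow> s \<in> S \<Longrightarrow> f (x \<otimes> s) = f x" for x s .
    show ?thesis
      by (rule constant_of_steps[where P = "\<lambda>y. f y = f b" and ?x0.0 = b, OF _ ab(2) refl ab(1)]) (simp add: step)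
  qed
qed

text \<open>An l^p gradient is bounded, hence lies in l^m for every integer m \<ge> p; from here on
  only integer powers of the gradient occur.\<close>

lemma lbound_of_in_lp:
  assumes lp: "in_lp p (cayley_edges G S) (gradient f)" and p: "1 < p" and m: "p \<le> real m"
  shows "\<exists>D. \<forall>s\<in>S. lbound (\<lambda>x. \<bar>f (x \<otimes> s) - f x\<bar> ^ m) D"
proof -
  define K where "K = infsum (\<lambda>a. \<bar>gradient f a\<bar> powr p) (cayley_edges G S)"
  \<comment> \<open>A uniform bound for the single increments, because one term of the sum is at
    most K.\<close>
  define c where "c = max 1 (K powr (1 / p))"
  have sum: "(\<Sum>x\<in>W. \<bar>f (x \<otimes> s) - f x\<bar> powr p) \<le> K" if s: "s \<in> S" and W: "finite W" "W \<subseteq> carrier G" for s W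
  proof -
    have "(\<Sum>x\<in>W. \<bar>f (x \<otimes> s) - f x\<bar> powr p) = (\<Sum>a\<in>(\<lambda>x. (x, x \<otimes> s)) ` W. \<bar>gradient f a\<bar> powr p)"
      by (subst sum.reindex) (auto simp: inj_on_def gradient_def)
    also have "\<dots> \<le> K"
      unfolding K_def using lp s W by (intro finite_sum_le_infsum) (auto simp: in_lp_def cayley_edges_def)
    finally show ?thesis .
  qed
  have "lbound (\<lambda>x. \<bar>f (x \<otimes> s) - f x\<bar> ^ m) (c powr (m - p) * K)" if s: "s \<in> S" for s
  proof (rule lbound_mono[OF lbound_cmult[OF lboundI[OF sum[OF s]]] order_refl])
    fix x assume x: "x \<in> carrier G"
    let ?t = "\<bar>f (x \<otimes> s) - f x\<bar>"
    have m1: "0 < m" using m p by (cases m) auto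
    show "?t ^ m \<le> c powr (m - p) * ?t powr p"
    proof (cases "?t = 0")
      case False
      then have t: "0 < ?t" by simp
      have "?t powr p \<le> K" using sum[OF s, of "{x}"] x by simp
      then have "(?t powr p) powr (1 / p) \<le> K powr (1 / p)" using p by (intro powr_mono2) auto
      then have "?t \<le> c" using p t by (simp add: powr_powr c_def)
      have "?t ^ m = ?t powr (m - p) * ?t powr p" using t by (simp add: powr_realpow flip: powr_add)
      also have "\<dots> \<le> c powr (m - p) * ?t powr p"
        using \<open>?t \<le> c\<close> t m by (intro mult_right_mono powr_mono2) auto
      finally show ?thesis .
    qed (use m1 in \<open>simp add: power_0_left\<close>)
  qed auto
  then show ?thesis by blast
qed

end

theorem theorem1p1:
  fixes G :: "('a, 'b) monoid_scheme"
    and S :: "'a set"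
    and K\<^sub>1 K\<^sub>2 \<gamma> p :: real
  assumes "group G"
    and "finite S"
    and "symmetric_generating_set G S"
    and "K\<^sub>1 > 0" and "K\<^sub>2 > 0"
    and "0 < \<gamma>" and "\<gamma> < 1"
    and "\<And>n::nat. even n \<Longrightarrow> n \<ge> 1 \<Longrightarrow>
           return_probability (cayley_edges G S) \<one>\<^bsub>G\<^esub> n \<ge> K\<^sub>1 * exp (- K\<^sub>2 * real n powr \<gamma>)"
    and "1 < p"
  shows "\<not> (\<exists>f :: 'a \<Rightarrow> real.
             harmonic_on (carrier G) (cayley_edges G S) f \<and>
             in_lp p (cayley_edges G S) (gradient f) \<and>
             \<not> f constant_on carrier G)"
proof (intro notI, elim exE conjE)
  fix f :: "'a \<Rightarrow> real"
  assume harm: "harmonic_on (carrier G) (cayley_edges G S) f"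
    and lp: "in_lp p (cayley_edges G S) (gradient f)" and nc: "\<not> f constant_on carrier G"
  interpret group G by fact
  have "S \<noteq> {}"
  proof
    assume "S = {}"
    then have "carrier G = {\<one>\<^bsub>G\<^esub>}"
      using assms(3) by (simp add: symmetric_generating_set_def generate_empty)
    then show False using nc by (auto simp: constant_on_def)
  qed
  then interpret cayley_graph G S
    using assms(2,3) by unfold_locales (auto simp: symmetric_generating_set_def)
  obtain m :: nat where m: "p \<le> real m" using real_arch_simple by blast
  then have m1: "1 \<le> m" using assms(9) by linarith
  obtain D where D: "\<And>s. s \<in> S \<Longrightarrow> lbound (\<lambda>x. \<bar>f (x \<otimes>\<^bsub>G\<^esub> s) - f x\<bar> ^ m) D"
    using lbound_of_in_lp[OF lp assms(9) m] by blast
  have "nbr_avg f x = f x" if "x \<in> carrier G" for x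
    using harm that unfolding harmonic_on_def by (metis neighbours_average)
  from harmonic_constant[OF this D m1 assms(4-8)]
  have "f a = f b" if "a \<in> carrier G" "b \<in> carrier G" for a b using that by blast
  then show False using nc unfolding constant_on_def by (metis one_closed)
qed

end
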